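(* Let $N\ge 20$ be an integer, $M\in\mathbb N$, $c_1,\dots,c_M\in\mathbb R$, and let $\mathcal C=\{x_1,\dots,x_M\}\subset SO(3)$ consist of pairwise distinct rotations with separation distance $$\rho(\mathcal C):=\min_{x_i\neq x_j}\omega(x_j^{-1}x_i)\ \ge\ \frac{36}{N+1}.$$ Let $\mu^*=\sum_{i=1}^M c_i\delta_{x_i}$. Then $\mu^*$ is the unique solution of $$\min_{\mu\in\mathcal M(SO(3))}\|\mu\|_{TV}\quad\text{subject to}\quad \langle \mu,D^l_{k,m}\rangle=\langle\mu^*,D^l_{k,m}\rangle\ \text{ for all } 0\le l\le N,\ -l\le k,m\le l .$$
   Context: $SO(3)=\{x\in\mathbb R^{3\times 3}: x^Tx=I,\ \det x=1\}$. For $x\in SO(3)$, $\omega(x)=\arccos\big((\operatorname{tr}(x)-1)/2\big)\in[0,\pi]$ is its rotation angle; $d(x,y)=\omega(y^{-1}x)$ is a bi-invariant metric on $SO(3)$. The Wigner D-functions $D^l_{k,m}$ ($l\in\mathbb N_0$, $-l\le k,m\le l$) are the matrix coefficients of the irreducible unitary representations of $SO(3)$ (of dimension $2l+1$), normalized so that $\{\sqrt{2l+1}D^l_{k,m}\}$ is an orthonormal basis of $L^2(SO(3))$ with respect to the normalized Haar measure; in Euler angles $x=R_Z(\alpha)R_X(\beta)R_Z(\gamma)$ one has $D^l_{k,m}(x)=e^{-ik\alpha}P^l_{k,m}(\cos\beta)e^{-im\gamma}$ with the standard Wigner $d$-functions $P^l_{k,m}$. $\mathcal M(SO(3))$ denotes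 the real (signed) finite regular Borel measures on $SO(3)$, $\langle\mu,f\rangle=\int_{SO(3)}f\,d\mu$, and $\|\mu\|_{TV}=|\mu|(SO(3))=\sup\sum_j|\mu(B_j)|$, the supremum over all finite Borel partitions $(B_j)$ of $SO(3)$. $\delta_x$ is the Dirac measure at $x$. *)

theory Defs
  imports "HOL-Analysis.Analysis"
begin

definition SO3 :: "(real^3^3) set" where
  "SO3 = {x. transpose x ** x = mat 1 \<and> det x = 1}"

definition rot_angle :: "real^3^3 \<Rightarrow> real" where
  "rot_angle x = arccos ((trace x - 1) / 2)"

definition so3_dist :: "real^3^3 \<Rightarrow> real^3^3 \<Rightarrow> real" where
  "so3_dist x y = rot_angle (matrix_inv y ** x)"

text \<open>Elementary rotations (row-major: A\$i\$j is row i, column j).\<close>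
definition RZ :: "real \<Rightarrow> real^3^3" where
  "RZ a = vector [vector [cos a, - sin a, 0], vector [sin a, cos a, 0], vector [0, 0, 1]]"

definition RX :: "real \<Rightarrow> real^3^3" where
  "RX b = vector [vector [1, 0, 0], vector [0, cos b, - sin b], vector [0, sin b, cos b]]"

text \<open>Standard Wigner small d-function d^l_{k,m}(beta) (Wigner's explicit formula).\<close>
definition wigner_d :: "nat \<Rightarrow> int \<Rightarrow> int \<Rightarrow> real \<Rightarrow> real" where
  "wigner_d l k m \<beta> =
     (\<Sum>s \<in> {max 0 (m - k) .. min (int l + m) (int l - k)}.
        (-1) ^ nat (k - m + s) *
        sqrt (fact (nat (int l + k)) * fact (nat (int l - k)) * fact (nat (int l + m)) * fact (nat (int l - m))) /
        (fact (nat (int l + m - s)) * fact (nat s) * fact (nat (k - m + s)) * fact (nat (int l - k - s))) *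
        cos (\<beta> / 2) ^ nat (2 * int l + m - k - 2 * s) *
        sin (\<beta> / 2) ^ nat (k - m + 2 * s))"

definition wigner_P :: "nat \<Rightarrow> int \<Rightarrow> int \<Rightarrow> real \<Rightarrow> real" where
  "wigner_P l k m t = wigner_d l k m (arccos t)"

text \<open>D^l_{k,m}(x) = e^{-ik alpha} P^l_{k,m}(cos beta) e^{-im gamma} for x = RZ(alpha) RX(beta) RZ(gamma)
  (the value does not depend on the choice of Euler angles).\<close>
definition wigner_D :: "nat \<Rightarrow> int \<Rightarrow> int \<Rightarrow> real^3^3 \<Rightarrow> complex" where
  "wigner_D l k m x = (SOME z. \<exists>\<alpha> \<beta> \<gamma>. x = RZ \<alpha> ** RX \<beta> ** RZ \<gamma> \<and> 0 \<le> \<beta> \<and> \<beta> \<le> pi \<and>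
      z = exp (- \<i> * of_int k * of_real \<alpha>) * of_real (wigner_P l k m (cos \<beta>)) * exp (- \<i> * of_int m * of_real \<gamma>))"

definition SO3_borel :: "(real^3^3) measure" where
  "SO3_borel = restrict_space borel SO3"

text \<open>A finite (positive) Borel measure on SO(3).  Every real finite signed Borel measure on
  SO(3) is P - Q for such P, Q (Jordan decomposition); regularity is automatic on the compact
  metric space SO(3).\<close>
definition fin_borel_SO3 :: "(real^3^3) measure \<Rightarrow> bool" where
  "fin_borel_SO3 P \<longleftrightarrow> sets P = sets SO3_borel \<and> finite_measure P"

definition smeas :: "(real^3^3) measure \<Rightarrow> (real^3^3) measure \<Rightarrow> (real^3^3) set \<Rightarrow> real" where
  "smeas P Q A = measure P A - measure Q A"

definition spair :: "(real^3^3) measure \<Rightarrow> (real^3^3) measure \<Rightarrow> (real^3^3 \<Rightarrow> complex) \<Rightarrow> complex" where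
  "spair P Q f = (\<integral>x. f x \<partial>P) - (\<integral>x. f x \<partial>Q)"

definition borel_partition :: "(real^3^3) set set \<Rightarrow> bool" where
  "borel_partition \<B> \<longleftrightarrow> finite \<B> \<and> \<B> \<subseteq> sets SO3_borel \<and> \<Union>\<B> = SO3 \<and>
     (\<forall>A\<in>\<B>. \<forall>B\<in>\<B>. A \<noteq> B \<longrightarrow> A \<inter> B = {})"

definition tv_norm :: "((real^3^3) set \<Rightarrow> real) \<Rightarrow> real" where
  "tv_norm \<nu> = Sup {(\<Sum>B\<in>\<B>. \<bar>\<nu> B\<bar>) | \<B>. borel_partition \<B>}"

definition discrete_smeas :: "nat \<Rightarrow> (nat \<Rightarrow> real) \<Rightarrow> (nat \<Rightarrow> real^3^3) \<Rightarrow> (real^3^3) set \<Rightarrow> real" where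
  "discrete_smeas M c x A = (\<Sum>i<M. c i * indicator A (x i))"

end

theory Submission
  imports Defs
begin

text \<open>
  The proof is by duality. A rotation is lifted to a unit quaternion \<open>y\<close>, determined up to sign.
  Writing \<open>a = y\<^sub>1 - \<i> y\<^sub>4\<close> and \<open>b = y\<^sub>2 - \<i> y\<^sub>3\<close>, the function \<open>D\<^sup>l\<^bsub>k,m\<^esub>\<close> is an alternating sum of
  monomials of degree \<open>2l\<close> in \<open>a\<close>, \<open>b\<close> and their conjugates; since \<open>|a|\<^sup>2 + |b|\<^sup>2 = 1\<close>, a triangularity
  argument shows that the \<open>D\<^sup>l\<^bsub>k,m\<^esub>\<close> with \<open>l \<le> N\<close> span all even polynomials of degree at most \<open>2N\<close> on the
  3-sphere. For prescribed signs \<open>u\<^sub>j = \<plusminus>1\<close> at the lifted nodes \<open>p\<^sub>j\<close>, the dual certificate is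
  \<open>q y = \<Sum>\<^sub>i (\<alpha>\<^sub>i + \<langle>b\<^sub>i, y\<rangle> \<langle>p\<^sub>i, y\<rangle>) (U\<^bsub>m-1\<^esub>(\<langle>p\<^sub>i, y\<rangle>) / m)\<^sup>8\<close> with \<open>m = (N + 3) div 4\<close> and \<open>U\<close> the Chebyshev
  polynomials of the second kind. The coefficients solve \<open>q p\<^sub>j = u\<^sub>j\<close>, \<open>\<nabla>q p\<^sub>j = 0\<close>; the system is a
  perturbation of the identity because the separation makes the mutual interference small, which is
  quantified by a packing bound after stereographic projection to three dimensions. Second-order
  Taylor expansion near the nodes and the decay of the kernel away from them give \<open>|q| < 1\<close> off the
  nodes. Pairing \<open>q\<close> with the measures and using a Hahn decomposition yields optimality and
  uniqueness.
\<close>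

section \<open>Chebyshev kernel\<close>

text \<open>A quaternion lift is determined only up to sign, so a certificate has to be an even
  function on the 3-sphere: hence the even power of the kernel, and the factor <p,y> beside the
  tangential term <b,y>. The exponent 8 balances two demands. With x the sine of the angle to a
  node, scaled by m, the terms decay like x^(-8) or x^(-7), while the number of nodes up to scaled
  distance R grows only like R^3, so the interference sums are small even after two
  differentiations. On the other hand the degree 2 + 8(m - 1) may not exceed 2N, which forces m to
  be about N/4. A rotation angle is twice the angle between the quaternion lines, so the separation
  becomes 18/(N + 1), hence at least \<delta> = 18/(4m + 1). From N \<ge> 20 follows m \<ge> 5, and
  then m \<delta> \<ge> 30/7 and \<delta> \<le> 6/7; the numerical constants of the interference
  estimates go back to these two bounds. Uniqueness needs certificates for two sign patterns:
  strictness off the nodes confines a minimizer to the nodes, and a second choice of signs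
  identifies its weights.\<close>

fun chebU :: "nat \<Rightarrow> real \<Rightarrow> real" where
  "chebU 0 t = 0"
| "chebU (Suc 0) t = 1"
| "chebU (Suc (Suc n)) t = 2 * t * chebU (Suc n) t - chebU n t"

text \<open>The index is shifted by one: for positive n, \<open>chebU n\<close> is the Chebyshev
  polynomial of the second kind of degree n - 1. With the value 0 at n = 0 the sine quotient needs
  no offset.\<close>

lemma chebU_cos: "chebU n (cos \<theta>) * sin \<theta> = sin (real n * \<theta>)"
proof (induction n "cos \<theta>" rule: chebU.induct)
  case (3 n)
  have "chebU (Suc (Suc n)) (cos \<theta>) * sin \<theta> = 2 * cos \<theta> * (chebU (Suc n) (cos \<theta>) * sin \<theta>) - chebU n (cos \<theta>) * sin \<theta>"
    by (simp add: algebra_simps)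
  also have "\<dots> = 2 * cos \<theta> * sin (real n * \<theta> + \<theta>) - sin (real n * \<theta>)"
    using 3 by (simp add: algebra_simps)
  also have "\<dots> = sin ((real n * \<theta> + \<theta>) + \<theta>)"
  proof -
    have "sin (real n * \<theta>) = sin ((real n * \<theta> + \<theta>) - \<theta>)" by simp
    also have "\<dots> = sin (real n * \<theta> + \<theta>) * cos \<theta> - cos (real n * \<theta> + \<theta>) * sin \<theta>"
      by (rule sin_diff)
    finally show ?thesis unfolding sin_add[of "real n * \<theta> + \<theta>" \<theta>] by simp
  qed
  finally show ?case by (simp add: algebra_simps)
qed auto

lemma chebU_uminus: "chebU n (- t) = (- 1) ^ Suc n * chebU n t"
  by (induction n t rule: chebU.induct) (auto simp: algebra_simps)

lemma chebU_one: "chebU n 1 = real n"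
  by (induction n "1::real" rule: chebU.induct) auto

definition ker :: "nat \<Rightarrow> real \<Rightarrow> real" where
  "ker m t = chebU m t / real m"

text \<open>\<open>ker1\<close> and \<open>ker2\<close> are the first two derivatives of
  \<open>ker m\<close> in closed form: the derivative of U is expressed through U and the first-kind
  polynomial \<open>cos (real m * arccos t)\<close>, and the second derivative is Chebyshev's
  equation (1 - t^2) U'' = 3 t U' - (m^2 - 1) U solved for U''. The denominators confine their use
  to |t| < 1.\<close>

definition ker1 :: "nat \<Rightarrow> real \<Rightarrow> real" where
  "ker1 m t = (t * ker m t - cos (real m * arccos t)) / (1 - t\<^sup>2)"

definition ker2 :: "nat \<Rightarrow> real \<Rightarrow> real" where
  "ker2 m t = (3 * t * ker1 m t - ((real m)\<^sup>2 - 1) * ker m t) / (1 - t\<^sup>2)"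

lemma ker_arccos:
  assumes "\<bar>t\<bar> < 1"
  shows "ker m t = sin (real m * arccos t) / (real m * sqrt (1 - t\<^sup>2))"
proof -
  have "1 - t\<^sup>2 > 0" using assms by (simp add: abs_square_less_1)
  moreover have "chebU m t * sqrt (1 - t\<^sup>2) = sin (real m * arccos t)"
    using chebU_cos[of m "arccos t"] assms by (simp add: cos_arccos_abs sin_arccos_abs)
  ultimately have "chebU m t = sin (real m * arccos t) / sqrt (1 - t\<^sup>2)"
    by (subst nonzero_eq_divide_eq) auto
  then show ?thesis by (simp add: ker_def)
qed

lemma ker_even_power: "even k \<Longrightarrow> ker m (- t) ^ k = ker m t ^ k"
  by (auto simp: ker_def chebU_uminus power_divide power_mult_distrib power_mult[symmetric])

lemma DERIV_ker:
  assumes t: "\<bar>t\<bar> < 1" and m: "m > 0"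
  shows "(ker m has_real_derivative ker1 m t) (at t)"
    and "(ker1 m has_real_derivative ker2 m t) (at t)"
proof -
  have S: "1 - u\<^sup>2 > 0" if "\<bar>u\<bar> < 1" for u :: real using that by (simp add: abs_square_less_1)
  define s where "s = sqrt (1 - t\<^sup>2)"
  have s: "s > 0" using S[OF t] by (simp add: s_def)
  have opn: "open {-1<..<1::real}" by simp
  have tin: "t \<in> {-1<..<1}" using t by auto
  have d1: "((\<lambda>t. sin (real m * arccos t) / (real m * sqrt (1 - t\<^sup>2))) has_real_derivative ker1 m t) (at t)"
    if t: "\<bar>t\<bar> < 1" for t
  proof -
    define s where "s = sqrt (1 - t\<^sup>2)"
    have s: "s > 0" "s\<^sup>2 = 1 - t\<^sup>2" "s * s = 1 - t\<^sup>2" using S[OF t] by (auto simp: s_def)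
    have e: "inverse (- sqrt (1 - t\<^sup>2)) = - 1 / s" "inverse (sqrt (1 - t\<^sup>2)) = 1 / s"
      by (simp_all add: s_def divide_inverse)
    show ?thesis
      apply (rule derivative_eq_intros refl | use t S[OF t] m in force)+
      unfolding ker1_def ker_arccos[OF t] e s_def[symmetric]
      using s(1) m apply (simp add: divide_simps s(2)[symmetric])
      apply (simp add: power2_eq_square algebra_simps)
      done
  qed
  have eq: "ker m u = sin (real m * arccos u) / (real m * sqrt (1 - u\<^sup>2))" if "u \<in> {-1<..<1}" for u
    using that by (intro ker_arccos) auto
  show *: "(ker m has_real_derivative ker1 m t) (at t)"
    using has_field_derivative_transform_within_open[OF d1[OF t] opn tin] eq by simp
  define C where "C = cos (real m * arccos t)"
  have snm: "sin (real m * arccos t) = real m * s * ker m t"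
    using eq[OF tin] s m by (simp add: s_def)
  have e: "inverse (- sqrt (1 - t\<^sup>2)) = - 1 / s"
    by (simp add: s_def divide_inverse)
  have k1: "ker1 m t * (1 - t\<^sup>2) = t * ker m t - C"
    using S[OF t] by (simp add: ker1_def C_def)
  have dC: "((\<lambda>t. cos (real m * arccos t)) has_real_derivative (real m)\<^sup>2 * ker m t) (at t)"
    apply (rule derivative_eq_intros refl | use t in force)+
    unfolding e snm using s m by (simp add: power2_eq_square)
  have "((\<lambda>t. (t * ker m t - cos (real m * arccos t)) / (1 - t\<^sup>2)) has_real_derivative
     (((1 * ker m t + ker1 m t * t) - (real m)\<^sup>2 * ker m t) * (1 - t\<^sup>2) - (t * ker m t - cos (real m * arccos t)) * (0 - 2 * t)) / ((1 - t\<^sup>2) * (1 - t\<^sup>2))) (at t)"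
  proof (rule DERIV_divide)
    show "((\<lambda>t. t * ker m t - cos (real m * arccos t)) has_real_derivative 1 * ker m t + ker1 m t * t - (real m)\<^sup>2 * ker m t) (at t)"
      by (rule DERIV_diff[OF DERIV_mult[OF DERIV_ident *] dC])
    show "((\<lambda>t. 1 - t\<^sup>2) has_real_derivative 0 - 2 * t) (at t)"
      by (rule derivative_eq_intros refl)+ simp
    show "1 - t\<^sup>2 \<noteq> 0" using S[OF t] by simp
  qed
  moreover have "(((1 * ker m t + ker1 m t * t) - (real m)\<^sup>2 * ker m t) * (1 - t\<^sup>2) - (t * ker m t - C) * (0 - 2 * t)) / ((1 - t\<^sup>2) * (1 - t\<^sup>2)) = ker2 m t"
  proof -
    have "((1 * ker m t + ker1 m t * t) - (real m)\<^sup>2 * ker m t) * (1 - t\<^sup>2) - (t * ker m t - C) * (0 - 2 * t)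
       = (3 * t * ker1 m t - ((real m)\<^sup>2 - 1) * ker m t) * (1 - t\<^sup>2)"
      unfolding k1[symmetric] by (simp add: algebra_simps)
    then show ?thesis using S[OF t] by (simp add: ker2_def)
  qed
  ultimately show "(ker1 m has_real_derivative ker2 m t) (at t)"
    by (simp add: ker1_def[abs_def] C_def)
qed

text \<open>Sine and cosine of m \<theta> are replaced by 1, so only m and S = sin \<theta> remain.
  The last bound carries the factor S^2 because \<open>ker2\<close> always meets the square of a
  tangential component of size at most S.\<close>

lemma ker_bounds:
  assumes t: "\<bar>t\<bar> < 1" and m: "m > 0"
  defines "S \<equiv> sqrt (1 - t\<^sup>2)"
  shows "\<bar>ker m t\<bar> \<le> 1 / (real m * S)"
    and "\<bar>ker1 m t\<bar> \<le> (1 + 1 / (real m * S)) / S\<^sup>2"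
    and "\<bar>ker2 m t\<bar> * S\<^sup>2 \<le> 3 * ((1 + 1 / (real m * S)) / S\<^sup>2) + (real m)\<^sup>2 * (1 / (real m * S))"
proof -
  have "1 - t\<^sup>2 > 0" using t by (simp add: abs_square_less_1)
  then have S: "S > 0" "S\<^sup>2 = 1 - t\<^sup>2" by (auto simp: S_def)
  show k: "\<bar>ker m t\<bar> \<le> 1 / (real m * S)"
    using m S(1) unfolding ker_arccos[OF t] S_def[symmetric] by (simp add: abs_mult divide_right_mono)
  have "\<bar>t * ker m t\<bar> \<le> 1 * (1 / (real m * S))"
    unfolding abs_mult using t k by (intro mult_mono) auto
  then have "\<bar>t * ker m t - cos (real m * arccos t)\<bar> \<le> 1 + 1 / (real m * S)"
    using abs_cos_le_one[of "real m * arccos t"] by linarith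
  then show k1: "\<bar>ker1 m t\<bar> \<le> (1 + 1 / (real m * S)) / S\<^sup>2"
    unfolding ker1_def S(2)[symmetric] abs_divide by (intro frac_le) (use S(1) in auto)
  have "\<bar>t * ker1 m t\<bar> \<le> 1 * ((1 + 1 / (real m * S)) / S\<^sup>2)"
    unfolding abs_mult using t k1 by (intro mult_mono) auto
  moreover have "\<bar>((real m)\<^sup>2 - 1) * ker m t\<bar> \<le> (real m)\<^sup>2 * (1 / (real m * S))"
  proof -
    have "(real m)\<^sup>2 \<ge> 1" using m by simp
    then show ?thesis unfolding abs_mult using k m by (intro mult_mono) auto
  qed
  ultimately have "\<bar>3 * t * ker1 m t - ((real m)\<^sup>2 - 1) * ker m t\<bar> \<le> 3 * ((1 + 1 / (real m * S)) / S\<^sup>2) + (real m)\<^sup>2 * (1 / (real m * S))"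
    unfolding mult.assoc[of 3] by linarith
  then show "\<bar>ker2 m t\<bar> * S\<^sup>2 \<le> 3 * ((1 + 1 / (real m * S)) / S\<^sup>2) + (real m)\<^sup>2 * (1 / (real m * S))"
    unfolding ker2_def S(2)[symmetric] using S(1) by (simp add: abs_divide)
qed

section \<open>Taylor estimates of the kernel near its peak\<close>

lemma sin_taylor_bounds:
  fixes x :: real
  assumes "x \<ge> 0"
  shows "x - x ^ 3 / 6 \<le> sin x" "sin x \<le> x - x ^ 3 / 6 + x ^ 5 / 120"
proof -
  have "\<bar>sin x - x\<bar> \<le> x ^ 3 / 6" "\<bar>sin x - (x - x ^ 3 / 6)\<bar> \<le> x ^ 5 / 120"
    using Maclaurin_sin_bound[of x 3] Maclaurin_sin_bound[of x 5] assms
    by (simp_all add: lessThan_nat_numeral lessThan_Suc sin_coeff_def fact_numeral field_simps)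
  then show "x - x ^ 3 / 6 \<le> sin x" "sin x \<le> x - x ^ 3 / 6 + x ^ 5 / 120" by linarith+
qed

text \<open>The kernel is sin x / (m sin (x/m)), close to sin x / x and hence to 1 - x^2/6.
  Replacing m sin (x/m) by x - x^3/150, legitimate for m \<ge> 5, lowers the coefficient 1/6 by
  1/150; the further slack down to 148/1000 absorbs the x^5 term up to x = 6/5.\<close>

lemma ker_near_bounds:
  assumes m: "m \<ge> 5" and x: "0 < x" "x \<le> 6 / 5"
  shows "0 \<le> ker m (cos (x / m))" "ker m (cos (x / m)) \<le> 1 - 148 / 1000 * x\<^sup>2"
    and "1 - x\<^sup>2 / 6 \<le> ker m (cos (x / m))"
proof -
  define s where "s = sin (x / m)"
  have m0: "real m \<ge> 5" using m by simp
  have xm: "0 < x / m" "x / m \<le> x / 5" using x m0 divide_left_mono[of 5 "real m" x] by simp_all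
  have "x / m < pi" using xm x pi_gt3 by linarith
  then have s: "s > 0" unfolding s_def by (intro sin_gt_zero) (use xm in auto)
  have k: "ker m (cos (x / m)) = sin x / (m * s)"
    using chebU_cos[of m "x / m"] s m0 unfolding s_def ker_def by (simp add: field_simps)
  have "x < pi" using x pi_gt3 by linarith
  then have sx: "sin x > 0" using x by (intro sin_gt_zero) auto
  show "0 \<le> ker m (cos (x / m))" using k s sx by simp
  have "s \<le> x / m" unfolding s_def using xm by (intro sin_x_le_x) auto
  then have ms: "m * s \<le> x" using m0 by (simp add: field_simps)
  have "1 - x\<^sup>2 / 6 = (x - x ^ 3 / 6) / x" using x by (simp add: field_simps power2_eq_square power3_eq_cube)
  also have "\<dots> \<le> sin x / x" using sin_taylor_bounds[of x] x by (intro divide_right_mono) auto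
  also have "\<dots> \<le> sin x / (m * s)" using ms s sx m0 x by (intro divide_left_mono) auto
  finally show "1 - x\<^sup>2 / 6 \<le> ker m (cos (x / m))" unfolding k .
  have "x / m - (x / m) ^ 3 / 6 \<le> s" unfolding s_def using xm by (intro sin_taylor_bounds) auto
  then have "m * (x / m - (x / m) ^ 3 / 6) \<le> m * s" using m0 by (intro mult_left_mono) auto
  moreover have "m * (x / m - (x / m) ^ 3 / 6) = x - x ^ 3 / (6 * (real m)\<^sup>2)"
    using m0 by (simp add: field_simps power2_eq_square power3_eq_cube)
  moreover have "x ^ 3 / (6 * (real m)\<^sup>2) \<le> x ^ 3 / 150"
    using power_mono[OF m0, of 2] x m0 by (intro divide_left_mono) auto
  ultimately have lo: "x - x ^ 3 / 150 \<le> m * s" by linarith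
  have x2: "x\<^sup>2 \<le> 36 / 25" using power_mono[OF x(2), of 2] x(1) by (simp add: power_divide)
  have "sin x \<le> x - x ^ 3 / 6 + x ^ 5 / 120" using x sin_taylor_bounds by simp
  also have "\<dots> \<le> (1 - 148 / 1000 * x\<^sup>2) * (x - x ^ 3 / 150)"
  proof -
    have "0 \<le> x ^ 3 * (1 / 6 - 1 / 150 - 148 / 1000 - (1 / 120 - 148 / 150000) * x\<^sup>2)"
      using x x2 by (intro mult_nonneg_nonneg) auto
    also have "\<dots> = (1 - 148 / 1000 * x\<^sup>2) * (x - x ^ 3 / 150) - (x - x ^ 3 / 6 + x ^ 5 / 120)"
      by (simp add: field_simps power_numeral_reduce)
    finally show ?thesis by simp
  qed
  also have "\<dots> \<le> (1 - 148 / 1000 * x\<^sup>2) * (m * s)"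
    using lo x2 by (intro mult_left_mono) auto
  finally show "ker m (cos (x / m)) \<le> 1 - 148 / 1000 * x\<^sup>2"
    unfolding k using s m0 by (subst pos_divide_le_eq) auto
qed

section \<open>Packing on the 3-sphere\<close>

text \<open>Volume comparison: the balls of radius h around the points are disjoint and lie in the
  ball of radius R + h.\<close>

lemma packing_card_le:
  fixes W :: "'a::euclidean_space set"
  assumes fin: "finite W" and sub: "W \<subseteq> cball 0 R" and h: "h > 0" and R: "R \<ge> 0"
    and sep: "\<And>v w. v \<in> W \<Longrightarrow> w \<in> W \<Longrightarrow> v \<noteq> w \<Longrightarrow> dist v w \<ge> 2 * h"
  shows "real (card W) * h ^ DIM('a) \<le> (R + h) ^ DIM('a)"
proof -
  let ?U = "measure lborel (ball (0::'a) 1)"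
  have U: "?U > 0" by simp
  have disj: "pairwise (\<lambda>v w. disjnt (ball v h) (ball w h)) W"
  proof (clarsimp simp: pairwise_def disjnt_iff)
    fix v w x assume "v \<in> W" "w \<in> W" "v \<noteq> w" "dist v x < h" "dist w x < h"
    then show False
      using sep[of v w] dist_triangle[of v w x] by (simp add: dist_commute)
  qed
  have "real (card W) * (h ^ DIM('a) * ?U) = (\<Sum>w\<in>W. measure lborel (ball w h))"
    using h by (simp add: content_ball_conv_unit_ball[of h])
  also have "\<dots> = measure lborel (\<Union>w\<in>W. ball w h)"
    by (rule measure_UNION'[symmetric]) (use fin disj in \<open>auto simp: fmeasurable_def emeasure_lborel_ball_finite infinity_ennreal_def[symmetric] simp del: infinity_ennreal_def\<close>)
  also have "\<dots> \<le> measure lborel (ball (0::'a) (R + h))"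
  proof (rule measure_mono_fmeasurable)
    show "(\<Union>w\<in>W. ball w h) \<subseteq> ball 0 (R + h)"
    proof clarsimp
      fix w x assume "w \<in> W" "dist w x < h"
      then show "norm x < R + h"
        using subsetD[OF sub, of w] norm_triangle_ineq4[of w "w - x"] by (simp add: dist_norm)
    qed
  qed (auto intro!: borel_open simp: fmeasurable_def emeasure_lborel_ball_finite infinity_ennreal_def[symmetric] simp del: infinity_ennreal_def)
  also have "\<dots> = (R + h) ^ DIM('a) * ?U"
    using R h by (simp add: content_ball_conv_unit_ball[of "R + h"])
  finally show ?thesis using U by (simp add: mult.assoc[symmetric])
qed

text \<open>
  If \<open>t\<close> is the inner product of two unit vectors and \<open>\<theta> \<le> \<pi>/2\<close> the angle between the lines they span, then
  \<open>half_tan t = tan (\<theta>/2)\<close>, the radius of one line after stereographic projection centred at the other.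
\<close>
definition half_tan :: "real \<Rightarrow> real" where
  "half_tan t = sqrt ((1 - \<bar>t\<bar>) / (1 + \<bar>t\<bar>))"

text \<open>An isometry moves y to the first axis, and each line is represented by its unit vector P
  in the closed hemisphere around that axis. Stereographic projection from the antipode of y divides
  the chord between two points by the root of (1 + t)(1 + u), at most 2. The chords are at least 2s
  long, so the images in dimension three are s apart and packing with balls of radius s/2
  applies.\<close>

lemma stereographic_card_le:
  fixes y :: "real^4" and p :: "'i \<Rightarrow> real^4"
  assumes fin: "finite I" and y: "norm y = 1" and p: "\<And>i. i \<in> I \<Longrightarrow> norm (p i) = 1"
    and sep: "\<And>i j. i \<in> I \<Longrightarrow> j \<in> I \<Longrightarrow> i \<noteq> j \<Longrightarrow> \<bar>p i \<bullet> p j\<bar> \<le> 1 - 2 * s\<^sup>2"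
    and s: "s > 0" and R: "R \<ge> 0"
  shows "real (card {i\<in>I. half_tan (y \<bullet> p i) \<le> R}) \<le> (1 + 2 * R / s) ^ 3"
proof -
  obtain f :: "real^4 \<Rightarrow> real^4" where f: "orthogonal_transformation f" "f y = axis 1 1"
    by (rule orthogonal_transformation_exists[of y "axis 1 1 :: real^4"]) (use y in auto)
  define P where "P i = (if y \<bullet> p i \<ge> 0 then f (p i) else - f (p i))" for i
  define w :: "'i \<Rightarrow> real^3" where
    "w i = vector [P i $ 2 / (1 + P i $ 1), P i $ 3 / (1 + P i $ 1), P i $ 4 / (1 + P i $ 1)]" for i
  have ff: "f v \<bullet> f w = v \<bullet> w" for v w
    using f(1) by (simp add: orthogonal_transformation_def)
  have P1: "P i $ 1 = \<bar>y \<bullet> p i\<bar>" for i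
  proof -
    have "f (p i) $ 1 = f y \<bullet> f (p i)" by (simp add: f(2) inner_axis')
    also have "\<dots> = y \<bullet> p i" by (rule ff)
    finally show ?thesis by (simp add: P_def)
  qed
  have nP: "P i \<bullet> P i = 1" if "i \<in> I" for i
    using p[OF that] ff[of "p i" "p i"] by (simp add: P_def dot_square_norm)
  have PP: "P i \<bullet> P j \<le> 1 - 2 * s\<^sup>2" if "i \<in> I" "j \<in> I" "i \<noteq> j" for i j
    using sep[OF that] by (auto simp: P_def ff)
  have P1': "0 \<le> P i $ 1" "P i $ 1 \<le> 1" if "i \<in> I" for i
    using P1[of i] Cauchy_Schwarz_ineq2[of y "p i"] y p[OF that] by auto
  have sum4: "P i \<bullet> P j = P i $ 1 * P j $ 1 + P i $ 2 * P j $ 2 + P i $ 3 * P j $ 3 + P i $ 4 * P j $ 4" for i j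
    by (simp add: inner_vec_def sum_4)
  have nw: "norm (w i) = half_tan (y \<bullet> p i)" if "i \<in> I" for i
  proof -
    define t where "t = P i $ 1"
    have t: "0 \<le> t" using P1'[OF that] by (simp add: t_def)
    have "(norm (w i))\<^sup>2 = (P i $ 2 / (1 + t))\<^sup>2 + (P i $ 3 / (1 + t))\<^sup>2 + (P i $ 4 / (1 + t))\<^sup>2"
      unfolding power2_norm_eq_inner by (simp add: w_def inner_vec_def sum_3 power2_eq_square t_def)
    also have "\<dots> = ((P i $ 2)\<^sup>2 + (P i $ 3)\<^sup>2 + (P i $ 4)\<^sup>2) / (1 + t)\<^sup>2"
      by (simp add: power_divide add_divide_distrib)
    also have "(P i $ 2)\<^sup>2 + (P i $ 3)\<^sup>2 + (P i $ 4)\<^sup>2 = (1 - t) * (1 + t)"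
      using nP[OF that] sum4[of i i] by (simp add: t_def power2_eq_square algebra_simps)
    also have "(1 - t) * (1 + t) / (1 + t)\<^sup>2 = (1 - t) / (1 + t)"
      using t by (simp add: power2_eq_square)
    finally have "norm (w i) = sqrt ((1 - t) / (1 + t))"
      by (metis norm_ge_zero real_sqrt_unique)
    then show ?thesis using P1[of i] by (simp add: half_tan_def t_def)
  qed
  have dw: "dist (w i) (w j) \<ge> s" if ij: "i \<in> I" "j \<in> I" "i \<noteq> j" for i j
  proof -
    define t u where "t = P i $ 1" "u = P j $ 1"
    have t: "0 \<le> t" "t \<le> 1" "0 \<le> u" "u \<le> 1" using P1' ij by (auto simp: t_u_def)
    define x z where "x = 1 / (1 + t)" "z = 1 / (1 + u)"
    have xz: "x * (1 + t) = 1" "z * (1 + u) = 1" using t by (auto simp: x_z_def)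
    have "(dist (w i) (w j))\<^sup>2 = (P i $ 2 * x - P j $ 2 * z)\<^sup>2 + (P i $ 3 * x - P j $ 3 * z)\<^sup>2 + (P i $ 4 * x - P j $ 4 * z)\<^sup>2"
      unfolding dist_norm power2_norm_eq_inner
      by (simp add: w_def inner_vec_def sum_3 power2_eq_square t_u_def x_z_def)
    also have "\<dots> = (P i \<bullet> P i - t * t) * x\<^sup>2 + (P j \<bullet> P j - u * u) * z\<^sup>2 - 2 * (P i \<bullet> P j - t * u) * (x * z)"
      unfolding sum4 t_u_def by algebra
    also have "\<dots> = (2 - 2 * (P i \<bullet> P j)) * (x * z)"
    proof -
      have "(1 - t * t) * x\<^sup>2 = (1 - t) * x" "(1 - u * u) * z\<^sup>2 = (1 - u) * z"
        using xz by algebra+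
      moreover have "(1 - t) * x + (1 - u) * z - 2 * (D - t * u) * (x * z) = (2 - 2 * D) * (x * z)" for D
        using xz by algebra
      ultimately show ?thesis using nP[OF ij(1)] nP[OF ij(2)] by simp
    qed
    also have "\<dots> = (2 - 2 * (P i \<bullet> P j)) / ((1 + t) * (1 + u))"
      by (simp add: x_z_def)
    also have "\<dots> \<ge> s\<^sup>2"
    proof -
      have "(1 + t) * (1 + u) \<le> 2 * 2" using t by (intro mult_mono) auto
      then have "s\<^sup>2 * ((1 + t) * (1 + u)) \<le> s\<^sup>2 * 4" by (intro mult_left_mono) auto
      also have "\<dots> \<le> 2 - 2 * (P i \<bullet> P j)" using PP[OF ij] by simp
      finally show ?thesis using t by (subst pos_le_divide_eq) auto
    qed
    finally show ?thesis using s by (intro power2_le_imp_le[of s]) auto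
  qed
  define K where "K = {i\<in>I. half_tan (y \<bullet> p i) \<le> R}"
  have inj: "inj_on w K"
  proof (rule inj_onI, rule ccontr)
    fix i j assume "i \<in> K" "j \<in> K" "w i = w j" "i \<noteq> j"
    then show False using dw[of i j] s by (simp add: K_def)
  qed
  have "real (card (w ` K)) * (s / 2) ^ DIM(real^3) \<le> (R + s / 2) ^ DIM(real^3)"
  proof (rule packing_card_le)
    show "finite (w ` K)" using fin by (simp add: K_def)
    show "w ` K \<subseteq> cball 0 R" using nw by (auto simp: K_def)
    show "s / 2 > 0" "R \<ge> 0" using s R by simp_all
    show "dist v v' \<ge> 2 * (s / 2)" if "v \<in> w ` K" "v' \<in> w ` K" "v \<noteq> v'" for v v'
      using that dw by (auto simp: K_def)
  qed
  then have "real (card K) \<le> (R + s / 2) ^ 3 / (s / 2) ^ 3"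
    using s by (simp add: card_image[OF inj] pos_le_divide_eq)
  also have "\<dots> = (1 + 2 * R / s) ^ 3"
    using s by (simp add: power_divide[symmetric] add_divide_distrib add.commute mult.commute)
  finally show ?thesis by (simp add: K_def)
qed


text \<open>For \<open>half_tan t\<close> = tan (\<theta>/2) the root is sin \<theta>, and the last
  claim is the double-angle formula. The simple bound tan (\<theta>/2) \<le> sin \<theta> suffices
  in the outer shells; the exact formula serves the second shell, where a lost factor would be too
  costly.\<close>

lemma half_tan_bounds:
  assumes "\<bar>t\<bar> \<le> 1"
  shows "0 \<le> half_tan t" "half_tan t \<le> 1" "half_tan t \<le> sqrt (1 - t\<^sup>2)"
    and "sqrt (1 - t\<^sup>2) = 2 * half_tan t / (1 + (half_tan t)\<^sup>2)"
proof -
  define a r where "a = \<bar>t\<bar>" "r = half_tan t"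
  have a: "0 \<le> a" "a \<le> 1" "t\<^sup>2 = a\<^sup>2" using assms by (auto simp: a_r_def)
  have r: "r = sqrt ((1 - a) / (1 + a))" by (simp add: a_r_def half_tan_def)
  have r2: "r\<^sup>2 = (1 - a) / (1 + a)" using a by (simp add: r)
  show r0: "0 \<le> half_tan t" using a r by (simp add: a_r_def(2)[symmetric])
  have "(1 - a) / (1 + a) \<le> 1" using a by (simp add: pos_divide_le_eq)
  then show "half_tan t \<le> 1" using r by (simp add: a_r_def(2)[symmetric])
  have "1 - t\<^sup>2 = (r * (1 + a))\<^sup>2"
  proof -
    have "r\<^sup>2 * (1 + a) = 1 - a" using a r2 by simp
    then show ?thesis unfolding a(3) by algebra
  qed
  then have S: "sqrt (1 - t\<^sup>2) = r * (1 + a)" using a r0 by (simp add: a_r_def(2))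
  have "r * 1 \<le> r * (1 + a)" using a r0 by (intro mult_left_mono) (auto simp: a_r_def(2))
  then show "half_tan t \<le> sqrt (1 - t\<^sup>2)" by (simp add: S a_r_def(2))
  have "(1 + r\<^sup>2) * (1 + a) = 2" using a by (simp add: r2 field_simps)
  moreover have "1 + r\<^sup>2 > 0" by (simp add: add_pos_nonneg)
  ultimately have "1 + a = 2 / (1 + r\<^sup>2)" by (simp add: nonzero_eq_divide_eq mult.commute)
  then show "sqrt (1 - t\<^sup>2) = 2 * half_tan t / (1 + (half_tan t)\<^sup>2)"
    by (simp add: S a_r_def(2))
qed

text \<open>
  The shells of radius \<open>2s\<close> and \<open>4s\<close> contain at most \<open>5\<^sup>3 = 125\<close> and \<open>9\<^sup>3 = 729\<close> nodes; the dyadic shells beyond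
  contribute a geometric series.
\<close>
lemma inverse_power_sum_le:
  fixes y :: "real^4" and p :: "'i \<Rightarrow> real^4"
  assumes fin: "finite I" and y: "norm y = 1" and p: "\<And>i. i \<in> I \<Longrightarrow> norm (p i) = 1"
    and sep: "\<And>i j. i \<in> I \<Longrightarrow> j \<in> I \<Longrightarrow> i \<noteq> j \<Longrightarrow> \<bar>p i \<bullet> p j\<bar> \<le> 1 - 2 * s\<^sup>2"
    and s: "0 < s" "s \<le> 3 / 7" and m: "m > 0" and ms: "m * s \<ge> 207 / 100"
    and xi: "xi > 0" "\<And>i. i \<in> I \<Longrightarrow> xi \<le> m * sqrt (1 - (y \<bullet> p i)\<^sup>2)"
  shows "(\<Sum>i\<in>I. (1 / (m * sqrt (1 - (y \<bullet> p i)\<^sup>2))) ^ 7) \<le> 125 * (1 / xi) ^ 7 + 149 / 10000"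
    and "(\<Sum>i\<in>I. (1 / (m * sqrt (1 - (y \<bullet> p i)\<^sup>2))) ^ 8) \<le> 125 * (1 / xi) ^ 8 + 296 / 100000"
proof -
  define r where "r i = half_tan (y \<bullet> p i)" for i
  define X where "X i = m * sqrt (1 - (y \<bullet> p i)\<^sup>2)" for i
  have t: "\<bar>y \<bullet> p i\<bar> \<le> 1" if "i \<in> I" for i
    using Cauchy_Schwarz_ineq2[of y "p i"] y p[OF that] by simp
  have count: "real (card {i\<in>I. r i \<le> R}) \<le> (1 + 2 * R / s) ^ 3" if "R \<ge> 0" for R
    unfolding r_def by (rule stereographic_card_le) (use assms that in auto)
  have X: "xi \<le> X i" "m * r i \<le> X i" "0 \<le> r i" "r i \<le> 1" if "i \<in> I" for i
    using that xi half_tan_bounds(1-3)[OF t[OF that]] m by (auto simp: X_def r_def)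
  have bound: "(\<Sum>i\<in>K. (1 / X i) ^ e) \<le> real n * (1 / x) ^ e"
    if "K \<subseteq> I" "real (card K) \<le> real n" "x > 0" "\<And>i. i \<in> K \<Longrightarrow> x \<le> X i" for K e n x
  proof -
    have "(\<Sum>i\<in>K. (1 / X i) ^ e) \<le> (\<Sum>i\<in>K. (1 / x) ^ e)"
    proof (intro sum_mono power_mono divide_left_mono)
      fix i assume "i \<in> K"
      then have "x \<le> X i" using that by blast
      then show "x \<le> X i" "0 \<le> 1 / X i" "0 < X i * x" using \<open>x > 0\<close> by auto
    qed auto
    also have "\<dots> = real (card K) * (1 / x) ^ e" by simp
    also have "\<dots> \<le> real n * (1 / x) ^ e" using that by (intro mult_right_mono) auto
    finally show ?thesis .
  qed
  define I0 I1 I2 where "I0 = {i\<in>I. r i \<le> 2 * s}" "I1 = {i\<in>I. 2 * s < r i \<and> r i \<le> 4 * s}" "I2 = {i\<in>I. 4 * s < r i}"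
  have I: "I = I0 \<union> I1 \<union> I2" "I0 \<inter> I1 = {}" "(I0 \<union> I1) \<inter> I2 = {}" "finite I0" "finite I1" "finite I2"
    using fin s by (auto simp: I0_I1_I2_def)
  have split: "(\<Sum>i\<in>I. f i) = (\<Sum>i\<in>I0. f i) + (\<Sum>i\<in>I1. f i) + (\<Sum>i\<in>I2. f i)" for f :: "'i \<Rightarrow> real"
    unfolding I(1) using I(2-) by (simp add: sum.union_disjoint)
  have c0: "(\<Sum>i\<in>I0. (1 / X i) ^ e) \<le> real 125 * (1 / xi) ^ e" for e
  proof (rule bound)
    show "real (card I0) \<le> real 125"
      using count[of "2 * s"] s by (simp add: I0_I1_I2_def)
  qed (use X xi in \<open>auto simp: I0_I1_I2_def\<close>)
  \<comment> \<open>The sine 2r/(1 + r^2) increases on [0, 1], so it is at least its value at r = c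
    = 2s. There m * 2c = 4 m s is at least 828/100, and 1 + c^2 is at most 1 + (6/7)^2 =
    85/49.\<close>
  have X1: "828 / 100 * 49 / 85 \<le> X i" if "i \<in> I" "2 * s < r i" for i
  proof -
    define c where "c = 2 * s"
    have c: "0 < c" "c \<le> 6 / 7" "c < r i" "r i \<le> 1" using s that X(4)[OF that(1)] by (auto simp: c_def)
    have cc: "c * c \<le> 6 / 7 * (6 / 7)" using c by (intro mult_mono) auto
    have "c * r i \<le> 1 * 1" using c by (intro mult_mono) auto
    then have "0 \<le> 2 * (r i - c) * (1 - c * r i)" using c by simp
    then have "2 * c * (1 + (r i)\<^sup>2) \<le> 2 * r i * (1 + c\<^sup>2)"
      by (simp add: power2_eq_square algebra_simps)
    then have 1: "2 * c / (1 + c\<^sup>2) \<le> 2 * r i / (1 + (r i)\<^sup>2)"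
      by (subst frac_le_eq) (auto simp: add_pos_nonneg divide_nonpos_pos add_nonneg_eq_0_iff)
    have "828 / 100 * 49 / 85 \<le> m * (2 * c) * 49 / 85" using ms by (simp add: c_def)
    also have "\<dots> = m * (2 * c) / (1 + 36 / 49)" by simp
    also have "\<dots> \<le> m * (2 * c) / (1 + c\<^sup>2)"
      using cc c m by (intro divide_left_mono) (auto simp: power2_eq_square add_pos_nonneg)
    also have "\<dots> \<le> m * (2 * r i / (1 + (r i)\<^sup>2))"
      using mult_left_mono[OF 1, of m] m by simp
    also have "\<dots> = X i" using half_tan_bounds(4)[OF t[OF that(1)]] by (simp add: X_def r_def)
    finally show ?thesis .
  qed
  have c1: "(\<Sum>i\<in>I1. (1 / X i) ^ e) \<le> real 729 * (1 / (828 / 100 * 49 / 85)) ^ e" for e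
  proof (rule bound)
    have "card I1 \<le> card {i\<in>I. r i \<le> 4 * s}"
      using fin by (intro card_mono) (auto simp: I0_I1_I2_def)
    then show "real (card I1) \<le> real 729"
      using count[of "4 * s"] s by simp
  qed (use X1 in \<open>auto simp: I0_I1_I2_def\<close>)
  define K where "K = (17 / 4) ^ 3 * (1 / (m * s)) ^ 7"
  \<comment> \<open>Shell n has at most (1 + 4 * 2^n)^3 \<le> (17/4 * 2^n)^3 nodes, each
    contributing a multiple of (2^n)^(-7), so it costs K * 16^(-n). The bracket on the right is the
    closed form of the sum of 16^(-k) over 2 \<le> k < n.\<close>
  have dy: "(\<Sum>i | i \<in> I \<and> 4 * s < r i \<and> r i \<le> 2 ^ n * s. (1 / X i) ^ 7) \<le> K * (1 / 240 - 16 / 15 * (1 / 16) ^ n)"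
    if "n \<ge> 2" for n
    using that
  proof (induction n rule: dec_induct)
    case base
    have "{i. i \<in> I \<and> 4 * s < r i \<and> r i \<le> 2 ^ 2 * s} = {}" by auto
    then show ?case by (simp only: sum.empty) (simp add: power2_eq_square)
  next
    case (step n)
    let ?A = "{i. i \<in> I \<and> 4 * s < r i \<and> r i \<le> 2 ^ n * s}"
    let ?B = "{i. i \<in> I \<and> 2 ^ n * s < r i \<and> r i \<le> 2 ^ Suc n * s}"
    have two: "(4::real) \<le> 2 ^ n" using power_increasing[OF step(1), of "2::real"] by simp
    have "4 * s \<le> 2 ^ n * s" "2 ^ n * s \<le> 2 ^ Suc n * s" using two s by (auto intro!: mult_right_mono)
    then have eq: "{i. i \<in> I \<and> 4 * s < r i \<and> r i \<le> 2 ^ Suc n * s} = ?A \<union> ?B"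
      by (auto simp del: power_Suc)
    have "(\<Sum>i\<in>?B. (1 / X i) ^ 7) \<le> (\<Sum>i\<in>?B. (1 / (m * (2 ^ n * s))) ^ 7)"
    proof (intro sum_mono power_mono divide_left_mono)
      fix i assume i: "i \<in> ?B"
      have "m * (2 ^ n * s) \<le> m * r i" using i m by (intro mult_left_mono) auto
      then show "m * (2 ^ n * s) \<le> X i" using X(2)[of i] i by simp
      moreover have "0 < m * (2 ^ n * s)" using m s by simp
      ultimately show "0 \<le> 1 / X i" "0 < X i * (m * (2 ^ n * s))" by auto
    qed auto
    also have "\<dots> = real (card ?B) * (1 / (m * (2 ^ n * s))) ^ 7" by simp
    also have "\<dots> \<le> (17 / 4 * 2 ^ n) ^ 3 * (1 / (m * (2 ^ n * s))) ^ 7"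
    proof (rule mult_right_mono)
      have "card ?B \<le> card {i\<in>I. r i \<le> 2 ^ Suc n * s}"
        using fin by (intro card_mono) auto
      then have "real (card ?B) \<le> (1 + 2 * (2 ^ Suc n * s) / s) ^ 3"
        using count[of "2 ^ Suc n * s"] s by simp
      also have "\<dots> = (1 + 4 * 2 ^ n) ^ 3" using s by simp
      also have "\<dots> \<le> (17 / 4 * 2 ^ n) ^ 3" using two by (intro power_mono) auto
      finally show "real (card ?B) \<le> (17 / 4 * 2 ^ n) ^ 3" .
    qed (use m s in auto)
    also have "\<dots> = K * ((2 ^ n) ^ 3 * (1 / 2 ^ n) ^ 7)"
      by (simp add: K_def power_mult_distrib power_divide)
    also have "((2::real) ^ n) ^ 3 * (1 / 2 ^ n) ^ 7 = (1 / 16) ^ n"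
    proof -
      have "((2::real) ^ n) ^ 3 * (1 / 2 ^ n) ^ 7 = (2 ^ 3 * (1 / 2) ^ 7) ^ n"
        by (simp only: power_one_over power_mult_distrib power_mult[symmetric] mult.commute[of n])
      then show ?thesis by (simp add: power_divide)
    qed
    finally have B: "(\<Sum>i\<in>?B. (1 / X i) ^ 7) \<le> K * (1 / 16) ^ n" .
    have "(\<Sum>i\<in>?A \<union> ?B. (1 / X i) ^ 7) = (\<Sum>i\<in>?A. (1 / X i) ^ 7) + (\<Sum>i\<in>?B. (1 / X i) ^ 7)"
      using fin by (intro sum.union_disjoint) auto
    also have "\<dots> \<le> K * (1 / 240 - 16 / 15 * (1 / 16) ^ n) + K * (1 / 16) ^ n"
      using step.IH B by simp
    also have "\<dots> = K * (1 / 240 - 16 / 15 * (1 / 16) ^ Suc n)"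
      by (simp add: algebra_simps)
    finally show ?case unfolding eq .
  qed
  obtain n0 where n0: "1 / s < 2 ^ n0" using real_arch_pow[of 2 "1 / s"] by auto
  define n where "n = max 2 n0"
  have "(2::real) ^ n0 \<le> 2 ^ n" by (intro power_increasing) (auto simp: n_def)
  then have "1 / s \<le> 2 ^ n" using n0 by linarith
  then have n: "n \<ge> 2" "1 \<le> 2 ^ n * s" using s by (auto simp: n_def pos_divide_le_eq)
  have I2n: "I2 = {i. i \<in> I \<and> 4 * s < r i \<and> r i \<le> 2 ^ n * s}"
    using order_trans[OF X(4) n(2)] by (auto simp: I0_I1_I2_def)
  have K: "0 \<le> K" "K \<le> (17 / 4) ^ 3 * (1 / (207 / 100)) ^ 7"
  proof -
    show "0 \<le> K" using m s by (simp add: K_def)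
    have "1 / (m * s) \<le> 1 / (207 / 100)" using ms by (intro divide_left_mono) auto
    then have "(1 / (m * s)) ^ 7 \<le> (1 / (207 / 100)) ^ 7" using m s by (intro power_mono) auto
    then show "K \<le> (17 / 4) ^ 3 * (1 / (207 / 100)) ^ 7" by (simp add: K_def)
  qed
  have "(\<Sum>i\<in>I2. (1 / X i) ^ 7) \<le> K * (1 / 240 - 16 / 15 * (1 / 16) ^ n)"
    unfolding I2n by (rule dy[OF n(1)])
  also have "\<dots> \<le> K * (1 / 240)" using K by (intro mult_left_mono) auto
  also have "\<dots> \<le> 1965 / 1000000" using K(2) by (simp add: power_divide)
  finally have c27: "(\<Sum>i\<in>I2. (1 / X i) ^ 7) \<le> 1965 / 1000000" .
  \<comment> \<open>Beyond radius 4s the scaled sine is at least 8, so one more power gains a factor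
    1/8.\<close>
  have "(\<Sum>i\<in>I2. (1 / X i) ^ 8) \<le> (\<Sum>i\<in>I2. (1 / 8) * (1 / X i) ^ 7)"
  proof (rule sum_mono)
    fix i assume "i \<in> I2"
    then have i: "i \<in> I" "4 * s < r i" by (auto simp: I0_I1_I2_def)
    have "8 \<le> 4 * (m * s)" using ms by simp
    also have "\<dots> \<le> m * r i" using i m by simp
    finally have "8 \<le> X i" using X(2)[OF i(1)] by simp
    then have "(1 / X i) * (1 / X i) ^ 7 \<le> (1 / 8) * (1 / X i) ^ 7"
      by (intro mult_right_mono divide_left_mono) auto
    then show "(1 / X i) ^ 8 \<le> (1 / 8) * (1 / X i) ^ 7" by (simp add: power_Suc[symmetric] del: power_Suc)
  qed
  then have c28: "(\<Sum>i\<in>I2. (1 / X i) ^ 8) \<le> 1 / 8 * (1965 / 1000000)"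
    using c27 unfolding sum_distrib_left[symmetric] by linarith
  show "(\<Sum>i\<in>I. (1 / (m * sqrt (1 - (y \<bullet> p i)\<^sup>2))) ^ 7) \<le> 125 * (1 / xi) ^ 7 + 149 / 10000"
    using split[of "\<lambda>i. (1 / X i) ^ 7"] c0[of 7] c1[of 7] c27
    unfolding X_def[symmetric] by (simp add: power_divide)
  show "(\<Sum>i\<in>I. (1 / (m * sqrt (1 - (y \<bullet> p i)\<^sup>2))) ^ 8) \<le> 125 * (1 / xi) ^ 8 + 296 / 100000"
    using split[of "\<lambda>i. (1 / X i) ^ 8"] c0[of 8] c1[of 8] c28
    unfolding X_def[symmetric] by (simp add: power_divide)
qed

section \<open>Localised bumps along great circles\<close>

text \<open>For b orthogonal to p, the value at p is a and the gradient at p is b, because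
  \<open>ker m\<close> is 1 with zero slope along the sphere there. The factor
  \<open>p \<bullet> y\<close> leaves this first-order behaviour unchanged and makes the tangential
  term even in y.\<close>

definition bump :: "nat \<Rightarrow> real \<Rightarrow> real^4 \<Rightarrow> real^4 \<Rightarrow> real^4 \<Rightarrow> real" where
  "bump m a b p y = (a + (b \<bullet> y) * (p \<bullet> y)) * ker m (p \<bullet> y) ^ 8"

text \<open>
  \<open>bump1\<close> and \<open>bump2\<close> are the first two derivatives of \<open>bump\<close> along the unit-speed great circle that
  passes through \<open>y\<close> with velocity \<open>v\<close>.
\<close>
definition bump1 :: "nat \<Rightarrow> real \<Rightarrow> real^4 \<Rightarrow> real^4 \<Rightarrow> real^4 \<Rightarrow> real^4 \<Rightarrow> real" where
  "bump1 m a b p y v = ((b \<bullet> v) * (p \<bullet> y) + (b \<bullet> y) * (p \<bullet> v)) * ker m (p \<bullet> y) ^ 8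
     + (a + (b \<bullet> y) * (p \<bullet> y)) * (8 * ker m (p \<bullet> y) ^ 7 * (ker1 m (p \<bullet> y) * (p \<bullet> v)))"

definition bump2 :: "nat \<Rightarrow> real \<Rightarrow> real^4 \<Rightarrow> real^4 \<Rightarrow> real^4 \<Rightarrow> real^4 \<Rightarrow> real" where
  "bump2 m a b p y v = (2 * (b \<bullet> v) * (p \<bullet> v) - 2 * (b \<bullet> y) * (p \<bullet> y)) * ker m (p \<bullet> y) ^ 8
     + 2 * ((b \<bullet> v) * (p \<bullet> y) + (b \<bullet> y) * (p \<bullet> v)) * (8 * ker m (p \<bullet> y) ^ 7 * (ker1 m (p \<bullet> y) * (p \<bullet> v)))
     + (a + (b \<bullet> y) * (p \<bullet> y)) * (56 * ker m (p \<bullet> y) ^ 6 * (ker1 m (p \<bullet> y) * (p \<bullet> v))\<^sup>2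
        + 8 * ker m (p \<bullet> y) ^ 7 * (ker2 m (p \<bullet> y) * (p \<bullet> v)\<^sup>2 - ker1 m (p \<bullet> y) * (p \<bullet> y)))"

lemma DERIV_inner_circle:
  fixes y v w :: "'a::real_inner"
  shows "((\<lambda>s. w \<bullet> (cos s *\<^sub>R y + sin s *\<^sub>R v)) has_real_derivative w \<bullet> (cos s *\<^sub>R v - sin s *\<^sub>R y)) (at s)"
    and "((\<lambda>s. w \<bullet> (cos s *\<^sub>R v - sin s *\<^sub>R y)) has_real_derivative - (w \<bullet> (cos s *\<^sub>R y + sin s *\<^sub>R v))) (at s)"
  unfolding inner_add_right inner_diff_right inner_scaleR_right
  by (rule derivative_eq_intros refl | simp add: algebra_simps)+

lemma DERIV_bump:
  assumes m: "m > 0"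
    and t: "\<bar>p \<bullet> (cos s *\<^sub>R y + sin s *\<^sub>R v)\<bar> < 1"
  shows "((\<lambda>s. bump m a b p (cos s *\<^sub>R y + sin s *\<^sub>R v)) has_real_derivative
           bump1 m a b p (cos s *\<^sub>R y + sin s *\<^sub>R v) (cos s *\<^sub>R v - sin s *\<^sub>R y)) (at s)"
    and "((\<lambda>s. bump1 m a b p (cos s *\<^sub>R y + sin s *\<^sub>R v) (cos s *\<^sub>R v - sin s *\<^sub>R y)) has_real_derivative
           bump2 m a b p (cos s *\<^sub>R y + sin s *\<^sub>R v) (cos s *\<^sub>R v - sin s *\<^sub>R y)) (at s)"
proof -
  define T L T1 L1 where "T s = p \<bullet> (cos s *\<^sub>R y + sin s *\<^sub>R v)" and "L s = b \<bullet> (cos s *\<^sub>R y + sin s *\<^sub>R v)"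
    and "T1 s = p \<bullet> (cos s *\<^sub>R v - sin s *\<^sub>R y)" and "L1 s = b \<bullet> (cos s *\<^sub>R v - sin s *\<^sub>R y)" for s
  have d: "(T has_real_derivative T1 s) (at s)" "(L has_real_derivative L1 s) (at s)"
     "(T1 has_real_derivative - T s) (at s)" "(L1 has_real_derivative - L s) (at s)"
    unfolding T_def[abs_def] L_def[abs_def] T1_def[abs_def] L1_def[abs_def] by (rule DERIV_inner_circle)+
  have k: "((\<lambda>s. ker m (T s)) has_real_derivative ker1 m (T s) * T1 s) (at s)"
    "((\<lambda>s. ker1 m (T s)) has_real_derivative ker2 m (T s) * T1 s) (at s)"
    using DERIV_chain2[OF DERIV_ker(1)[OF t[folded T_def] m] d(1)] DERIV_chain2[OF DERIV_ker(2)[OF t[folded T_def] m] d(1)]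
    by simp_all
  show "((\<lambda>s. bump m a b p (cos s *\<^sub>R y + sin s *\<^sub>R v)) has_real_derivative
           bump1 m a b p (cos s *\<^sub>R y + sin s *\<^sub>R v) (cos s *\<^sub>R v - sin s *\<^sub>R y)) (at s)"
    unfolding bump_def bump1_def T_def[symmetric] L_def[symmetric] T1_def[symmetric] L1_def[symmetric]
    by (rule derivative_eq_intros d k refl)+ (simp add: algebra_simps)
  show "((\<lambda>s. bump1 m a b p (cos s *\<^sub>R y + sin s *\<^sub>R v) (cos s *\<^sub>R v - sin s *\<^sub>R y)) has_real_derivative
           bump2 m a b p (cos s *\<^sub>R y + sin s *\<^sub>R v) (cos s *\<^sub>R v - sin s *\<^sub>R y)) (at s)"
    unfolding bump1_def bump2_def T_def[symmetric] L_def[symmetric] T1_def[symmetric] L1_def[symmetric]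
    by (rule derivative_eq_intros d k refl)+ (simp add: algebra_simps power2_eq_square)
qed

text \<open>Only the component of p orthogonal to y pairs with v, and its length is the root on the
  right.\<close>

lemma inner_orthonormal_le:
  fixes p y v :: "'a::real_inner"
  assumes "norm p = 1" "norm y = 1" "norm v = 1" "y \<bullet> v = 0"
  shows "\<bar>p \<bullet> v\<bar> \<le> sqrt (1 - (p \<bullet> y)\<^sup>2)"
proof -
  define w where "w = p - (p \<bullet> y) *\<^sub>R y"
  have yy: "y \<bullet> y = 1" "p \<bullet> p = 1" using assms by (simp_all add: dot_square_norm)
  have "p \<bullet> v = w \<bullet> v" using assms by (simp add: w_def inner_diff_left)
  also have "\<bar>w \<bullet> v\<bar> \<le> norm w" using Cauchy_Schwarz_ineq2[of w v] assms by simp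
  also have "norm w = sqrt (1 - (p \<bullet> y)\<^sup>2)"
    unfolding norm_eq_sqrt_inner
    by (simp add: w_def inner_diff_left inner_diff_right yy inner_commute[of y p] power2_eq_square)
  finally show ?thesis .
qed

text \<open>All sizes are powers of Z, the reciprocal of the scaled sine m S. The tangential term is
  at most m B S, and m S Z = 1, so it costs one power of Z: this is why B comes with the seventh
  power. Each derivative costs a factor m. The constants result from inserting Z \<le> 298/1000: 8(1
  + Z) \<le> 104/10, 32(1 + Z) \<le> 42, and 115 bounds the factor from two derivatives of the
  eighth power.\<close>

lemma bump_bounds:
  assumes m: "m \<ge> 5" and n: "norm p = 1" "norm y = 1" and b: "b \<bullet> p = 0" "norm b \<le> real m * B"
    and a: "\<bar>a\<bar> \<le> A" and t: "\<bar>p \<bullet> y\<bar> < 1"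
  defines "Z \<equiv> 1 / (real m * sqrt (1 - (p \<bullet> y)\<^sup>2))"
  shows "\<bar>bump m a b p y\<bar> \<le> A * Z ^ 8 + B * Z ^ 7"
    and "norm v = 1 \<Longrightarrow> y \<bullet> v = 0 \<Longrightarrow> Z \<le> 298 / 1000 \<Longrightarrow>
       \<bar>bump1 m a b p y v\<bar> \<le> real m * (104 / 10 * (A * Z ^ 8 + B * Z ^ 7) + 2 * B * Z ^ 8)"
    and "norm v = 1 \<Longrightarrow> y \<bullet> v = 0 \<Longrightarrow> Z \<le> 298 / 1000 \<Longrightarrow>
       \<bar>bump2 m a b p y v\<bar> \<le> (real m)\<^sup>2 * (115 * (A * Z ^ 8 + B * Z ^ 7) + 43 * B * Z ^ 8)"
proof -
  define S where "S = sqrt (1 - (p \<bullet> y)\<^sup>2)"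
  define k k1 k2 l where "k = ker m (p \<bullet> y)" and "k1 = ker1 m (p \<bullet> y)" and "k2 = ker2 m (p \<bullet> y)" and "l = b \<bullet> y"
  define t' l' where "t' = p \<bullet> v" and "l' = b \<bullet> v"
  define t where "t = p \<bullet> y"
  define c where "c = real m * (Z * (1 + Z))"
  have m0: "real m \<ge> 5" using m by simp
  have t1: "\<bar>t\<bar> < 1" using t by (simp add: t_def)
  have S2: "S\<^sup>2 = 1 - t\<^sup>2" and S0: "S > 0" and S1: "S \<le> 1"
    using t1 by (auto simp: S_def t_def abs_square_less_1 abs_square_le_1)
  have Z: "Z = 1 / (real m * S)" "Z > 0" using S0 m0 by (auto simp: Z_def S_def)
  have mSZ: "real m * S * Z = 1" using Z S0 m0 by simp
  have Sinv: "1 / S = real m * Z" using Z S0 m0 by simp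
  have Sinv2: "1 / S\<^sup>2 = (real m * Z)\<^sup>2" unfolding Sinv[symmetric] by (simp add: power_one_over)
  have A0: "A \<ge> 0" using a by linarith
  have B0: "B \<ge> 0" using order_trans[OF norm_ge_zero b(2)] m0 by (simp add: zero_le_mult_iff)
  have kb: "\<bar>k\<bar> \<le> Z"
    using ker_bounds(1)[OF t, of m] m0 by (simp add: k_def Z S_def)
  have k1b: "\<bar>k1\<bar> \<le> (1 + Z) / S\<^sup>2"
    using ker_bounds(2)[OF t, of m] m0 by (simp add: k1_def Z S_def)
  have k2b: "\<bar>k2\<bar> * S\<^sup>2 \<le> 3 * ((1 + Z) / S\<^sup>2) + (real m)\<^sup>2 * Z"
    using ker_bounds(3)[OF t, of m] m0 unfolding k2_def Z(1) S_def by simp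
  have lb: "\<bar>l\<bar> \<le> real m * B * S"
  proof -
    define w where "w = y - (p \<bullet> y) *\<^sub>R p"
    have nn: "y \<bullet> y = 1" "p \<bullet> p = 1" using n by (simp_all add: dot_square_norm)
    have "norm w = S" unfolding norm_eq_sqrt_inner S_def
      by (simp add: w_def inner_diff_left inner_diff_right nn inner_commute[of y p] power2_eq_square)
    moreover have "l = b \<bullet> w" using b by (simp add: l_def w_def inner_diff_right)
    ultimately have "\<bar>l\<bar> \<le> norm b * S" using Cauchy_Schwarz_ineq2[of b w] by simp
    also have "\<dots> \<le> real m * B * S" using b S0 by (intro mult_right_mono) auto
    finally show ?thesis .
  qed
  have lt: "\<bar>l * t\<bar> \<le> real m * B * S * 1"
    unfolding abs_mult using lb t1 by (intro mult_mono) auto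
  have Lb: "\<bar>a + l * t\<bar> \<le> A + real m * B * S" using lt a by linarith
  have LZ: "(A + real m * B * S) * Z ^ 8 = A * Z ^ 8 + B * Z ^ 7"
  proof -
    have "(A + real m * B * S) * Z ^ 8 = A * Z ^ 8 + B * Z ^ 7 * (real m * S * Z)"
      by (simp add: algebra_simps power_numeral_reduce)
    then show ?thesis by (simp only: mSZ mult_1_right)
  qed
  have kp: "\<bar>k ^ e\<bar> \<le> Z ^ e" for e unfolding power_abs by (rule power_mono[OF kb]) auto
  have "\<bar>bump m a b p y\<bar> = \<bar>a + l * t\<bar> * \<bar>k ^ 8\<bar>"
    by (simp add: bump_def k_def l_def t_def abs_mult)
  also have "\<dots> \<le> (A + real m * B * S) * Z ^ 8"
    by (intro mult_mono Lb kp) (use A0 B0 S0 in auto)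
  finally show "\<bar>bump m a b p y\<bar> \<le> A * Z ^ 8 + B * Z ^ 7" unfolding LZ .
  assume v: "norm v = 1" "y \<bullet> v = 0" and Zs: "Z \<le> 298 / 1000"
  have tb: "\<bar>t'\<bar> \<le> S" unfolding t'_def S_def by (rule inner_orthonormal_le) (use n v in auto)
  have l'b: "\<bar>l'\<bar> \<le> real m * B"
    using Cauchy_Schwarz_ineq2[of b v] b v by (simp add: l'_def)
  have k1t: "\<bar>k1 * t'\<bar> \<le> c"
  proof -
    have "\<bar>k1 * t'\<bar> \<le> (1 + Z) / S\<^sup>2 * S" unfolding abs_mult using k1b tb Z S0 by (intro mult_mono) auto
    also have "\<dots> = (1 + Z) * (1 / S)" using S0 by (simp add: power2_eq_square)
    also have "\<dots> = c" unfolding Sinv c_def by simp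
    finally show ?thesis .
  qed
  have c0: "c \<ge> 0" using Z(2) m0 by (simp add: c_def)
  have P: "\<bar>l' * t + l * t'\<bar> \<le> 2 * (real m * B)"
  proof -
    have "\<bar>l' * t\<bar> \<le> real m * B * 1" unfolding abs_mult using l'b t1 by (intro mult_mono) auto
    moreover have "\<bar>l * t'\<bar> \<le> (real m * B * S) * S"
      unfolding abs_mult using lb tb by (intro mult_mono) (use B0 S0 in auto)
    moreover have "(real m * B * S) * S \<le> (real m * B * 1) * 1"
      using S0 S1 B0 by (intro mult_mono) auto
    ultimately show ?thesis by linarith
  qed
  have Q: "\<bar>2 * l' * t' - 2 * l * t\<bar> \<le> 4 * (real m * B)"
  proof -
    have "\<bar>l' * t'\<bar> \<le> real m * B * S" unfolding abs_mult using l'b tb by (intro mult_mono) (use B0 in auto)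
    moreover have "real m * B * S \<le> real m * B * 1" using S0 S1 B0 by (intro mult_mono) auto
    ultimately show ?thesis using lt by (simp only: mult.assoc)
  qed
  have k7: "\<bar>8 * k ^ 7 * (k1 * t')\<bar> \<le> 8 * Z ^ 7 * c"
    unfolding abs_mult[of "8 * k ^ 7"] by (intro mult_mono k1t) (use kp[of 7] Z c0 in \<open>auto simp: abs_mult\<close>)
  have e7: "8 * Z ^ 7 * c = real m * (8 * (1 + Z)) * Z ^ 8"
    by (simp add: c_def power_numeral_reduce)
  have "\<bar>bump1 m a b p y v\<bar> = \<bar>(l' * t + l * t') * k ^ 8 + (a + l * t) * (8 * k ^ 7 * (k1 * t'))\<bar>"
    by (simp add: bump1_def k_def l_def t_def t'_def l'_def k1_def)
  also have "\<dots> \<le> \<bar>(l' * t + l * t') * k ^ 8\<bar> + \<bar>(a + l * t) * (8 * k ^ 7 * (k1 * t'))\<bar>"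
    by (rule abs_triangle_ineq)
  also have "\<dots> \<le> 2 * (real m * B) * Z ^ 8 + (A + real m * B * S) * (8 * Z ^ 7 * c)"
    unfolding abs_mult[of "l' * t + l * t'"] abs_mult[of "a + l * t"]
    by (intro add_mono mult_mono P Lb kp k7) (use A0 B0 S0 Z c0 in auto)
  also have "\<dots> = real m * (8 * (1 + Z) * (A * Z ^ 8 + B * Z ^ 7) + 2 * B * Z ^ 8)"
    unfolding e7 LZ[symmetric] by (simp add: algebra_simps)
  also have "\<dots> \<le> real m * (104 / 10 * (A * Z ^ 8 + B * Z ^ 7) + 2 * B * Z ^ 8)"
    by (intro mult_left_mono add_mono mult_right_mono) (use A0 B0 Z Zs in auto)
  finally show "\<bar>bump1 m a b p y v\<bar> \<le> real m * (104 / 10 * (A * Z ^ 8 + B * Z ^ 7) + 2 * B * Z ^ 8)" .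
  have k2t: "\<bar>k2 * t'\<^sup>2 - k1 * t\<bar> \<le> (real m)\<^sup>2 * (4 * (1 + Z) * Z\<^sup>2 + Z)"
  proof -
    have "t'\<^sup>2 \<le> S\<^sup>2" using tb S0 by (simp add: abs_le_square_iff[symmetric])
    then have "\<bar>k2 * t'\<^sup>2\<bar> \<le> \<bar>k2\<bar> * S\<^sup>2" unfolding abs_mult by (intro mult_mono) auto
    moreover have "\<bar>k1 * t\<bar> \<le> (1 + Z) / S\<^sup>2 * 1" unfolding abs_mult using k1b t1 Z by (intro mult_mono) auto
    ultimately have "\<bar>k2 * t'\<^sup>2 - k1 * t\<bar> \<le> 4 * ((1 + Z) / S\<^sup>2) + (real m)\<^sup>2 * Z"
      using k2b by linarith
    also have "(1 + Z) / S\<^sup>2 = (1 + Z) * (real m * Z)\<^sup>2" unfolding Sinv2[symmetric] by simp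
    finally show ?thesis by (simp add: algebra_simps power2_eq_square)
  qed
  have M: "\<bar>56 * k ^ 6 * (k1 * t')\<^sup>2 + 8 * k ^ 7 * (k2 * t'\<^sup>2 - k1 * t)\<bar>
     \<le> 56 * Z ^ 6 * c\<^sup>2 + 8 * Z ^ 7 * ((real m)\<^sup>2 * (4 * (1 + Z) * Z\<^sup>2 + Z))"
  proof (rule order_trans[OF abs_triangle_ineq], rule add_mono)
    have "(k1 * t')\<^sup>2 \<le> c\<^sup>2" using k1t c0 by (simp add: abs_le_square_iff[symmetric])
    then show "\<bar>56 * k ^ 6 * (k1 * t')\<^sup>2\<bar> \<le> 56 * Z ^ 6 * c\<^sup>2"
      unfolding abs_mult[of "56 * k ^ 6"] by (intro mult_mono) (use kp[of 6] Z in \<open>auto simp: abs_mult\<close>)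
    show "\<bar>8 * k ^ 7 * (k2 * t'\<^sup>2 - k1 * t)\<bar> \<le> 8 * Z ^ 7 * ((real m)\<^sup>2 * (4 * (1 + Z) * Z\<^sup>2 + Z))"
      unfolding abs_mult[of "8 * k ^ 7"] by (intro mult_mono k2t) (use kp[of 7] Z in \<open>auto simp: abs_mult\<close>)
  qed
  have eM: "56 * Z ^ 6 * c\<^sup>2 + 8 * Z ^ 7 * ((real m)\<^sup>2 * (4 * (1 + Z) * Z\<^sup>2 + Z))
     = (real m)\<^sup>2 * (56 * (1 + Z)\<^sup>2 + 8 * (4 * (1 + Z) * Z + 1)) * Z ^ 8"
    by (simp add: c_def algebra_simps power_numeral_reduce)
  have ZZ: "(1 + Z)\<^sup>2 \<le> (1298 / 1000)\<^sup>2" using Z Zs by (intro power_mono) auto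
  have ZZ2: "(1 + Z) * Z \<le> 1298 / 1000 * (298 / 1000)" using Z Zs by (intro mult_mono) auto
  have c115: "56 * (1 + Z)\<^sup>2 + 8 * (4 * (1 + Z) * Z + 1) \<le> 115"
  proof -
    define x w where "x = (1 + Z)\<^sup>2" and "w = (1 + Z) * Z"
    have xw: "x \<le> 1685 / 1000" "w \<le> 387 / 1000"
      unfolding x_def w_def by (rule order_trans[OF ZZ] order_trans[OF ZZ2], simp add: power2_eq_square)+
    have "56 * (1 + Z)\<^sup>2 + 8 * (4 * (1 + Z) * Z + 1) = 56 * x + 8 * (4 * w + 1)"
      by (simp add: x_def w_def)
    also have "\<dots> \<le> 115" using xw by simp
    finally show ?thesis .
  qed
  have "\<bar>bump2 m a b p y v\<bar> = \<bar>(2 * l' * t' - 2 * l * t) * k ^ 8 + 2 * (l' * t + l * t') * (8 * k ^ 7 * (k1 * t'))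
     + (a + l * t) * (56 * k ^ 6 * (k1 * t')\<^sup>2 + 8 * k ^ 7 * (k2 * t'\<^sup>2 - k1 * t))\<bar>"
    by (simp add: bump2_def k_def l_def t_def t'_def l'_def k1_def k2_def)
  also have "\<dots> \<le> \<bar>(2 * l' * t' - 2 * l * t) * k ^ 8\<bar> + \<bar>2 * (l' * t + l * t') * (8 * k ^ 7 * (k1 * t'))\<bar>
     + \<bar>(a + l * t) * (56 * k ^ 6 * (k1 * t')\<^sup>2 + 8 * k ^ 7 * (k2 * t'\<^sup>2 - k1 * t))\<bar>"
    by linarith
  also have "\<dots> \<le> 4 * (real m * B) * Z ^ 8 + 2 * (2 * (real m * B)) * (8 * Z ^ 7 * c)
     + (A + real m * B * S) * (56 * Z ^ 6 * c\<^sup>2 + 8 * Z ^ 7 * ((real m)\<^sup>2 * (4 * (1 + Z) * Z\<^sup>2 + Z)))"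
    unfolding abs_mult[of "2 * l' * t' - 2 * l * t"] abs_mult[of "2 * (l' * t + l * t')"] abs_mult[of "a + l * t"] abs_mult[of 2 "l' * t + l * t'"]
    by (intro add_mono mult_mono P Q Lb kp k7 M) (use A0 B0 S0 Z c0 in auto)
  also have "\<dots> = (real m)\<^sup>2 * ((56 * (1 + Z)\<^sup>2 + 8 * (4 * (1 + Z) * Z + 1)) * (A * Z ^ 8 + B * Z ^ 7) + 32 * (1 + Z) * B * Z ^ 8)
      + 4 * (real m * B) * Z ^ 8"
    unfolding e7 eM LZ[symmetric] by (simp add: algebra_simps power2_eq_square)
  also have "\<dots> \<le> (real m)\<^sup>2 * (115 * (A * Z ^ 8 + B * Z ^ 7) + 42 * B * Z ^ 8) + (real m)\<^sup>2 * (1 * B * Z ^ 8)"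
  proof (intro add_mono mult_left_mono mult_right_mono c115)
    have "4 * (real m * B) * Z ^ 8 \<le> real m * (real m * B) * Z ^ 8"
      using m0 B0 Z by (intro mult_right_mono) auto
    then show "4 * (real m * B) * Z ^ 8 \<le> (real m)\<^sup>2 * (1 * B * Z ^ 8)" by (simp add: power2_eq_square algebra_simps)
  qed (use A0 B0 Z Zs in auto)
  finally show "\<bar>bump2 m a b p y v\<bar> \<le> (real m)\<^sup>2 * (115 * (A * Z ^ 8 + B * Z ^ 7) + 43 * B * Z ^ 8)"
    by (simp add: algebra_simps)
qed

section \<open>Interference of separated nodes\<close>

text \<open>The triangle inequality for angles between lines, in cosine form: split p and q into
  components along and orthogonal to y and apply Cauchy-Schwarz to the orthogonal parts.\<close>

lemma inner_sphere_ge: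
  fixes y p q :: "'a::real_inner"
  assumes "norm y = 1" "norm p = 1" "norm q = 1"
  shows "\<bar>y \<bullet> p\<bar> * \<bar>y \<bullet> q\<bar> - sqrt (1 - (y \<bullet> p)\<^sup>2) * sqrt (1 - (y \<bullet> q)\<^sup>2) \<le> \<bar>p \<bullet> q\<bar>"
proof -
  have yy: "y \<bullet> y = 1" using assms by (simp add: dot_square_norm)
  have n: "norm (w - (y \<bullet> w) *\<^sub>R y) = sqrt (1 - (y \<bullet> w)\<^sup>2)" if "norm w = 1" for w
  proof -
    have "w \<bullet> w = 1" using that by (simp add: dot_square_norm)
    then show ?thesis unfolding norm_eq_sqrt_inner
      by (simp add: inner_diff_left inner_diff_right yy inner_commute[of w y] power2_eq_square)
  qed
  have "p \<bullet> q = (y \<bullet> p) * (y \<bullet> q) + (p - (y \<bullet> p) *\<^sub>R y) \<bullet> (q - (y \<bullet> q) *\<^sub>R y)"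
    by (simp add: inner_diff_left inner_diff_right yy inner_commute[of p y] inner_commute[of q y])
  moreover have "\<bar>(p - (y \<bullet> p) *\<^sub>R y) \<bullet> (q - (y \<bullet> q) *\<^sub>R y)\<bar> \<le> sqrt (1 - (y \<bullet> p)\<^sup>2) * sqrt (1 - (y \<bullet> q)\<^sup>2)"
    using Cauchy_Schwarz_ineq2[of "p - (y \<bullet> p) *\<^sub>R y" "q - (y \<bullet> q) *\<^sub>R y"] n assms by simp
  ultimately show ?thesis unfolding abs_mult[symmetric] by linarith
qed

text \<open>Banach's fixed-point theorem for the maximum norm over the indices below M, with an
  explicit coordinatewise bound K playing the role of that norm. The fixed point is the limit of the
  iterates from zero, summed as a telescoping series.\<close>

lemma contraction_fixpoint:
  fixes E :: "(nat \<Rightarrow> 'a::banach) \<Rightarrow> nat \<Rightarrow> 'a"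
  assumes c: "0 \<le> c" "c < 1"
    and E: "\<And>z w K j. j < M \<Longrightarrow> (\<And>i. i < M \<Longrightarrow> norm (z i - w i) \<le> K) \<Longrightarrow> norm (E z j - E w j) \<le> c * K"
  shows "\<exists>z. \<forall>j<M. E z j = z j"
proof -
  define Y where "Y n = (E ^^ n) (\<lambda>_. 0)" for n
  have Y: "Y (Suc n) = E (Y n)" for n by (simp add: Y_def)
  define K where "K = (\<Sum>i<M. norm (Y 1 i - Y 0 i))"
  have step: "norm (Y (Suc n) j - Y n j) \<le> c ^ n * K" if "j < M" for n j
    using that
  proof (induction n arbitrary: j)
    case 0
    then show ?case
      using member_le_sum[of j "{..<M}" "\<lambda>i. norm (Y 1 i - Y 0 i)"] by (simp add: K_def)
  next
    case (Suc n)
    then show ?case using E[of j "Y (Suc n)" "Y n" "c ^ n * K"] by (simp add: Y mult.assoc)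
  qed
  define z where "z j = Y 0 j + (\<Sum>n. Y (Suc n) j - Y n j)" for j
  have lim: "(\<lambda>n. Y n j) \<longlonglongrightarrow> z j" if "j < M" for j
  proof -
    have "summable (\<lambda>n. Y (Suc n) j - Y n j)"
      by (rule summable_comparison_test'[of "\<lambda>n. c ^ n * K" 0])
        (use step[OF that] c in \<open>auto intro!: summable_mult2 summable_geometric\<close>)
    then have "(\<lambda>n. \<Sum>k<n. Y (Suc k) j - Y k j) \<longlonglongrightarrow> (\<Sum>n. Y (Suc n) j - Y n j)"
      by (rule summable_LIMSEQ)
    then have "(\<lambda>n. Y 0 j + (\<Sum>k<n. Y (Suc k) j - Y k j)) \<longlonglongrightarrow> z j"
      unfolding z_def by (intro tendsto_intros)
    moreover have "Y 0 j + (\<Sum>k<n. Y (Suc k) j - Y k j) = Y n j" for n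
      using sum_lessThan_telescope[of "\<lambda>n. Y n j" n] by simp
    ultimately show ?thesis by simp
  qed
  have "E z j = z j" if j: "j < M" for j
  proof (rule LIMSEQ_unique)
    show "(\<lambda>n. Y (Suc n) j) \<longlonglongrightarrow> z j" by (rule LIMSEQ_Suc[OF lim[OF j]])
    show "(\<lambda>n. Y (Suc n) j) \<longlonglongrightarrow> E z j"
    proof (rule tendstoI)
      fix e :: real assume e: "e > 0"
      have "\<forall>\<^sub>F n in sequentially. \<forall>i\<in>{..<M}. dist (Y n i) (z i) < e"
        by (rule eventually_ball_finite) (use lim e in \<open>auto dest: tendstoD\<close>)
      then show "\<forall>\<^sub>F n in sequentially. dist (Y (Suc n) j) (E z j) < e"
      proof eventually_elim
        case (elim n)
        then have "norm (E (Y n) j - E z j) \<le> c * e"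
          by (intro E[OF j]) (auto simp: dist_norm less_imp_le)
        also have "\<dots> < 1 * e" using c e by (intro mult_strict_right_mono) auto
        finally show ?case by (simp add: Y dist_norm)
      qed
    qed
  qed
  then show ?thesis by blast
qed

text \<open>The \<open>p i\<close> are unit quaternions of the nodes. The absolute value makes the
  separation a statement about lines, and 18/(4m + 1) is half the required rotation angle once N is
  bounded by 4m.\<close>

locale separated_rotations =
  fixes m M :: nat and p :: "nat \<Rightarrow> real^4"
  assumes m5: "m \<ge> 5"
    and unit: "i < M \<Longrightarrow> norm (p i) = 1"
    and sep: "i < M \<Longrightarrow> j < M \<Longrightarrow> i \<noteq> j \<Longrightarrow> \<bar>p i \<bullet> p j\<bar> \<le> cos (18 / (4 * real m + 1))"
begin

definition "\<delta> = 18 / (4 * real m + 1)"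

lemma m_real: "real m \<ge> 5" using m5 by simp

lemma delta_bounds: "0 < \<delta>" "\<delta> \<le> 6 / 7" "real m * \<delta> \<ge> 30 / 7"
  using m_real by (auto simp: \<delta>_def field_simps)

lemma sin_delta: "real m * sin \<delta> \<ge> 376 / 100" "real m * sin (\<delta> / 2) \<ge> 207 / 100"
  "sin (\<delta> / 2) > 0" "sin (\<delta> / 2) \<le> 3 / 7"
proof -
  have d2: "\<delta>\<^sup>2 \<le> (6 / 7)\<^sup>2" using delta_bounds by (intro power_mono) auto
  \<comment> \<open>Both numerical bounds insert \<delta> \<le> 6/7 and m \<delta> \<ge> 30/7 into
    sin t \<ge> t - t^3/6; the two extremes are attained together at m = 5.\<close>
  have "376 / 100 \<le> 30 / 7 * (1 - (6 / 7)\<^sup>2 / 6 :: real)" by (simp add: power2_eq_square)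
  also have "\<dots> \<le> real m * \<delta> * (1 - \<delta>\<^sup>2 / 6)"
    using delta_bounds d2 by (intro mult_mono) (auto simp: power2_eq_square)
  also have "\<dots> = real m * (\<delta> - \<delta> ^ 3 / 6)" by (simp add: algebra_simps power2_eq_square power3_eq_cube)
  also have "\<dots> \<le> real m * sin \<delta>"
    using sin_taylor_bounds(1)[of \<delta>] delta_bounds by (intro mult_left_mono) auto
  finally show "real m * sin \<delta> \<ge> 376 / 100" .
  have "207 / 100 \<le> 30 / 14 * (1 - (6 / 7)\<^sup>2 / 24 :: real)" by (simp add: power2_eq_square)
  also have "\<dots> \<le> real m * \<delta> / 2 * (1 - \<delta>\<^sup>2 / 24)"
    using delta_bounds d2 by (intro mult_mono) (auto simp: power2_eq_square)
  also have "\<dots> = real m * (\<delta> / 2 - (\<delta> / 2) ^ 3 / 6)" by (simp add: algebra_simps power2_eq_square power3_eq_cube)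
  also have "\<dots> \<le> real m * sin (\<delta> / 2)"
    using sin_taylor_bounds(1)[of "\<delta> / 2"] delta_bounds by (intro mult_left_mono) auto
  finally show "real m * sin (\<delta> / 2) \<ge> 207 / 100" .
  show "sin (\<delta> / 2) > 0" using delta_bounds pi_gt3 by (intro sin_gt_zero) auto
  show "sin (\<delta> / 2) \<le> 3 / 7" using sin_x_le_x[of "\<delta> / 2"] delta_bounds by linarith
qed

lemma sep': "i < M \<Longrightarrow> j < M \<Longrightarrow> i \<noteq> j \<Longrightarrow> \<bar>p i \<bullet> p j\<bar> \<le> 1 - 2 * (sin (\<delta> / 2))\<^sup>2"
  using sep[of i j, folded \<delta>_def] cos_double_sin[of "\<delta> / 2"] by simp

section \<open>Angles between a point and the node lines\<close>

definition ang :: "real^4 \<Rightarrow> nat \<Rightarrow> real" where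
  "ang y i = arccos \<bar>y \<bullet> p i\<bar>"

lemma ang:
  assumes "norm y = 1" "i < M"
  shows "0 \<le> ang y i" "ang y i \<le> pi / 2" "cos (ang y i) = \<bar>y \<bullet> p i\<bar>" "sin (ang y i) = sqrt (1 - (y \<bullet> p i)\<^sup>2)"
proof -
  have t: "\<bar>y \<bullet> p i\<bar> \<le> 1" using Cauchy_Schwarz_ineq2[of y "p i"] assms unit by simp
  then show "0 \<le> ang y i" "cos (ang y i) = \<bar>y \<bullet> p i\<bar>" "sin (ang y i) = sqrt (1 - (y \<bullet> p i)\<^sup>2)"
    by (auto simp: ang_def arccos_lbound cos_arccos_abs sin_arccos_abs)
  show "ang y i \<le> pi / 2" unfolding ang_def using t by (intro arccos_le_pi2) auto
qed

lemma ang_triangle: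
  assumes y: "norm y = 1" and ij: "i < M" "j < M" "i \<noteq> j"
  shows "\<delta> \<le> ang y i + ang y j"
proof -
  have "cos (ang y i + ang y j) \<le> \<bar>p i \<bullet> p j\<bar>"
    using inner_sphere_ge[of y "p i" "p j"] y unit ij by (simp add: cos_add ang)
  also have "\<dots> \<le> cos \<delta>" using sep ij by (simp add: \<delta>_def)
  finally show ?thesis
    using cos_mono_le_eq[of "ang y i + ang y j" \<delta>] delta_bounds ang[OF y ij(1)] ang[OF y ij(2)] pi_gt3
    by auto
qed

text \<open>Two regimes. Close to node j the others stay at angle at least \<delta> -
  \<open>ang y j\<close>, and sin (\<delta> - t) \<ge> sin \<delta> - t. If j is a nearest node,
  every other node is at angle at least \<delta>/2, however far y is from j.\<close>

lemma sine_ge: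
  assumes y: "norm y = 1" and ij: "i < M" "j < M" "i \<noteq> j"
  shows "376 / 100 - real m * ang y j \<le> real m * sqrt (1 - (y \<bullet> p i)\<^sup>2)"
    and "ang y j \<le> ang y i \<Longrightarrow> 207 / 100 \<le> real m * sqrt (1 - (y \<bullet> p i)\<^sup>2)"
proof -
  note A = ang[OF y ij(1)] ang[OF y ij(2)]
  have s: "sqrt (1 - (y \<bullet> p i)\<^sup>2) = sin (ang y i)" using A by simp
  have sj: "0 \<le> sin (ang y j)"
    using ang(1,2)[OF y ij(2)] by (intro sin_ge_zero) auto
  have "sin \<delta> - ang y j \<le> sin (ang y i)"
  proof (cases "ang y j \<le> \<delta>")
    case True
    have 1: "sin \<delta> = sin (\<delta> - ang y j) * cos (ang y j) + cos (\<delta> - ang y j) * sin (ang y j)"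
      using sin_add[of "\<delta> - ang y j" "ang y j"] by simp
    have 0: "0 \<le> sin (\<delta> - ang y j)" using True delta_bounds A pi_gt3 by (intro sin_ge_zero) auto
    have "sin (\<delta> - ang y j) * cos (ang y j) \<le> sin (\<delta> - ang y j) * 1" using 0 by (intro mult_left_mono) auto
    moreover have "cos (\<delta> - ang y j) * sin (ang y j) \<le> 1 * ang y j"
      using ang(1)[OF y ij(2)] sj by (intro mult_mono sin_x_le_x) auto
    moreover have "sin (\<delta> - ang y j) \<le> sin (ang y i)"
      using ang_triangle[OF y ij] True delta_bounds A pi_gt3 by (intro sin_monotone_2pi_le) auto
    ultimately show ?thesis using 1 by linarith
  next
    case False
    have "sin \<delta> \<le> \<delta>" using delta_bounds by (intro sin_x_le_x) auto
    moreover have "0 \<le> sin (ang y i)" using A by (intro sin_ge_zero) auto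
    ultimately show ?thesis using False by linarith
  qed
  then have "real m * (sin \<delta> - ang y j) \<le> real m * sin (ang y i)" by (intro mult_left_mono) auto
  then show "376 / 100 - real m * ang y j \<le> real m * sqrt (1 - (y \<bullet> p i)\<^sup>2)"
    using sin_delta(1) by (simp add: s algebra_simps)
  assume "ang y j \<le> ang y i"
  then have "\<delta> / 2 \<le> ang y i" using ang_triangle[OF y ij] by linarith
  then have "sin (\<delta> / 2) \<le> sin (ang y i)" using A delta_bounds pi_gt3 by (intro sin_monotone_2pi_le) auto
  then have "real m * sin (\<delta> / 2) \<le> real m * sin (ang y i)" by (intro mult_left_mono) auto
  then show "207 / 100 \<le> real m * sqrt (1 - (y \<bullet> p i)\<^sup>2)" using sin_delta(2) by (simp add: s)
qed

definition Z :: "real^4 \<Rightarrow> nat \<Rightarrow> real" where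
  "Z y i = 1 / (real m * sqrt (1 - (p i \<bullet> y)\<^sup>2))"

lemma sum_Z_le:
  assumes y: "norm y = 1" and j: "j < M" and xi: "xi > 0"
    and X: "\<And>i. i < M \<Longrightarrow> i \<noteq> j \<Longrightarrow> xi \<le> real m * sqrt (1 - (y \<bullet> p i)\<^sup>2)"
  shows "(\<Sum>i\<in>{..<M}-{j}. Z y i ^ 7) \<le> 125 * (1 / xi) ^ 7 + 149 / 10000"
    and "(\<Sum>i\<in>{..<M}-{j}. Z y i ^ 8) \<le> 125 * (1 / xi) ^ 8 + 296 / 100000"
    and "\<And>i. i < M \<Longrightarrow> i \<noteq> j \<Longrightarrow> Z y i \<le> 1 / xi"
    and "\<And>i. i < M \<Longrightarrow> i \<noteq> j \<Longrightarrow> \<bar>p i \<bullet> y\<bar> < 1"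
proof -
  have Zc: "Z y i = 1 / (real m * sqrt (1 - (y \<bullet> p i)\<^sup>2))" for i
    by (simp add: Z_def inner_commute)
  note * = inverse_power_sum_le[of "{..<M}-{j}" y p "sin (\<delta> / 2)" "real m" xi]
  show "(\<Sum>i\<in>{..<M}-{j}. Z y i ^ 7) \<le> 125 * (1 / xi) ^ 7 + 149 / 10000"
    unfolding Zc by (rule *(1)) (use y unit sep' sin_delta m_real xi X in auto)
  show "(\<Sum>i\<in>{..<M}-{j}. Z y i ^ 8) \<le> 125 * (1 / xi) ^ 8 + 296 / 100000"
    unfolding Zc by (rule *(2)) (use y unit sep' sin_delta m_real xi X in auto)
  fix i assume i: "i < M" "i \<noteq> j"
  have Xi: "xi \<le> real m * sqrt (1 - (y \<bullet> p i)\<^sup>2)" using X i by simp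
  then show "Z y i \<le> 1 / xi" unfolding Zc using xi by (intro divide_left_mono) auto
  have "0 < real m * sqrt (1 - (y \<bullet> p i)\<^sup>2)" using Xi xi by linarith
  then have "(y \<bullet> p i)\<^sup>2 < 1" by (simp add: zero_less_mult_iff)
  then show "\<bar>p i \<bullet> y\<bar> < 1" by (simp add: inner_commute abs_square_less_1)
qed

text \<open>Projection to the tangent space at c. Projecting inside the construction lets the
  unknown gradient coefficients range over all of the four-dimensional space, so the fixed-point
  iteration runs without a tangency constraint.\<close>

definition proj :: "real^4 \<Rightarrow> real^4 \<Rightarrow> real^4" where
  "proj c b = b - (b \<bullet> c) *\<^sub>R c"

lemma proj_inner: "norm c = 1 \<Longrightarrow> proj c b \<bullet> c = 0"
  by (simp add: proj_def inner_diff_left dot_square_norm)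

lemma proj_inner': "v \<bullet> c = 0 \<Longrightarrow> proj c b \<bullet> v = b \<bullet> v"
  by (simp add: proj_def inner_diff_left inner_commute[of c v])

lemma proj_diff: "proj c (a - b) = proj c a - proj c b"
  by (simp add: proj_def algebra_simps inner_diff_left scaleR_diff_left)

lemma norm_proj_le: "norm c = 1 \<Longrightarrow> norm (proj c b) \<le> norm b"
proof -
  assume c: "norm c = 1"
  have "(norm (proj c b))\<^sup>2 = proj c b \<bullet> b"
    using proj_inner[OF c, of b] unfolding power2_norm_eq_inner
    by (subst (2) proj_def) (simp add: inner_diff_right)
  also have "\<dots> \<le> norm (proj c b) * norm b" by (rule norm_cauchy_schwarz)
  finally show ?thesis by (cases "proj c b = 0") (auto simp: power2_eq_square)
qed

text \<open>The pair \<open>z i\<close> holds the value and gradient coefficients of node i. The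
  gradient part is scaled by m, the natural size of a derivative of the kernel, so that both
  coefficients can be compared in one norm.\<close>

definition h :: "(nat \<Rightarrow> real \<times> (real^4)) \<Rightarrow> nat \<Rightarrow> real^4 \<Rightarrow> real" where
  "h z i y = bump m (fst (z i)) (real m *\<^sub>R proj (p i) (snd (z i))) (p i) y"

definition h1 :: "(nat \<Rightarrow> real \<times> (real^4)) \<Rightarrow> nat \<Rightarrow> real^4 \<Rightarrow> real^4 \<Rightarrow> real" where
  "h1 z i y v = bump1 m (fst (z i)) (real m *\<^sub>R proj (p i) (snd (z i))) (p i) y v"

definition h2 :: "(nat \<Rightarrow> real \<times> (real^4)) \<Rightarrow> nat \<Rightarrow> real^4 \<Rightarrow> real^4 \<Rightarrow> real" where
  "h2 z i y v = bump2 m (fst (z i)) (real m *\<^sub>R proj (p i) (snd (z i))) (p i) y v"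

definition rest :: "(nat \<Rightarrow> real \<times> (real^4)) \<Rightarrow> nat \<Rightarrow> real^4 \<Rightarrow> real" where
  "rest z j y = (\<Sum>i\<in>{..<M}-{j}. h z i y)"

definition rest1 :: "(nat \<Rightarrow> real \<times> (real^4)) \<Rightarrow> nat \<Rightarrow> real^4 \<Rightarrow> real^4 \<Rightarrow> real" where
  "rest1 z j y v = (\<Sum>i\<in>{..<M}-{j}. h1 z i y v)"

definition rest2 :: "(nat \<Rightarrow> real \<times> (real^4)) \<Rightarrow> nat \<Rightarrow> real^4 \<Rightarrow> real^4 \<Rightarrow> real" where
  "rest2 z j y v = (\<Sum>i\<in>{..<M}-{j}. h2 z i y v)"

text \<open>At \<open>p j\<close> the directional derivative \<open>rest1\<close> is linear in the
  direction; \<open>grad\<close> is the vector representing it.\<close>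

definition grad :: "(nat \<Rightarrow> real \<times> (real^4)) \<Rightarrow> nat \<Rightarrow> real^4" where
  "grad z j = (\<chi> k. rest1 z j (p j) (axis k 1))"

text \<open>Linearity in the coefficients: it reduces the contraction estimate for two arguments to
  a size estimate for their difference.\<close>

lemma h_diff: "h (\<lambda>i. z i - w i) i y = h z i y - h w i y"
  and h1_diff: "h1 (\<lambda>i. z i - w i) i y v = h1 z i y v - h1 w i y v"
  by (simp_all add: h_def h1_def bump_def bump1_def proj_diff scaleR_diff_right inner_diff_left algebra_simps)

lemma rest_diff: "rest (\<lambda>i. z i - w i) j y = rest z j y - rest w j y"
  and rest1_diff: "rest1 (\<lambda>i. z i - w i) j y v = rest1 z j y v - rest1 w j y v"
  by (simp_all add: rest_def rest1_def h_diff h1_diff sum_subtractf)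

lemma grad_diff: "grad (\<lambda>i. z i - w i) j = grad z j - grad w j"
  by (simp add: grad_def rest1_diff vec_eq_iff)

lemma grad_inner: "grad z j \<bullet> v = rest1 z j (p j) v"
proof -
  have lin: "linear (rest1 z j (p j))"
    unfolding rest1_def h1_def bump1_def
    by (rule linearI) (simp_all add: inner_add_right sum.distrib[symmetric] sum_distrib_left algebra_simps)
  have "rest1 z j (p j) v = rest1 z j (p j) (\<Sum>k\<in>UNIV. v $ k *\<^sub>R axis k 1)"
    using basis_expansion[of v] by (simp add: scalar_mult_eq_scaleR)
  also have "\<dots> = (\<Sum>k\<in>UNIV. v $ k * rest1 z j (p j) (axis k 1))"
    using lin by (simp add: linear_sum linear_cmul)
  finally show ?thesis by (simp add: grad_def inner_vec_def mult.commute)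
qed

text \<open>The bounds for a single bump are summed with the packing estimates. The threshold
  336/100 ensures Z \<le> 298/1000, the range in which the derivative bounds hold.\<close>

lemma rest_bounds:
  assumes y: "norm y = 1" and j: "j < M" and xi: "xi > 0"
    and X: "\<And>i. i < M \<Longrightarrow> i \<noteq> j \<Longrightarrow> xi \<le> real m * sqrt (1 - (y \<bullet> p i)\<^sup>2)"
    and AB: "\<And>i. i < M \<Longrightarrow> \<bar>fst (z i)\<bar> \<le> A" "\<And>i. i < M \<Longrightarrow> norm (snd (z i)) \<le> B"
  defines "W8 \<equiv> 125 * (1 / xi) ^ 8 + 296 / 100000" and "W7 \<equiv> 125 * (1 / xi) ^ 7 + 149 / 10000"
  shows "\<bar>rest z j y\<bar> \<le> A * W8 + B * W7"
    and "norm v = 1 \<Longrightarrow> y \<bullet> v = 0 \<Longrightarrow> xi \<ge> 336 / 100 \<Longrightarrow>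
           \<bar>rest1 z j y v\<bar> \<le> real m * (104 / 10 * (A * W8 + B * W7) + 2 * B * W8)"
    and "norm v = 1 \<Longrightarrow> y \<bullet> v = 0 \<Longrightarrow> xi \<ge> 336 / 100 \<Longrightarrow>
           \<bar>rest2 z j y v\<bar> \<le> (real m)\<^sup>2 * (115 * (A * W8 + B * W7) + 43 * B * W8)"
proof -
  let ?I = "{..<M}-{j}"
  have S: "(\<Sum>i\<in>?I. Z y i ^ 7) \<le> W7" "(\<Sum>i\<in>?I. Z y i ^ 8) \<le> W8"
    "\<And>i. i < M \<Longrightarrow> i \<noteq> j \<Longrightarrow> Z y i \<le> 1 / xi" "\<And>i. i < M \<Longrightarrow> i \<noteq> j \<Longrightarrow> \<bar>p i \<bullet> y\<bar> < 1"
    unfolding W7_def W8_def using sum_Z_le[OF y j xi] X by blast+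
  have A0: "A \<ge> 0" "B \<ge> 0" using AB[OF j] abs_ge_zero[of "fst (z j)"] norm_ge_zero[of "snd (z j)"] by linarith+
  have b: "(real m *\<^sub>R proj (p i) (snd (z i))) \<bullet> p i = 0" "norm (real m *\<^sub>R proj (p i) (snd (z i))) \<le> real m * B"
    if "i < M" for i
    using proj_inner[OF unit[OF that], of "snd (z i)"] order_trans[OF norm_proj_le[OF unit[OF that]] AB(2)[OF that]]
    by (simp_all add: mult_left_mono)
  have bb: "\<bar>h z i y\<bar> \<le> A * Z y i ^ 8 + B * Z y i ^ 7"
    "norm v = 1 \<Longrightarrow> y \<bullet> v = 0 \<Longrightarrow> Z y i \<le> 298 / 1000 \<Longrightarrow>
       \<bar>h1 z i y v\<bar> \<le> real m * (104 / 10 * (A * Z y i ^ 8 + B * Z y i ^ 7) + 2 * B * Z y i ^ 8)"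
    "norm v = 1 \<Longrightarrow> y \<bullet> v = 0 \<Longrightarrow> Z y i \<le> 298 / 1000 \<Longrightarrow>
       \<bar>h2 z i y v\<bar> \<le> (real m)\<^sup>2 * (115 * (A * Z y i ^ 8 + B * Z y i ^ 7) + 43 * B * Z y i ^ 8)"
    if i: "i \<in> ?I" for i v
    using bump_bounds[OF m5 unit y b AB(1) S(4), of i i] i
    unfolding Z_def h_def h1_def h2_def by auto
  have W: "(\<Sum>i\<in>?I. A * Z y i ^ 8 + B * Z y i ^ 7) \<le> A * W8 + B * W7"
    unfolding sum.distrib sum_distrib_left[symmetric]
    using S(1,2) A0 by (intro add_mono mult_left_mono) auto
  note W2 = S(2)
  show "\<bar>rest z j y\<bar> \<le> A * W8 + B * W7"
    unfolding rest_def by (rule order_trans[OF sum_abs order_trans[OF sum_mono W]]) (use bb(1) in auto)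
  assume v: "norm v = 1" "y \<bullet> v = 0" and xi3: "xi \<ge> 336 / 100"
  have "1 / xi \<le> 1 / (336 / 100)" using xi3 by (intro divide_left_mono) auto
  then have Zs: "Z y i \<le> 298 / 1000" if "i < M" "i \<noteq> j" for i
    using S(3)[OF that] by simp
  have "\<bar>rest1 z j y v\<bar> \<le> (\<Sum>i\<in>?I. real m * (104 / 10 * (A * Z y i ^ 8 + B * Z y i ^ 7) + 2 * B * Z y i ^ 8))"
    unfolding rest1_def by (rule order_trans[OF sum_abs sum_mono]) (use bb(2) v Zs in auto)
  also have "\<dots> = real m * (104 / 10 * (\<Sum>i\<in>?I. A * Z y i ^ 8 + B * Z y i ^ 7) + 2 * B * (\<Sum>i\<in>?I. Z y i ^ 8))"
    by (simp only: sum_distrib_left sum.distrib[symmetric])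
  also have "\<dots> \<le> real m * (104 / 10 * (A * W8 + B * W7) + 2 * B * W8)"
    using W W2 A0 by (intro mult_left_mono add_mono) auto
  finally show "\<bar>rest1 z j y v\<bar> \<le> real m * (104 / 10 * (A * W8 + B * W7) + 2 * B * W8)" .
  have "\<bar>rest2 z j y v\<bar> \<le> (\<Sum>i\<in>?I. (real m)\<^sup>2 * (115 * (A * Z y i ^ 8 + B * Z y i ^ 7) + 43 * B * Z y i ^ 8))"
    unfolding rest2_def by (rule order_trans[OF sum_abs sum_mono]) (use bb(3) v Zs in auto)
  also have "\<dots> = (real m)\<^sup>2 * (115 * (\<Sum>i\<in>?I. A * Z y i ^ 8 + B * Z y i ^ 7) + 43 * B * (\<Sum>i\<in>?I. Z y i ^ 8))"
    by (simp only: sum_distrib_left sum.distrib[symmetric])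
  also have "\<dots> \<le> (real m)\<^sup>2 * (115 * (A * W8 + B * W7) + 43 * B * W8)"
    using W W2 A0 by (intro mult_left_mono add_mono) auto
  finally show "\<bar>rest2 z j y v\<bar> \<le> (real m)\<^sup>2 * (115 * (A * W8 + B * W7) + 43 * B * W8)" .
qed

section \<open>The dual certificate\<close>

lemma ang_self: "j < M \<Longrightarrow> ang (p j) j = 0"
  using unit[of j] by (simp add: ang_def dot_square_norm)

text \<open>At the node itself \<open>ang\<close> is 0, so the other nodes have scaled sine at least
  376/100; 61/10000 and 267/10000 are the resulting sums of eighth and seventh powers. The gradient
  bound is homogeneous of degree one in A and B, which is what both the contraction and the a priori
  estimate use.\<close>

lemma rest_at_center:
  assumes j: "j < M" and AB: "\<And>i. i < M \<Longrightarrow> \<bar>fst (z i)\<bar> \<le> A" "\<And>i. i < M \<Longrightarrow> norm (snd (z i)) \<le> B"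
  shows "\<bar>rest z j (p j)\<bar> \<le> 61 / 10000 * A + 267 / 10000 * B"
    and "norm (proj (p j) (grad z j)) \<le> real m * (104 / 10 * (61 / 10000 * A + 267 / 10000 * B) + 122 / 10000 * B)"
proof -
  let ?W8 = "125 * (1 / (376 / 100)) ^ 8 + 296 / 100000 :: real" and ?W7 = "125 * (1 / (376 / 100)) ^ 7 + 149 / 10000 :: real"
  have W: "?W8 \<le> 61 / 10000" "?W7 \<le> 267 / 10000" by (simp_all add: power_divide)
  have A0: "A \<ge> 0" "B \<ge> 0" using AB[OF j] abs_ge_zero[of "fst (z j)"] norm_ge_zero[of "snd (z j)"] by linarith+
  have X: "376 / 100 \<le> real m * sqrt (1 - (p j \<bullet> p i)\<^sup>2)" if "i < M" "i \<noteq> j" for i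
    using sine_ge(1)[OF unit[OF j] that(1) j that(2)] by (simp add: ang_self[OF j])
  have AW: "A * ?W8 + B * ?W7 \<le> 61 / 10000 * A + 267 / 10000 * B"
    using mult_left_mono[OF W(1) A0(1)] mult_left_mono[OF W(2) A0(2)] by linarith
  have BW: "2 * B * ?W8 \<le> 122 / 10000 * B" using mult_left_mono[OF W(1) A0(2)] by linarith
  note R = rest_bounds[OF unit[OF j] j, of "376 / 100" z A B]
  show "\<bar>rest z j (p j)\<bar> \<le> 61 / 10000 * A + 267 / 10000 * B"
    by (rule order_trans[OF R(1) AW]) (use X AB in auto)
  have R1: "\<bar>rest1 z j (p j) v\<bar> \<le> real m * (104 / 10 * (61 / 10000 * A + 267 / 10000 * B) + 122 / 10000 * B)"
    if v: "norm v = 1" "p j \<bullet> v = 0" for v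
  proof -
    have "\<bar>rest1 z j (p j) v\<bar> \<le> real m * (104 / 10 * (A * ?W8 + B * ?W7) + 2 * B * ?W8)"
      by (rule R(2)) (use X AB v in auto)
    also have "\<dots> \<le> real m * (104 / 10 * (61 / 10000 * A + 267 / 10000 * B) + 122 / 10000 * B)"
      by (intro mult_left_mono add_mono AW BW) auto
    finally show ?thesis .
  qed
  \<comment> \<open>The norm of the tangential gradient is the derivative in its own direction, so
    the bound for unit tangent vectors applies to the normalised \<open>w\<close>.\<close>
  define w where "w = proj (p j) (grad z j)"
  show "norm (proj (p j) (grad z j)) \<le> real m * (104 / 10 * (61 / 10000 * A + 267 / 10000 * B) + 122 / 10000 * B)"
  proof (cases "w = 0")
    case True
    then show ?thesis using A0 by (simp add: w_def)
  next
    case False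
    define v where "v = (1 / norm w) *\<^sub>R w"
    have v: "norm v = 1" "v \<bullet> p j = 0" using False proj_inner[OF unit[OF j]] by (simp_all add: v_def w_def)
    have "norm w = w \<bullet> v" using False by (simp add: v_def dot_square_norm power2_eq_square)
    also have "\<dots> = rest1 z j (p j) v" unfolding w_def proj_inner'[OF v(2)] grad_inner ..
    also have "\<dots> \<le> \<bar>rest1 z j (p j) v\<bar>" by simp
    finally show ?thesis using R1[of v] v by (simp add: w_def inner_commute)
  qed
qed

text \<open>The interpolation conditions say that each node's coefficients compensate the
  interference of all others: a fixed-point equation for \<open>T\<close>. The interference is
  small, so \<open>T\<close> contracts, and inserting the largest coefficients into the same
  estimates bounds the solution.\<close>

lemma interpolation_coefficients:
  assumes u: "\<And>i. i < M \<Longrightarrow> \<bar>u i\<bar> = 1"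
  obtains z where
    "\<And>j. j < M \<Longrightarrow> fst (z j) = u j - rest z j (p j)"
    "\<And>j v. j < M \<Longrightarrow> v \<bullet> p j = 0 \<Longrightarrow> real m * (proj (p j) (snd (z j)) \<bullet> v) = - rest1 z j (p j) v"
    "\<And>i. i < M \<Longrightarrow> \<bar>fst (z i)\<bar> \<le> 101 / 100" "\<And>i. i < M \<Longrightarrow> norm (snd (z i)) \<le> 91 / 1000"
    "\<And>i. i < M \<Longrightarrow> \<bar>u i - fst (z i)\<bar> \<le> 1 / 100"
proof -
  define T where "T z j = (u j - rest z j (p j), - ((1 / real m) *\<^sub>R proj (p j) (grad z j)))" for z j
  have m0: "real m > 0" using m_real by linarith
  have gr: "norm ((1 / real m) *\<^sub>R proj (p j) (grad z j)) \<le> 104 / 10 * (61 / 10000 * A + 267 / 10000 * B) + 122 / 10000 * B"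
    if "j < M" "\<And>i. i < M \<Longrightarrow> \<bar>fst (z i)\<bar> \<le> A" "\<And>i. i < M \<Longrightarrow> norm (snd (z i)) \<le> B" for j z A B
  proof -
    have "norm (proj (p j) (grad z j)) \<le> real m * (104 / 10 * (61 / 10000 * A + 267 / 10000 * B) + 122 / 10000 * B)"
      by (rule rest_at_center(2)) (use that in auto)
    then show ?thesis using m0 by (simp add: pos_divide_le_eq mult.commute)
  qed
  have "\<exists>z. \<forall>j<M. T z j = z j"
  proof (rule contraction_fixpoint[of "1 / 2"])
    fix z w :: "nat \<Rightarrow> real \<times> (real^4)" and K j
    assume j: "j < M" and K: "\<And>i. i < M \<Longrightarrow> norm (z i - w i) \<le> K"
    let ?d = "\<lambda>i. z i - w i"
    have d: "\<bar>fst (?d i)\<bar> \<le> K" "norm (snd (?d i)) \<le> K" if "i < M" for i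
    proof -
      have "norm (fst (?d i)) \<le> norm (?d i)" "norm (snd (?d i)) \<le> norm (?d i)"
        using norm_fst_le[of "fst (?d i)" "snd (?d i)"] norm_snd_le[of "snd (?d i)" "fst (?d i)"] by (simp_all only: prod.collapse)
      then show "\<bar>fst (?d i)\<bar> \<le> K" "norm (snd (?d i)) \<le> K" using K[OF that] by (simp_all only: real_norm_def)
    qed
    have eq: "T z j - T w j = (- rest ?d j (p j), - ((1 / real m) *\<^sub>R proj (p j) (grad ?d j)))"
      by (simp add: T_def rest_diff grad_diff proj_diff algebra_simps)
    have "norm (T z j - T w j) \<le> \<bar>rest ?d j (p j)\<bar> + norm ((1 / real m) *\<^sub>R proj (p j) (grad ?d j))"
      unfolding eq by (rule order_trans[OF norm_Pair_le]) simp
    also have "\<dots> \<le> 1 / 2 * K"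
    proof -
      \<comment> \<open>The two bounds together amount to less than 0.39 K.\<close>
      have "\<bar>rest ?d j (p j)\<bar> \<le> 61 / 10000 * K + 267 / 10000 * K"
        by (rule rest_at_center(1)) (use j d in auto)
      moreover have "norm ((1 / real m) *\<^sub>R proj (p j) (grad ?d j)) \<le> 104 / 10 * (61 / 10000 * K + 267 / 10000 * K) + 122 / 10000 * K"
        by (rule gr) (use j d in auto)
      moreover have "0 \<le> K" using K[OF j] norm_ge_zero[of "z j - w j"] by linarith
      ultimately show ?thesis by simp
    qed
    finally show "norm (T z j - T w j) \<le> 1 / 2 * K" .
  qed auto
  then obtain z where z: "\<And>j. j < M \<Longrightarrow> z j = T z j" by metis
  have z1: "fst (z j) = u j - rest z j (p j)" "snd (z j) = - ((1 / real m) *\<^sub>R proj (p j) (grad z j))" if "j < M" for j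
    using z[OF that] by (simp_all add: T_def prod_eq_iff)
  have z2: "real m * (proj (p j) (snd (z j)) \<bullet> v) = - rest1 z j (p j) v" if "j < M" "v \<bullet> p j = 0" for j v
  proof -
    have "proj (p j) (snd (z j)) \<bullet> v = snd (z j) \<bullet> v" by (rule proj_inner'[OF that(2)])
    also have "\<dots> = - (1 / real m * (proj (p j) (grad z j) \<bullet> v))" by (simp add: z1(2)[OF that(1)])
    also have "proj (p j) (grad z j) \<bullet> v = rest1 z j (p j) v" unfolding proj_inner'[OF that(2)] grad_inner ..
    finally show ?thesis using m0 by simp
  qed
  have "(\<forall>i<M. \<bar>fst (z i)\<bar> \<le> 101 / 100) \<and> (\<forall>i<M. norm (snd (z i)) \<le> 91 / 1000) \<and> (\<forall>i<M. \<bar>u i - fst (z i)\<bar> \<le> 1 / 100)"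
  proof (cases "M = 0")
    case False
    \<comment> \<open>Maximal coefficients satisfy A \<le> 1 + small multiples of A and B, and B
      \<le> small multiples of A and B. Solving the second inequality for B and substituting gives A
      \<le> 1009/1000.\<close>
    define A B where "A = Max ((\<lambda>i. \<bar>fst (z i)\<bar>) ` {..<M})" and "B = Max ((\<lambda>i. norm (snd (z i))) ` {..<M})"
    have AB: "\<bar>fst (z i)\<bar> \<le> A" "norm (snd (z i)) \<le> B" if "i < M" for i
      using that by (auto simp: A_def B_def intro!: Max_ge)
    have ne: "{..<M} \<noteq> {}" using False by auto
    have "A \<in> (\<lambda>i. \<bar>fst (z i)\<bar>) ` {..<M}" "B \<in> (\<lambda>i. norm (snd (z i))) ` {..<M}"
      unfolding A_def B_def using ne by (auto intro!: Max_in)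
    then obtain i j where ij: "i < M" "A = \<bar>fst (z i)\<bar>" "j < M" "B = norm (snd (z j))" by auto
    have rb: "\<bar>rest z i (p i)\<bar> \<le> 61 / 10000 * A + 267 / 10000 * B" if "i < M" for i
      by (rule rest_at_center(1)) (use that AB in auto)
    have "A \<le> 1 + (61 / 10000 * A + 267 / 10000 * B)"
      using rb[OF ij(1)] u[OF ij(1)] z1(1)[OF ij(1)] ij(2) by linarith
    moreover have "norm ((1 / real m) *\<^sub>R proj (p j) (grad z j)) \<le> 104 / 10 * (61 / 10000 * A + 267 / 10000 * B) + 122 / 10000 * B"
      by (rule gr) (use ij AB in auto)
    then have "B \<le> 104 / 10 * (61 / 10000 * A + 267 / 10000 * B) + 122 / 10000 * B"
      unfolding ij(4) z1(2)[OF ij(3)] norm_minus_cancel .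
    moreover have "0 \<le> A" using ij by simp
    ultimately have B1: "B \<le> 895 / 10000 * A" and A1: "A \<le> 1 + (61 / 10000 * A + 267 / 10000 * B)"
      by (simp_all add: field_simps)
    have A2: "A \<le> 1009 / 1000" using A1 B1 by simp
    then have b: "A \<le> 101 / 100" "B \<le> 91 / 1000" "61 / 10000 * A + 267 / 10000 * B \<le> 1 / 100" using B1 by simp_all
    have "\<bar>u i - fst (z i)\<bar> \<le> 1 / 100" if "i < M" for i
      using rb[OF that] z1(1)[OF that] b(3) by linarith
    then show ?thesis using AB b(1,2) by (meson order_trans)
  qed simp
  then show ?thesis using that z1(1) z2 by blast
qed

definition q :: "(nat \<Rightarrow> real \<times> (real^4)) \<Rightarrow> real^4 \<Rightarrow> real" where
  "q z y = (\<Sum>i<M. h z i y)"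

lemma q_split: "j < M \<Longrightarrow> q z y = h z j y + rest z j y"
  unfolding q_def rest_def by (simp add: sum.remove)

lemma q_uminus: "q z (- y) = q z y"
  by (simp add: q_def h_def bump_def ker_even_power)

lemma h_center: "j < M \<Longrightarrow> h z j (p j) = fst (z j)"
  using proj_inner[OF unit[of j], of "snd (z j)"] unit[of j] m_real
  by (simp add: h_def bump_def dot_square_norm ker_def chebU_one)

text \<open>The tangential coefficient pairs with y only through the component of y orthogonal to
  \<open>p j\<close>, of length sin (\<open>ang y j\<close>) \<le> \<open>ang y j\<close>. By
  evenness of the eighth power the kernel may be taken at the cosine of the angle between the
  lines.\<close>

lemma abs_h_le:
  assumes y: "norm y = 1" and j: "j < M" and AB: "\<bar>fst (z j)\<bar> \<le> A" "norm (snd (z j)) \<le> B"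
  shows "\<bar>h z j y\<bar> \<le> (A + B * (real m * ang y j)) * ker m (cos (ang y j)) ^ 8"
proof -
  define b where "b = proj (p j) (snd (z j))"
  have B0: "B \<ge> 0" using AB(2) norm_ge_zero[of "snd (z j)"] by linarith
  have b: "b \<bullet> p j = 0" "norm b \<le> B"
    using proj_inner[OF unit[OF j]] order_trans[OF norm_proj_le[OF unit[OF j]] AB(2)] by (auto simp: b_def)
  have bnd: "\<bar>b \<bullet> y\<bar> \<le> norm b * sin (ang y j)"
  proof (cases "b = 0")
    case False
    have "\<bar>y \<bullet> ((1 / norm b) *\<^sub>R b)\<bar> \<le> sqrt (1 - (y \<bullet> p j)\<^sup>2)"
      by (rule inner_orthonormal_le) (use False y unit[OF j] b in \<open>auto simp: inner_commute\<close>)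
    then show ?thesis using False ang(4)[OF y j] by (simp add: inner_commute pos_divide_le_eq mult.commute)
  qed simp
  also have "\<dots> \<le> B * ang y j"
    using b B0 ang(1,2)[OF y j] by (intro mult_mono sin_x_le_x) (auto intro!: sin_ge_zero)
  finally have "\<bar>b \<bullet> y\<bar> * \<bar>p j \<bullet> y\<bar> \<le> B * ang y j * 1"
    using Cauchy_Schwarz_ineq2[of "p j" y] unit[OF j] y by (intro mult_mono) auto
  then have "\<bar>real m * (b \<bullet> y) * (p j \<bullet> y)\<bar> \<le> real m * (B * ang y j)"
    by (simp add: abs_mult mult.assoc mult_left_mono)
  then have "\<bar>fst (z j) + real m * (b \<bullet> y) * (p j \<bullet> y)\<bar> \<le> A + B * (real m * ang y j)"
    using AB(1) by (simp add: algebra_simps)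
  moreover have "ker m (p j \<bullet> y) ^ 8 = ker m (cos (ang y j)) ^ 8"
    using ker_even_power[of 8 m "y \<bullet> p j"] by (auto simp: ang(3)[OF y j] inner_commute abs_if)
  moreover have "\<bar>h z j y\<bar> = \<bar>fst (z j) + real m * (b \<bullet> y) * (p j \<bullet> y)\<bar> * ker m (p j \<bullet> y) ^ 8"
    by (simp add: h_def bump_def b_def abs_mult)
  ultimately show ?thesis by (simp add: mult_right_mono)
qed

text \<open>Let x be the scaled distance to the nearest node. The budgets for main bump and
  interference are 0.90 + 0.04 up to x = 4/5, then 0.60 + 0.10 up to 6/5, and 0.30 + 0.50 beyond.
  Below 2/5 the main bump gets too close to 1 and a second-order argument takes over.\<close>

lemma q_far:
  assumes AB: "\<And>i. i < M \<Longrightarrow> \<bar>fst (z i)\<bar> \<le> 101 / 100" "\<And>i. i < M \<Longrightarrow> norm (snd (z i)) \<le> 91 / 1000"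
    and y: "norm y = 1" and j: "j < M" and min: "\<And>i. i < M \<Longrightarrow> ang y j \<le> ang y i"
    and x: "real m * ang y j \<ge> 2 / 5"
  shows "\<bar>q z y\<bar> < 1"
proof -
  define x where "x = real m * ang y j"
  have m0: "real m > 0" using m_real by linarith
  have ax: "ang y j = x / real m" using m0 by (simp add: x_def)
  have q: "\<bar>q z y\<bar> \<le> \<bar>h z j y\<bar> + \<bar>rest z j y\<bar>" unfolding q_split[OF j] by (rule abs_triangle_ineq)
  \<comment> \<open>The first option for \<open>xi\<close> is the full separation reduced by the
    distance x, the second the half separation valid around a nearest node.\<close>
  have R: "\<bar>rest z j y\<bar> \<le> 101 / 100 * (125 * (1 / xi) ^ 8 + 296 / 100000) + 91 / 1000 * (125 * (1 / xi) ^ 7 + 149 / 10000)"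
    if "xi > 0" "xi \<le> 376 / 100 - x \<or> xi \<le> 207 / 100" for xi
  proof (rule rest_bounds(1)[OF y j that(1) _ AB])
    fix i assume "i < M" "i \<noteq> j"
    then show "xi \<le> real m * sqrt (1 - (y \<bullet> p i)\<^sup>2)"
      using sine_ge[OF y _ j, of i] min[of i] that(2) by (auto simp: x_def)
  qed
  have H: "\<bar>h z j y\<bar> \<le> (101 / 100 + 91 / 1000 * x1) * (1 - 148 / 1000 * x0\<^sup>2) ^ 8"
    if "0 < x0" "x0 \<le> x" "x \<le> x1" "x1 \<le> 6 / 5" for x0 x1
  proof -
    have "\<bar>h z j y\<bar> \<le> (101 / 100 + 91 / 1000 * x) * ker m (cos (x / real m)) ^ 8"
      using abs_h_le[where z = z, OF y j AB(1)[OF j] AB(2)[OF j]] unfolding x_def[symmetric] unfolding ax .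
    also have "\<dots> \<le> (101 / 100 + 91 / 1000 * x1) * (1 - 148 / 1000 * x0\<^sup>2) ^ 8"
    proof (intro mult_mono power_mono)
      have "x0\<^sup>2 \<le> x\<^sup>2" using that by (intro power_mono) auto
      then show "ker m (cos (x / real m)) \<le> 1 - 148 / 1000 * x0\<^sup>2"
        using ker_near_bounds(2)[OF m5, of x] that by linarith
      show "0 \<le> ker m (cos (x / real m))" using ker_near_bounds(1)[OF m5, of x] that by linarith
    qed (use that in auto)
    finally show ?thesis .
  qed
  consider "x \<le> 4 / 5" | "4 / 5 \<le> x" "x \<le> 6 / 5" | "6 / 5 \<le> x" by linarith
  then show ?thesis
  proof cases
    case 1
    have "\<bar>h z j y\<bar> \<le> (101 / 100 + 91 / 1000 * (4 / 5)) * (1 - 148 / 1000 * (2 / 5)\<^sup>2) ^ 8"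
      by (rule H) (use 1 x in \<open>auto simp: x_def\<close>)
    also have "\<dots> \<le> 90 / 100" by (simp add: power_divide)
    finally have 2: "\<bar>h z j y\<bar> \<le> 90 / 100" .
    have "\<bar>rest z j y\<bar> \<le> 101 / 100 * (125 * (1 / (296 / 100)) ^ 8 + 296 / 100000) + 91 / 1000 * (125 * (1 / (296 / 100)) ^ 7 + 149 / 10000)"
      by (rule R) (use 1 in auto)
    also have "\<dots> \<le> 4 / 100" by (simp add: power_divide)
    finally show ?thesis using q 2 by linarith
  next
    case 2
    have "\<bar>h z j y\<bar> \<le> (101 / 100 + 91 / 1000 * (6 / 5)) * (1 - 148 / 1000 * (4 / 5)\<^sup>2) ^ 8"
      by (rule H) (use 2 in auto)
    also have "\<dots> \<le> 60 / 100" by (simp add: power_divide)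
    finally have 3: "\<bar>h z j y\<bar> \<le> 60 / 100" .
    have "\<bar>rest z j y\<bar> \<le> 101 / 100 * (125 * (1 / (256 / 100)) ^ 8 + 296 / 100000) + 91 / 1000 * (125 * (1 / (256 / 100)) ^ 7 + 149 / 10000)"
      by (rule R) (use 2 in auto)
    also have "\<dots> \<le> 10 / 100" by (simp add: power_divide)
    finally show ?thesis using q 3 by linarith
  next
    case 3
    \<comment> \<open>Beyond 6/5 the Taylor bounds of the kernel end. The main bump is estimated by
      its decay instead, from the scaled sine 1188/1000 at x = 6/5 and m \<ge> 5.\<close>
    have a: "6 / 5 / real m \<le> ang y j" using 3 m0 by (simp add: x_def pos_divide_le_eq ac_simps)
    have "1188 / 1000 \<le> real m * (6 / 5 / real m - (6 / 5 / real m) ^ 3 / 6)"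
    proof -
      have "real m * (6 / 5 / real m - (6 / 5 / real m) ^ 3 / 6) = 6 / 5 - 36 / 125 / (real m)\<^sup>2"
        using m0 by (simp add: field_simps power2_eq_square power3_eq_cube)
      moreover have "36 / 125 / (real m)\<^sup>2 \<le> 36 / 125 / 5\<^sup>2"
        using power_mono[OF m_real, of 2] m0 by (intro divide_left_mono) auto
      ultimately show ?thesis by (simp add: power2_eq_square)
    qed
    also have "\<dots> \<le> real m * sin (6 / 5 / real m)"
      using m0 by (intro mult_left_mono sin_taylor_bounds) auto
    also have "\<dots> \<le> real m * sin (ang y j)"
    proof (intro mult_left_mono sin_monotone_2pi_le)
      have "0 < 6 / 5 / real m" using m0 by simp
      then show "- (pi / 2) \<le> 6 / 5 / real m" using pi_gt3 by linarith
    qed (use a ang(2)[OF y j] in auto)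
    finally have s: "1188 / 1000 \<le> real m * sqrt (1 - (p j \<bullet> y)\<^sup>2)" using ang(4)[OF y j] by (simp add: inner_commute)
    then have "0 < real m * sqrt (1 - (p j \<bullet> y)\<^sup>2)" by linarith
    then have t: "\<bar>p j \<bullet> y\<bar> < 1" by (simp add: zero_less_mult_iff abs_square_less_1)
    have Z: "0 \<le> Z y j" "Z y j \<le> 1 / (1188 / 1000)"
      unfolding Z_def using s \<open>0 < real m * sqrt (1 - (p j \<bullet> y)\<^sup>2)\<close> by (auto simp: divide_simps mult.commute)
    have b: "(real m *\<^sub>R proj (p j) (snd (z j))) \<bullet> p j = 0" "norm (real m *\<^sub>R proj (p j) (snd (z j))) \<le> real m * (91 / 1000)"
      using proj_inner[OF unit[OF j], of "snd (z j)"]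
        mult_left_mono[OF order_trans[OF norm_proj_le[OF unit[OF j]] AB(2)[OF j]], of "real m"] by simp_all
    have "\<bar>h z j y\<bar> \<le> 101 / 100 * Z y j ^ 8 + 91 / 1000 * Z y j ^ 7"
      unfolding h_def Z_def by (rule bump_bounds(1)[OF m5 unit[OF j] y b AB(1)[OF j] t])
    also have "\<dots> \<le> 101 / 100 * (1 / (1188 / 1000)) ^ 8 + 91 / 1000 * (1 / (1188 / 1000)) ^ 7"
      using Z by (intro add_mono mult_left_mono power_mono) auto
    also have "\<dots> \<le> 30 / 100" by (simp add: power_divide)
    finally have 4: "\<bar>h z j y\<bar> \<le> 30 / 100" .
    have "\<bar>rest z j y\<bar> \<le> 101 / 100 * (125 * (1 / (207 / 100)) ^ 8 + 296 / 100000) + 91 / 1000 * (125 * (1 / (207 / 100)) ^ 7 + 149 / 10000)"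
      by (rule R) auto
    also have "\<dots> \<le> 50 / 100" by (simp add: power_divide)
    finally show ?thesis using q 4 by linarith
  qed
qed


text \<open>On the great circle from \<open>p j\<close> to y, the interference is expanded to second
  order. By the interpolation conditions it combines with the main bump to value \<open>u j\<close>
  and slope 0 at the node. In units of x^2, with x the scaled angle, the main bump then falls by at
  least 0.98, against at most 0.855 from the second derivative of the interference and 0.05 from the
  tangential term.\<close>

lemma q_near:
  assumes u: "\<bar>u j\<bar> = 1" and j: "j < M"
    and z1: "fst (z j) = u j - rest z j (p j)"
    and z2: "\<And>v. v \<bullet> p j = 0 \<Longrightarrow> real m * (proj (p j) (snd (z j)) \<bullet> v) = - rest1 z j (p j) v"
    and AB: "\<And>i. i < M \<Longrightarrow> \<bar>fst (z i)\<bar> \<le> 101 / 100" "\<And>i. i < M \<Longrightarrow> norm (snd (z i)) \<le> 91 / 1000"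
    and z3: "\<bar>u j - fst (z j)\<bar> \<le> 1 / 100"
    and y: "norm y = 1" and yp: "y \<bullet> p j \<ge> 0"
    and x: "0 < real m * ang y j" "real m * ang y j \<le> 2 / 5"
  shows "\<bar>q z y\<bar> < 1"
proof -
  define \<tau> where "\<tau> = ang y j"
  define x where "x = real m * \<tau>"
  have m0: "real m > 0" using m_real by linarith
  have tx: "\<tau> = x / real m" using m0 by (simp add: x_def)
  have x0: "0 < x" "x \<le> 2 / 5" using x by (auto simp: x_def \<tau>_def)
  have tau: "0 < \<tau>" "\<tau> \<le> x / 5" "\<tau> \<le> pi / 2"
    using x0 m_real ang(2)[OF y j] divide_left_mono[of 5 "real m" x] by (auto simp: tx \<tau>_def[symmetric])
  have x2: "x\<^sup>2 \<le> 4 / 25" using power_mono[OF x0(2), of 2] x0 by (simp add: power_divide)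
  have tau2: "\<tau>\<^sup>2 \<le> x\<^sup>2 / 25" using power_mono[OF tau(2), of 2] tau by (simp add: power_divide)
  have c: "cos \<tau> = y \<bullet> p j" using ang(3)[OF y j] yp by (simp add: \<tau>_def)
  have s0: "sin \<tau> > 0" using tau pi_gt3 by (intro sin_gt_zero) auto
  have pp: "p j \<bullet> p j = 1" "y \<bullet> y = 1" using unit[OF j] y by (simp_all add: dot_square_norm)
  \<comment> \<open>The unit tangent vector at \<open>p j\<close> pointing towards y;
    \<open>Y\<close> is the resulting great circle and \<open>V\<close> its velocity.\<close>
  define v where "v = (1 / sin \<tau>) *\<^sub>R (y - cos \<tau> *\<^sub>R p j)"
  have yv: "y = cos \<tau> *\<^sub>R p j + sin \<tau> *\<^sub>R v" using s0 by (simp add: v_def)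
  have vp: "v \<bullet> p j = 0" by (simp add: v_def inner_diff_left c pp)
  have vv: "v \<bullet> v = 1"
  proof -
    have "(y - cos \<tau> *\<^sub>R p j) \<bullet> (y - cos \<tau> *\<^sub>R p j) = 1 - (cos \<tau>)\<^sup>2"
      by (simp add: inner_diff_left inner_diff_right pp inner_commute[of "p j" y] c[symmetric] power2_eq_square)
    also have "\<dots> = (sin \<tau>)\<^sup>2" by (simp add: sin_squared_eq)
    finally show ?thesis using s0 by (simp add: v_def power2_eq_square)
  qed
  define Y V where "Y s = cos s *\<^sub>R p j + sin s *\<^sub>R v" and "V s = cos s *\<^sub>R v - sin s *\<^sub>R p j" for s
  have nY: "norm (Y s) = 1" "norm (V s) = 1" "Y s \<bullet> V s = 0" for s
    using sin_cos_squared_add3[of s] vp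
    by (simp_all add: Y_def V_def norm_eq_sqrt_inner inner_add_left inner_add_right inner_diff_left inner_diff_right pp vv inner_commute[of "p j" v] add.commute)
  \<comment> \<open>336/100 = 376/100 - 2/5: the separation bound after moving a scaled distance of
    at most 2/5.\<close>
  have X: "336 / 100 \<le> real m * sqrt (1 - (Y s \<bullet> p i)\<^sup>2)" if "0 \<le> s" "s \<le> \<tau>" "i < M" "i \<noteq> j" for s i
  proof -
    have "cos s \<ge> 0" using that tau by (intro cos_ge_zero) auto
    then have "ang (Y s) j = s"
      using that tau by (simp add: ang_def Y_def inner_add_left pp vp arccos_cos)
    moreover have "real m * s \<le> 2 / 5" using mult_left_mono[OF that(2), of "real m"] x0 by (simp add: x_def)
    ultimately show ?thesis using sine_ge(1)[OF nY(1) that(3) j that(4), of s] by simp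
  qed
  let ?W8 = "125 * (1 / (336 / 100)) ^ 8 + 296 / 100000 :: real" and ?W7 = "125 * (1 / (336 / 100)) ^ 7 + 149 / 10000 :: real"
  have R2: "\<bar>rest2 z j (Y s) (V s)\<bar> \<le> (real m)\<^sup>2 * (171 / 100)" if "0 \<le> s" "s \<le> \<tau>" for s
  proof -
    have "\<bar>rest2 z j (Y s) (V s)\<bar> \<le> (real m)\<^sup>2 * (115 * (101 / 100 * ?W8 + 91 / 1000 * ?W7) + 43 * (91 / 1000) * ?W8)"
      by (rule rest_bounds(3)[OF nY(1) j]) (use X that AB nY in auto)
    also have "\<dots> \<le> (real m)\<^sup>2 * (171 / 100)" by (intro mult_left_mono) (simp_all add: power_divide)
    finally show ?thesis .
  qed
  have R0: "\<bar>rest z j y\<bar> \<le> 2 / 100"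
  proof -
    have "\<bar>rest z j y\<bar> \<le> 101 / 100 * ?W8 + 91 / 1000 * ?W7"
      by (rule rest_bounds(1)[OF y j]) (use X[of \<tau>] tau AB yv Y_def in auto)
    also have "\<dots> \<le> 2 / 100" by (simp add: power_divide)
    finally show ?thesis .
  qed
  have lt1: "\<bar>p i \<bullet> Y s\<bar> < 1" if "0 \<le> s" "s \<le> \<tau>" "i < M" "i \<noteq> j" for s i
    using sum_Z_le(4)[OF nY(1) j, of "336 / 100" s i] X that by auto
  have D1: "((\<lambda>s. rest z j (Y s)) has_real_derivative rest1 z j (Y s) (V s)) (at s)" if "0 \<le> s" "s \<le> \<tau>" for s
    unfolding rest_def rest1_def
  proof (rule DERIV_sum)
    fix i assume "i \<in> {..<M} - {j}"
    then show "((\<lambda>s. h z i (Y s)) has_real_derivative h1 z i (Y s) (V s)) (at s)"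
      using lt1[OF that, of i] m0 unfolding h_def h1_def Y_def V_def by (intro DERIV_bump(1)) auto
  qed
  have D2: "((\<lambda>s. rest1 z j (Y s) (V s)) has_real_derivative rest2 z j (Y s) (V s)) (at s)" if "0 \<le> s" "s \<le> \<tau>" for s
    unfolding rest1_def rest2_def
  proof (rule DERIV_sum)
    fix i assume "i \<in> {..<M} - {j}"
    then show "((\<lambda>s. h1 z i (Y s) (V s)) has_real_derivative h2 z i (Y s) (V s)) (at s)"
      using lt1[OF that, of i] m0 unfolding h1_def h2_def Y_def V_def by (intro DERIV_bump(2)) auto
  qed
  \<comment> \<open>The interference and its two derivatives along the circle, packed as the
    derivative sequence for a Maclaurin expansion with remainder of order two.\<close>
  define df where "df n = (if n = (0::nat) then (\<lambda>s. rest z j (Y s)) else if n = 1 then (\<lambda>s. rest1 z j (Y s) (V s)) else (\<lambda>s. rest2 z j (Y s) (V s)))" for n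
  have "\<exists>t>0. t < \<tau> \<and> rest z j (Y \<tau>) = (\<Sum>n<2. df n 0 / fact n * \<tau> ^ n) + df 2 t / fact 2 * \<tau> ^ 2"
  proof (rule Maclaurin)
    show "\<forall>n t. n < 2 \<and> 0 \<le> t \<and> t \<le> \<tau> \<longrightarrow> (df n has_real_derivative df (Suc n) t) (at t)"
      using D1 D2 by (auto simp: df_def less_2_cases_iff)
  qed (use tau in \<open>auto simp: df_def\<close>)
  then obtain t where t: "0 < t" "t < \<tau>" "rest z j (Y \<tau>) = (\<Sum>n<2. df n 0 / fact n * \<tau> ^ n) + df 2 t / fact 2 * \<tau> ^ 2" by blast
  define g where "g = real m * (proj (p j) (snd (z j)) \<bullet> v)"
  define e where "e = rest2 z j (Y t) (V t) / 2 * \<tau>\<^sup>2"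
  have Y0: "Y 0 = p j" "V 0 = v" "Y \<tau> = y" using yv by (simp_all add: Y_def V_def)
  \<comment> \<open>The interpolation conditions identify the first two Taylor coefficients as
    \<open>u j - fst (z j)\<close> and \<open>- g\<close>.\<close>
  have rest: "rest z j y = (u j - fst (z j)) - g * \<tau> + e"
    using t(3) z1 z2[OF vp] by (simp add: df_def Y0 e_def g_def lessThan_nat_numeral lessThan_Suc fact_numeral)
  have eb: "\<bar>e\<bar> \<le> 171 / 200 * x\<^sup>2"
  proof -
    have "\<bar>e\<bar> = \<bar>rest2 z j (Y t) (V t)\<bar> * (\<tau>\<^sup>2 / 2)" by (simp add: e_def abs_mult)
    also have "\<dots> \<le> (real m)\<^sup>2 * (171 / 100) * (\<tau>\<^sup>2 / 2)" using R2[of t] t by (intro mult_right_mono) auto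
    finally show ?thesis by (simp add: x_def power_mult_distrib)
  qed
  have gb: "\<bar>g\<bar> \<le> real m * (91 / 1000)"
  proof -
    have "norm v = 1" using vv by (simp add: norm_eq_sqrt_inner)
    then have "\<bar>proj (p j) (snd (z j)) \<bullet> v\<bar> \<le> norm (proj (p j) (snd (z j)))"
      using Cauchy_Schwarz_ineq2[of "proj (p j) (snd (z j))" v] by simp
    also have "\<dots> \<le> 91 / 1000" using norm_proj_le[OF unit[OF j]] AB(2)[OF j] by (rule order_trans)
    finally show ?thesis unfolding g_def abs_mult by (intro mult_mono) auto
  qed
  define J where "J = ker m (cos \<tau>) ^ 8"
  have hy: "h z j y = (fst (z j) + g * (sin \<tau> * cos \<tau>)) * J"
  proof -
    have "proj (p j) (snd (z j)) \<bullet> y = sin \<tau> * (proj (p j) (snd (z j)) \<bullet> v)"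
      by (subst yv) (simp add: inner_add_right proj_inner[OF unit[OF j]])
    then show ?thesis by (simp add: h_def bump_def J_def g_def c inner_commute[of "p j" y] algebra_simps)
  qed
  note kn = ker_near_bounds[OF m5, of x, folded tx]
  have k: "0 \<le> ker m (cos \<tau>)" "ker m (cos \<tau>) \<le> 1 - 148 / 1000 * x\<^sup>2" "1 - x\<^sup>2 / 6 \<le> ker m (cos \<tau>)"
    using kn x0 by auto
  have J0: "0 \<le> J" by (simp add: J_def)
  \<comment> \<open>Bernoulli gives (1 - w)^8 \<le> 1/(1 + 8w) with 8w = 1.184 x^2. The coefficient
    0.994 is what survives linearisation for x^2 \<le> 4/25.\<close>
  have J1: "J \<le> 1 - 994 / 1000 * x\<^sup>2"
  proof -
    define w where "w = 148 / 1000 * x\<^sup>2"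
    have w: "0 \<le> w" "w \<le> 1" using x2 by (auto simp: w_def)
    have "J \<le> (1 - w) ^ 8" unfolding J_def w_def using k by (intro power_mono) auto
    moreover have "(1 - w) ^ 8 * (1 + 8 * w) \<le> (1 - w) ^ 8 * (1 + w) ^ 8"
      using w Bernoulli_inequality[of w 8] by (intro mult_left_mono) auto
    moreover have "(1 - w) ^ 8 * (1 + w) ^ 8 = (1 - w\<^sup>2) ^ 8"
      by (simp add: power_mult_distrib[symmetric] power2_eq_square algebra_simps)
    moreover have "(1 - w\<^sup>2) ^ 8 \<le> 1" using w by (intro power_le_one) (auto simp: abs_square_le_1)
    ultimately have "(1 - w) ^ 8 * (1 + 8 * w) \<le> 1" by linarith
    then have "(1 - w) ^ 8 \<le> 1 / (1 + 8 * w)" using w by (simp add: pos_le_divide_eq)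
    also have "\<dots> \<le> 1 - 994 / 1000 * x\<^sup>2"
    proof -
      have "1 \<le> (1 - 994 / 1000 * x\<^sup>2) * (1 + 1184 / 1000 * x\<^sup>2)"
      proof -
        have "0 \<le> x\<^sup>2 * (190 / 1000 - 994 / 1000 * (1184 / 1000) * x\<^sup>2)" using x2 by (intro mult_nonneg_nonneg) auto
        then show ?thesis by (simp add: algebra_simps power2_eq_square)
      qed
      moreover have "0 < 1 + 8 * w" using w by simp
      ultimately show ?thesis by (subst pos_divide_le_eq) (simp_all add: w_def)
    qed
    finally show ?thesis using \<open>J \<le> (1 - w) ^ 8\<close> by linarith
  qed
  have J2: "J \<ge> 1 - 4 / 3 * x\<^sup>2"
  proof -
    have "1 + real 8 * (- (x\<^sup>2 / 6)) \<le> (1 + (- (x\<^sup>2 / 6))) ^ 8" using x2 by (intro Bernoulli_inequality) auto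
    also have "\<dots> \<le> J" unfolding J_def using k x2 by (intro power_mono) auto
    finally show ?thesis by simp
  qed
  have x2p: "x\<^sup>2 > 0" using x0 by simp
  have Jle1: "J \<le> 1" using J1 x2p by linarith
  have sc: "sin \<tau> * cos \<tau> = sin (2 * \<tau>) / 2" by (simp add: sin_double)
  have sc_le: "sin \<tau> * cos \<tau> \<le> \<tau>" unfolding sc using sin_x_le_x[of "2 * \<tau>"] tau by simp
  have sc_ge: "\<tau> * (1 - 2 / 75 * x\<^sup>2) \<le> sin \<tau> * cos \<tau>"
  proof -
    have "\<tau> * (1 - 2 / 75 * x\<^sup>2) \<le> \<tau> * (1 - 2 / 3 * \<tau>\<^sup>2)" using tau tau2 by (intro mult_left_mono) auto
    also have "\<dots> = (2 * \<tau> - (2 * \<tau>) ^ 3 / 6) / 2" by (simp add: power2_eq_square power3_eq_cube field_simps)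
    also have "\<dots> \<le> sin (2 * \<tau>) / 2" using sin_taylor_bounds(1)[of "2 * \<tau>"] tau by simp
    finally show ?thesis by (simp add: sc)
  qed
  have sc0: "0 \<le> sin \<tau> * cos \<tau>" using order_trans[OF _ sc_ge] tau x2 by simp
  have scJ_le: "sin \<tau> * cos \<tau> * J \<le> \<tau>"
    using mult_mono[OF sc_le Jle1] tau J0 by simp
  have scJ_ge: "\<tau> * (1 - 136 / 100 * x\<^sup>2) \<le> sin \<tau> * cos \<tau> * J"
  proof -
    have "1 - 136 / 100 * x\<^sup>2 \<le> (1 - 2 / 75 * x\<^sup>2) * (1 - 4 / 3 * x\<^sup>2)"
      by (simp add: algebra_simps)
    then have "\<tau> * (1 - 136 / 100 * x\<^sup>2) \<le> \<tau> * ((1 - 2 / 75 * x\<^sup>2) * (1 - 4 / 3 * x\<^sup>2))"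
      using tau by (intro mult_left_mono) auto
    also have "\<dots> = \<tau> * (1 - 2 / 75 * x\<^sup>2) * (1 - 4 / 3 * x\<^sup>2)" by simp
    also have "\<dots> \<le> sin \<tau> * cos \<tau> * J"
      by (rule mult_mono[OF sc_ge J2 sc0]) (use x2 in simp)
    finally show ?thesis .
  qed
  \<comment> \<open>The slope of the main bump matches the linear term of the interference up to
    order x^3; with x \<le> 2/5 one factor x goes into the constant.\<close>
  have gd: "\<bar>g * (\<tau> - sin \<tau> * cos \<tau> * J)\<bar> \<le> 5 / 100 * x\<^sup>2"
  proof -
    have "\<bar>g * (\<tau> - sin \<tau> * cos \<tau> * J)\<bar> \<le> (real m * (91 / 1000)) * (\<tau> * (136 / 100 * x\<^sup>2))"
      unfolding abs_mult using gb scJ_le scJ_ge by (intro mult_mono) (auto simp: algebra_simps)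
    also have "\<dots> = 91 / 1000 * (136 / 100) * (x * x\<^sup>2)" by (simp add: x_def)
    also have "\<dots> \<le> 91 / 1000 * (136 / 100) * (2 / 5 * x\<^sup>2)" using x0 by (intro mult_left_mono mult_right_mono) auto
    also have "\<dots> \<le> 5 / 100 * x\<^sup>2" using x2p by simp
    finally show ?thesis .
  qed
  \<comment> \<open>The key identity: the deviation from \<open>u j\<close> is a loss governed by 1
    - J, a mismatch of linear terms and the Taylor remainder, all of second order or
    smaller.\<close>
  have qy: "q z y = u j - fst (z j) * (1 - J) - g * (\<tau> - sin \<tau> * cos \<tau> * J) + e"
    unfolding q_split[OF j] hy rest by (simp add: algebra_simps)
  have uu: "u j = 1 \<or> u j = -1" using u by linarith
  define a where "a = u j * fst (z j)"
  have a: "a \<ge> 99 / 100" using uu abs_le_D1[OF z3] abs_le_D2[OF z3] by (auto simp: a_def)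
  have uq: "u j * q z y = 1 - a * (1 - J) - u j * (g * (\<tau> - sin \<tau> * cos \<tau> * J)) + u j * e"
    unfolding qy a_def using uu by (auto simp: algebra_simps)
  have "u j * q z y < 1"
  proof -
    have arith: "1 - P - Q + R < 1"
      if "99 / 100 * (994 / 1000 * X) \<le> P" "- Q \<le> 5 / 100 * X" "R \<le> 171 / 200 * X" "0 < X" for P Q R X :: real
      using that by (simp add: field_simps)
    have 1: "99 / 100 * (994 / 1000 * x\<^sup>2) \<le> a * (1 - J)" using a J1 x2p by (intro mult_mono) auto
    have 2: "\<bar>u j * (g * (\<tau> - sin \<tau> * cos \<tau> * J))\<bar> \<le> 5 / 100 * x\<^sup>2"
      unfolding abs_mult[of "u j"] u mult_1 by (rule gd)
    have 3: "\<bar>u j * e\<bar> \<le> 171 / 200 * x\<^sup>2"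
      unfolding abs_mult[of "u j"] u mult_1 by (rule eb)
    show ?thesis unfolding uq by (rule arith[OF 1 abs_le_D2[OF 2] abs_le_D1[OF 3] x2p])
  qed
  \<comment> \<open>A crude estimate is enough on this side: the main part \<open>a * J\<close> is
    nonnegative and the other terms are far below 1.\<close>
  moreover have "u j * q z y > -1"
  proof -
    have "\<bar>g * (sin \<tau> * cos \<tau> * J)\<bar> \<le> (real m * (91 / 1000)) * \<tau>"
      unfolding abs_mult[of g] using gb scJ_le sc0 J0 by (intro mult_mono) auto
    also have "\<dots> = 91 / 1000 * x" by (simp add: x_def)
    finally have "\<bar>u j * (g * (sin \<tau> * cos \<tau> * J))\<bar> \<le> 91 / 1000 * x" using u by (simp add: abs_mult)
    moreover have "\<bar>u j * rest z j y\<bar> \<le> 2 / 100" using R0 u by (simp add: abs_mult)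
    moreover have "u j * q z y = a * J + u j * (g * (sin \<tau> * cos \<tau> * J)) + u j * rest z j y"
      unfolding q_split[OF j] hy a_def by (simp add: algebra_simps)
    moreover have "a * J \<ge> 0" using a J0 by simp
    ultimately show ?thesis using x0 by linarith
  qed
  ultimately show ?thesis using uu by auto
qed

text \<open>Each y is compared with a nearest node. Evenness permits replacing y by -y, so that this
  node lies in its hemisphere. A zero angle would be equality in Cauchy-Schwarz and put y on the
  line of the node.\<close>

theorem dual_certificate:
  assumes u: "\<And>i. i < M \<Longrightarrow> \<bar>u i\<bar> = 1"
  obtains z where "\<And>i. i < M \<Longrightarrow> q z (p i) = u i"
    "\<And>y. norm y = 1 \<Longrightarrow> (\<And>i. i < M \<Longrightarrow> y \<noteq> p i \<and> y \<noteq> - p i) \<Longrightarrow> \<bar>q z y\<bar> < 1"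
proof -
  obtain z where z: "\<And>j. j < M \<Longrightarrow> fst (z j) = u j - rest z j (p j)"
    "\<And>j v. j < M \<Longrightarrow> v \<bullet> p j = 0 \<Longrightarrow> real m * (proj (p j) (snd (z j)) \<bullet> v) = - rest1 z j (p j) v"
    "\<And>i. i < M \<Longrightarrow> \<bar>fst (z i)\<bar> \<le> 101 / 100" "\<And>i. i < M \<Longrightarrow> norm (snd (z i)) \<le> 91 / 1000"
    "\<And>i. i < M \<Longrightarrow> \<bar>u i - fst (z i)\<bar> \<le> 1 / 100"
    using interpolation_coefficients[of u] u by metis
  show ?thesis
  proof (rule that)
    show "q z (p i) = u i" if "i < M" for i
      using q_split[OF that] h_center[OF that] z(1)[OF that] by simp
    fix y :: "real^4" assume y: "norm y = 1" and ne: "\<And>i. i < M \<Longrightarrow> y \<noteq> p i \<and> y \<noteq> - p i"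
    show "\<bar>q z y\<bar> < 1"
    proof (cases "M = 0")
      case False
      then obtain j where j: "j < M" "\<And>i. i < M \<Longrightarrow> ang y j \<le> ang y i"
        using arg_min_if_finite(1)[of "{..<M}" "ang y"] arg_min_least[of "{..<M}" _ "ang y"] by fastforce
      show ?thesis
      proof (cases "real m * ang y j \<ge> 2 / 5")
        case True
        show ?thesis by (rule q_far[of z y j]) (use z(3,4) y j True in auto)
      next
        case nr: False
        have pos: "ang y j > 0"
        proof (rule ccontr)
          assume "\<not> ang y j > 0"
          then have "ang y j = 0" using ang(1)[OF y j(1)] by simp
          then have "\<bar>y \<bullet> p j\<bar> = norm y * norm (p j)" using ang(3)[OF y j(1)] y unit[OF j(1)] by simp
          then have "p j = y \<or> p j = - y"
            unfolding norm_cauchy_schwarz_abs_eq using y unit[OF j(1)] by simp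
          then show False using ne[OF j(1)] by auto
        qed
        then have x: "0 < real m * ang y j" "real m * ang y j \<le> 2 / 5" using nr m_real by auto
        show ?thesis
        proof (cases "y \<bullet> p j \<ge> 0")
          case True
          show ?thesis
            by (rule q_near[of u j z]) (use u z j y True x in auto)
        next
          case False
          have "\<bar>q z (- y)\<bar> < 1"
            by (rule q_near[of u j z]) (use u z j y False x in \<open>auto simp: ang_def\<close>)
          then show ?thesis by (simp add: q_uminus)
        qed
      qed
    next
      case True
      then have "q z y = 0" unfolding q_def by simp
      then show ?thesis by simp
    qed
  qed
qed

end

section \<open>Rotations and quaternions\<close>

definition quat :: "real \<Rightarrow> real \<Rightarrow> real \<Rightarrow> real \<Rightarrow> real^4" where
  "quat a b c d = (\<chi> i. if i = 1 then a else if i = 2 then b else if i = 3 then c else d)"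

lemma quat_nth [simp]: "quat a b c d $ 1 = a" "quat a b c d $ 2 = b" "quat a b c d $ 3 = c" "quat a b c d $ 4 = d"
  by (simp_all add: quat_def)

text \<open>The matrix of conjugation by the unit quaternion with real part \<open>y$1\<close> and
  imaginary parts \<open>y$2\<close>, \<open>y$3\<close>, \<open>y$4\<close>.\<close>

definition quat_rot :: "real^4 \<Rightarrow> real^3^3" where
  "quat_rot y = vector
    [vector [(y$1)\<^sup>2 + (y$2)\<^sup>2 - (y$3)\<^sup>2 - (y$4)\<^sup>2, 2 * (y$2 * y$3 - y$1 * y$4), 2 * (y$2 * y$4 + y$1 * y$3)],
     vector [2 * (y$2 * y$3 + y$1 * y$4), (y$1)\<^sup>2 - (y$2)\<^sup>2 + (y$3)\<^sup>2 - (y$4)\<^sup>2, 2 * (y$3 * y$4 - y$1 * y$2)],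
     vector [2 * (y$2 * y$4 - y$1 * y$3), 2 * (y$3 * y$4 + y$1 * y$2), (y$1)\<^sup>2 - (y$2)\<^sup>2 - (y$3)\<^sup>2 + (y$4)\<^sup>2]]"

lemma norm_quat: "norm y = 1 \<longleftrightarrow> (y$1)\<^sup>2 + (y$2)\<^sup>2 + (y$3)\<^sup>2 + (y$4)\<^sup>2 = 1" for y :: "real^4"
  by (simp add: norm_eq_sqrt_inner inner_vec_def sum_4 power2_eq_square)

text \<open>The quaternion product of the half-angle quaternions of \<open>RZ \<alpha>\<close>,
  \<open>RX \<beta>\<close> and \<open>RZ \<gamma>\<close>.\<close>

definition euler_quat :: "real \<Rightarrow> real \<Rightarrow> real \<Rightarrow> real^4" where
  "euler_quat \<alpha> \<beta> \<gamma> = quat (cos (\<beta>/2) * cos ((\<alpha> + \<gamma>)/2)) (sin (\<beta>/2) * cos ((\<alpha> - \<gamma>)/2))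
     (sin (\<beta>/2) * sin ((\<alpha> - \<gamma>)/2)) (cos (\<beta>/2) * sin ((\<alpha> + \<gamma>)/2))"

lemma norm_euler_quat: "norm (euler_quat \<alpha> \<beta> \<gamma>) = 1"
proof -
  define s d h where "s = (\<alpha> + \<gamma>)/2" and "d = (\<alpha> - \<gamma>)/2" and "h = \<beta>/2"
  have "(cos s)\<^sup>2 + (sin s)\<^sup>2 = 1" "(cos d)\<^sup>2 + (sin d)\<^sup>2 = 1" "(cos h)\<^sup>2 + (sin h)\<^sup>2 = 1" by simp_all
  then have "(cos h * cos s)\<^sup>2 + (sin h * cos d)\<^sup>2 + (sin h * sin d)\<^sup>2 + (cos h * sin s)\<^sup>2 = 1" by algebra
  then show ?thesis by (simp add: norm_quat euler_quat_def s_def d_def h_def)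
qed

lemma quat_rot_euler: "quat_rot (euler_quat \<alpha> \<beta> \<gamma>) = RZ \<alpha> ** RX \<beta> ** RZ \<gamma>"
proof -
  define cs ss cd sd ch sh where "cs = cos ((\<alpha> + \<gamma>)/2)" and "ss = sin ((\<alpha> + \<gamma>)/2)"
    and "cd = cos ((\<alpha> - \<gamma>)/2)" and "sd = sin ((\<alpha> - \<gamma>)/2)" and "ch = cos (\<beta>/2)" and "sh = sin (\<beta>/2)"
  note defs = cs_def ss_def cd_def sd_def ch_def sh_def
  have a: "\<alpha> = (\<alpha> + \<gamma>)/2 + (\<alpha> - \<gamma>)/2" "\<gamma> = (\<alpha> + \<gamma>)/2 - (\<alpha> - \<gamma>)/2" by (simp_all add: field_simps)
  have ca: "cos \<alpha> = cs * cd - ss * sd" "sin \<alpha> = ss * cd + cs * sd"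
    using cos_add[of "(\<alpha> + \<gamma>)/2" "(\<alpha> - \<gamma>)/2"] sin_add[of "(\<alpha> + \<gamma>)/2" "(\<alpha> - \<gamma>)/2"]
    unfolding a(1)[symmetric] by (simp_all add: defs)
  have cg: "cos \<gamma> = cs * cd + ss * sd" "sin \<gamma> = ss * cd - cs * sd"
    using cos_diff[of "(\<alpha> + \<gamma>)/2" "(\<alpha> - \<gamma>)/2"] sin_diff[of "(\<alpha> + \<gamma>)/2" "(\<alpha> - \<gamma>)/2"]
    unfolding a(2)[symmetric] by (simp_all add: defs)
  have cb: "cos \<beta> = ch\<^sup>2 - sh\<^sup>2" "sin \<beta> = 2 * sh * ch"
    using cos_double[of "\<beta>/2"] sin_double[of "\<beta>/2"] by (simp_all add: defs)
  have h: "cs\<^sup>2 + ss\<^sup>2 = 1" "cd\<^sup>2 + sd\<^sup>2 = 1" "ch\<^sup>2 + sh\<^sup>2 = 1" by (simp_all add: defs)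
  have e: "euler_quat \<alpha> \<beta> \<gamma> = quat (ch * cs) (sh * cd) (sh * sd) (ch * ss)"
    by (simp add: euler_quat_def defs)
  have 11: "(ch * cs)\<^sup>2 + (sh * cd)\<^sup>2 - (sh * sd)\<^sup>2 - (ch * ss)\<^sup>2 = cos \<alpha> * cos \<gamma> - sin \<alpha> * cos \<beta> * sin \<gamma>"
    unfolding ca cg cb using h by algebra
  have 12: "2 * (sh * cd * (sh * sd) - ch * cs * (ch * ss)) = - (cos \<alpha> * sin \<gamma>) - sin \<alpha> * cos \<beta> * cos \<gamma>"
    unfolding ca cg cb using h by algebra
  have 13: "2 * (sh * cd * (ch * ss) + ch * cs * (sh * sd)) = sin \<alpha> * sin \<beta>"
    unfolding ca cg cb by algebra
  have 21: "2 * (sh * cd * (sh * sd) + ch * cs * (ch * ss)) = sin \<alpha> * cos \<gamma> + cos \<alpha> * cos \<beta> * sin \<gamma>"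
    unfolding ca cg cb using h by algebra
  have 22: "(ch * cs)\<^sup>2 - (sh * cd)\<^sup>2 + (sh * sd)\<^sup>2 - (ch * ss)\<^sup>2 = - (sin \<alpha> * sin \<gamma>) + cos \<alpha> * cos \<beta> * cos \<gamma>"
    unfolding ca cg cb using h by algebra
  have 23: "2 * (sh * sd * (ch * ss) - ch * cs * (sh * cd)) = - (cos \<alpha> * sin \<beta>)"
    unfolding ca cg cb by algebra
  have 31: "2 * (sh * cd * (ch * ss) - ch * cs * (sh * sd)) = sin \<beta> * sin \<gamma>"
    unfolding ca cg cb by algebra
  have 32: "2 * (sh * sd * (ch * ss) + ch * cs * (sh * cd)) = sin \<beta> * cos \<gamma>"
    unfolding ca cg cb by algebra
  have 33: "(ch * cs)\<^sup>2 - (sh * cd)\<^sup>2 - (sh * sd)\<^sup>2 + (ch * ss)\<^sup>2 = cos \<beta>"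
    unfolding ca cg cb using h by algebra
  show ?thesis
    unfolding e vec_eq_iff forall_3
    by (simp add: quat_rot_def RZ_def RX_def matrix_matrix_mult_def sum_3 11 22 33)
      (use 12 13 21 23 31 32 in simp)
qed

text \<open>With \<theta> the angle between the lines of p and y, the trace makes the cosine of the
  relative rotation angle 2 cos^2 \<theta> - 1: rotation angles are twice the angles between
  quaternion lines.\<close>

lemma trace_quat_rot:
  assumes "norm y = 1" "norm p = 1"
  shows "trace (transpose (quat_rot p) ** quat_rot y) = 4 * (p \<bullet> y)\<^sup>2 - 1"
proof -
  have y: "(y$1)\<^sup>2 + (y$2)\<^sup>2 + (y$3)\<^sup>2 + (y$4)\<^sup>2 = 1" and p: "(p$1)\<^sup>2 + (p$2)\<^sup>2 + (p$3)\<^sup>2 + (p$4)\<^sup>2 = 1"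
    using assms by (simp_all add: norm_quat)
  have "trace (transpose (quat_rot p) ** quat_rot y) =
    4 * (p$1 * y$1 + p$2 * y$2 + p$3 * y$3 + p$4 * y$4)\<^sup>2 -
    ((y$1)\<^sup>2 + (y$2)\<^sup>2 + (y$3)\<^sup>2 + (y$4)\<^sup>2) * ((p$1)\<^sup>2 + (p$2)\<^sup>2 + (p$3)\<^sup>2 + (p$4)\<^sup>2)"
    unfolding trace_def matrix_matrix_mult_def transpose_def quat_rot_def
    by (simp add: sum_3) algebra
  then show ?thesis unfolding y p by (simp add: inner_vec_def sum_4)
qed

lemma quat_rot_SO3:
  assumes "norm y = 1"
  shows "quat_rot y \<in> SO3"
proof -
  have y: "(y$1)\<^sup>2 + (y$2)\<^sup>2 + (y$3)\<^sup>2 + (y$4)\<^sup>2 = 1" using assms by (simp add: norm_quat)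
  define a b c d where "a = y$1" and "b = y$2" and "c = y$3" and "d = y$4"
  note defs = a_def[symmetric] b_def[symmetric] c_def[symmetric] d_def[symmetric]
  have y': "a\<^sup>2 + b\<^sup>2 + c\<^sup>2 + d\<^sup>2 = 1" using y by (simp add: defs)
  have "transpose (quat_rot y) ** quat_rot y = mat 1"
    unfolding vec_eq_iff forall_3 matrix_matrix_mult_def transpose_def quat_rot_def mat_def
    apply (simp add: sum_3 defs)
    apply (intro conjI)
    apply (algebra | use y' in algebra)+
    done
  moreover have "det (quat_rot y) = 1"
    unfolding det_3 quat_rot_def apply (simp add: defs) using y' by algebra
  ultimately show ?thesis by (simp add: SO3_def)
qed

lemma quat_rot_eq_iff:
  assumes "norm y = 1" "norm p = 1"
  shows "quat_rot p = quat_rot y \<longleftrightarrow> y = p \<or> y = - p"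
proof
  assume "quat_rot p = quat_rot y"
  then have "4 * (p \<bullet> y)\<^sup>2 - 1 = 4 * (y \<bullet> y)\<^sup>2 - 1"
    using trace_quat_rot[OF assms] trace_quat_rot[OF assms(1,1)] by simp
  then have "(p \<bullet> y)\<^sup>2 = 1" using assms by (simp add: dot_square_norm)
  then have "\<bar>p \<bullet> y\<bar> = norm p * norm y" using assms by (simp add: abs_square_eq_1)
  then show "y = p \<or> y = - p" unfolding norm_cauchy_schwarz_abs_eq using assms by auto
next
  assume "y = p \<or> y = - p"
  then show "quat_rot p = quat_rot y" by (auto simp: quat_rot_def)
qed

text \<open>The third column of X determines \<alpha> and \<beta>:
  \<open>RZ \<alpha> ** RX \<beta>\<close> is given the same third column. What is left after
  dividing it off fixes the third axis, hence is a rotation \<open>RZ \<gamma>\<close>.\<close>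

lemma SO3_euler:
  assumes X: "X \<in> SO3"
  shows "\<exists>\<alpha> \<beta> \<gamma>. X = RZ \<alpha> ** RX \<beta> ** RZ \<gamma> \<and> 0 \<le> \<beta> \<and> \<beta> \<le> pi"
proof -
  define u1 u2 u3 where "u1 = X$1$3" and "u2 = X$2$3" and "u3 = X$3$3"
  have X1: "transpose X ** X = mat 1" "det X = 1" using X by (auto simp: SO3_def)
  have u: "u1\<^sup>2 + u2\<^sup>2 + u3\<^sup>2 = 1"
    using arg_cong[OF X1(1), of "\<lambda>A. A$3$3"]
    by (simp add: matrix_matrix_mult_def transpose_def mat_def sum_3 u1_def u2_def u3_def power2_eq_square)
  have "u3\<^sup>2 \<le> 1" using u sum_power2_ge_zero[of u1 u2] by linarith
  then have u3: "\<bar>u3\<bar> \<le> 1" by (simp add: abs_square_le_1)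
  define \<beta> where "\<beta> = arccos u3"
  have b: "cos \<beta> = u3" "0 \<le> \<beta>" "\<beta> \<le> pi" "sin \<beta> = sqrt (1 - u3\<^sup>2)"
    using u3 by (auto simp: \<beta>_def cos_arccos_abs sin_arccos_abs arccos_lbound arccos_ubound)
  obtain \<alpha> where a: "u1 = sin \<beta> * sin \<alpha>" "u2 = - (sin \<beta> * cos \<alpha>)"
  proof (cases "sin \<beta> = 0")
    case True
    then have "1 - u3\<^sup>2 = 0" using b(4) by simp
    then have "u1\<^sup>2 + u2\<^sup>2 = 0" using u by linarith
    then show ?thesis using that[of 0] True by (simp add: sum_power2_eq_zero_iff)
  next
    case False
    have "(sin \<beta>)\<^sup>2 = u1\<^sup>2 + u2\<^sup>2" using b(1) u by (simp add: sin_squared_eq)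
    then have "(- u2 / sin \<beta>)\<^sup>2 + (u1 / sin \<beta>)\<^sup>2 = (sin \<beta>)\<^sup>2 / (sin \<beta>)\<^sup>2"
      by (simp only: power_divide power2_minus add_divide_distrib[symmetric] add.commute)
    then have "(- u2 / sin \<beta>)\<^sup>2 + (u1 / sin \<beta>)\<^sup>2 = 1" using False by simp
    then obtain t where "- u2 / sin \<beta> = cos t" "u1 / sin \<beta> = sin t" using sincos_total_2pi by metis
    then show ?thesis using that[of t] False by (simp add: field_simps)
  qed
  define Q where "Q = RZ \<alpha> ** RX \<beta>"
  have Qe: "Q = quat_rot (euler_quat \<alpha> \<beta> 0)"
  proof -
    have "RZ 0 = mat 1" by (simp add: RZ_def vec_eq_iff forall_3 mat_def)
    then show ?thesis by (simp add: quat_rot_euler Q_def)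
  qed
  have Q: "transpose Q ** Q = mat 1" "det Q = 1"
    using quat_rot_SO3[OF norm_euler_quat[of \<alpha> \<beta> 0]] by (auto simp: SO3_def Qe)
  have Q': "Q ** transpose Q = mat 1" using Q(1) matrix_left_right_inverse by blast
  define Y where "Y = transpose Q ** X"
  have XQ: "X = Q ** Y" by (simp add: Y_def matrix_mul_assoc Q')
  have YY: "transpose Y ** Y = mat 1"
  proof -
    have "transpose Y ** Y = transpose X ** (Q ** transpose Q) ** X"
      unfolding Y_def matrix_transpose_mul transpose_transpose by (simp only: matrix_mul_assoc)
    then show ?thesis by (simp add: Q' X1)
  qed
  then have YY': "Y ** transpose Y = mat 1" using matrix_left_right_inverse by blast
  have dY: "det Y = 1" using X1(2) Q(2) by (simp add: Y_def det_mul det_transpose)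
  have Q3: "Q$1$3 = u1" "Q$2$3 = u2" "Q$3$3 = u3"
    using a b by (simp_all add: Q_def RZ_def RX_def matrix_matrix_mult_def sum_3 algebra_simps)
  have QQ: "(transpose Q ** Q)$i$3 = (transpose Q ** X)$i$3" for i
    by (simp add: matrix_matrix_mult_def sum_3 Q3 u1_def u2_def u3_def)
  have Y3: "Y$1$3 = 0" "Y$2$3 = 0" "Y$3$3 = 1"
    using QQ[of 1] QQ[of 2] QQ[of 3] unfolding Y_def[symmetric] Q(1) by (simp_all add: mat_def)
  have r: "(Y ** transpose Y)$i$j = Y$i$1 * Y$j$1 + Y$i$2 * Y$j$2 + Y$i$3 * Y$j$3" for i j
    by (simp add: matrix_matrix_mult_def transpose_def sum_3)
  have "(Y$3$1)\<^sup>2 + (Y$3$2)\<^sup>2 = 0" using r[of 3 3] unfolding YY' by (simp add: mat_def Y3 power2_eq_square)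
  then have Y31: "Y$3$1 = 0" "Y$3$2 = 0" by (simp_all add: sum_power2_eq_zero_iff)
  have e1: "(Y$1$1)\<^sup>2 + (Y$1$2)\<^sup>2 = 1" using r[of 1 1] unfolding YY' by (simp add: mat_def Y3 power2_eq_square)
  have e2: "(Y$2$1)\<^sup>2 + (Y$2$2)\<^sup>2 = 1" using r[of 2 2] unfolding YY' by (simp add: mat_def Y3 power2_eq_square)
  have e4: "Y$1$1 * Y$2$2 - Y$1$2 * Y$2$1 = 1" using dY by (simp add: det_3 Y3 Y31)
  \<comment> \<open>Two unit rows with determinant 1: the sum of squares equals 1 + 1 - 2 =
    0.\<close>
  have e5: "Y$2$2 = Y$1$1" "Y$1$2 = - Y$2$1"
  proof -
    have "(Y$2$2 - Y$1$1)\<^sup>2 + (Y$1$2 + Y$2$1)\<^sup>2 = 0" using e1 e2 e4 by algebra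
    then have "Y$2$2 - Y$1$1 = 0" "Y$1$2 + Y$2$1 = 0" by (auto simp: sum_power2_eq_zero_iff)
    then show "Y$2$2 = Y$1$1" "Y$1$2 = - Y$2$1" by auto
  qed
  have "(Y$1$1)\<^sup>2 + (Y$2$1)\<^sup>2 = 1" using e1 e5 by simp
  then obtain \<gamma> where g: "Y$1$1 = cos \<gamma>" "Y$2$1 = sin \<gamma>" using sincos_total_2pi by metis
  have "Y = RZ \<gamma>" by (simp add: RZ_def vec_eq_iff forall_3 Y3 Y31 e5 g)
  then show ?thesis using XQ b unfolding Q_def by blast
qed

text \<open>An arbitrary choice of sign, which cannot be made continuously on all of SO(3). It is
  therefore only composed with even functions.\<close>

definition lift :: "real^3^3 \<Rightarrow> real^4" where
  "lift X = (SOME y. norm y = 1 \<and> quat_rot y = X)"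

lemma lift:
  assumes "X \<in> SO3"
  shows "norm (lift X) = 1" "quat_rot (lift X) = X"
proof -
  have "\<exists>y. norm y = 1 \<and> quat_rot y = X"
    using SO3_euler[OF assms] quat_rot_euler norm_euler_quat by metis
  from someI_ex[OF this] show "norm (lift X) = 1" "quat_rot (lift X) = X" by (auto simp: lift_def)
qed

lemma lift_quat_rot:
  assumes "norm y = 1"
  shows "lift (quat_rot y) = y \<or> lift (quat_rot y) = - y"
  using lift[OF quat_rot_SO3[OF assms]] quat_rot_eq_iff[OF _ assms, of "lift (quat_rot y)"] by metis

lemma so3_dist_lift:
  assumes "X \<in> SO3" "Y \<in> SO3"
  shows "so3_dist X Y = arccos (2 * (lift Y \<bullet> lift X)\<^sup>2 - 1)"
proof -
  have "transpose Y ** Y = mat 1" using assms by (simp add: SO3_def)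
  then have YY: "transpose Y ** Y = mat 1 \<and> Y ** transpose Y = mat 1" using matrix_left_right_inverse by blast
  then have "Y ** matrix_inv Y = mat 1 \<and> matrix_inv Y ** Y = mat 1"
    unfolding matrix_inv_def by (intro someI[of "\<lambda>A. Y ** A = mat 1 \<and> A ** Y = mat 1" "transpose Y"]) simp
  then have "matrix_inv Y = transpose Y" using YY by (metis matrix_mul_assoc matrix_mul_lid matrix_mul_rid)
  then show ?thesis
    unfolding so3_dist_def rot_angle_def
    using trace_quat_rot[OF lift(1)[OF assms(1)] lift(1)[OF assms(2)]] lift(2)[OF assms(1)] lift(2)[OF assms(2)]
    by (simp add: diff_divide_distrib)
qed

text \<open>Although \<open>lift\<close> is not continuous, an even f does not see its sign, so the
  preimage of a closed set is the image under \<open>quat_rot\<close> of a compact subset of the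
  sphere.\<close>

lemma closed_SO3: "closed SO3"
  and continuous_on_lift:
    "continuous_on UNIV f \<Longrightarrow> (\<And>y. f (- y) = f y) \<Longrightarrow> continuous_on SO3 (\<lambda>X. f (lift X))"
    for f :: "real^4 \<Rightarrow> 'a::t2_space"
proof -
  have cont: "continuous_on A quat_rot" for A
  proof -
    have "continuous_on A (\<lambda>y. quat_rot y $ i $ j)" for i j
      using exhaust_3[of i] exhaust_3[of j] unfolding quat_rot_def
      by (elim disjE; simp; intro continuous_intros)
    then have "continuous_on A (\<lambda>y. \<chi> i j. quat_rot y $ i $ j)"
      by (intro continuous_on_vec_lambda)
    then show ?thesis by simp
  qed
  have SO: "SO3 = quat_rot ` sphere 0 1"
  proof (intro equalityI subsetI)
    fix X assume "X \<in> SO3"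
    then show "X \<in> quat_rot ` sphere 0 1" using lift[of X] by (intro image_eqI[of _ _ "lift X"]) auto
  qed (use quat_rot_SO3 in auto)
  show cl: "closed SO3" unfolding SO
    by (intro compact_imp_closed compact_continuous_image cont) simp
  assume f: "continuous_on UNIV f" "\<And>y. f (- y) = f y"
  show "continuous_on SO3 (\<lambda>X. f (lift X))"
    unfolding continuous_on_closed_vimage[OF cl]
  proof (intro allI impI)
    fix B :: "'a set" assume B: "closed B"
    have "(\<lambda>X. f (lift X)) -` B \<inter> SO3 = quat_rot ` (sphere 0 1 \<inter> f -` B)"
    proof (intro equalityI subsetI)
      fix X assume "X \<in> (\<lambda>X. f (lift X)) -` B \<inter> SO3"
      then show "X \<in> quat_rot ` (sphere 0 1 \<inter> f -` B)"
        using lift[of X] by (auto intro!: image_eqI[of _ _ "lift X"])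
    next
      fix X assume "X \<in> quat_rot ` (sphere 0 1 \<inter> f -` B)"
      then obtain y where y: "X = quat_rot y" "norm y = 1" "f y \<in> B" by auto
      then show "X \<in> (\<lambda>X. f (lift X)) -` B \<inter> SO3"
        using lift_quat_rot[OF y(2)] quat_rot_SO3[OF y(2)] f(2)[of y] by auto
    qed
    moreover have "closed (f -` B)" using f(1) B by (simp add: continuous_on_closed_vimage[OF closed_UNIV])
    ultimately show "closed ((\<lambda>X. f (lift X)) -` B \<inter> SO3)"
      by (auto intro!: compact_imp_closed compact_continuous_image cont compact_Int_closed)
  qed
qed

section \<open>Wigner functions and even polynomials\<close>

definition za :: "real^4 \<Rightarrow> complex" where "za y = of_real (y$1) - \<i> * of_real (y$4)"
definition zb :: "real^4 \<Rightarrow> complex" where "zb y = of_real (y$2) - \<i> * of_real (y$3)"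

definition mon :: "nat \<Rightarrow> nat \<Rightarrow> nat \<Rightarrow> nat \<Rightarrow> real^4 \<Rightarrow> complex" where
  "mon p q r s y = za y ^ p * cnj (za y) ^ q * zb y ^ r * cnj (zb y) ^ s"

lemma mon_uminus: "mon p q r s (- y) = (- 1) ^ (p + q + r + s) * mon p q r s y"
proof -
  have "za (- y) = - 1 * za y" "zb (- y) = - 1 * zb y" by (simp_all add: za_def zb_def)
  then show ?thesis unfolding mon_def complex_cnj_mult complex_cnj_minus complex_cnj_one
    by (simp only: power_mult_distrib power_add complex_cnj_mult complex_cnj_minus complex_cnj_one) (simp only: mult_ac)
qed

lemma continuous_on_mon: "continuous_on A (mon p q r s)"
  unfolding mon_def za_def zb_def by (intro continuous_intros)

lemma mon_split:
  assumes "norm y = 1"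
  shows "mon p q r s y = mon (Suc p) (Suc q) r s y + mon p q (Suc r) (Suc s) y"
proof -
  have "za y * cnj (za y) + zb y * cnj (zb y) = of_real ((y$1)\<^sup>2 + (y$2)\<^sup>2 + (y$3)\<^sup>2 + (y$4)\<^sup>2)"
    by (simp add: za_def zb_def complex_eq_iff power2_eq_square)
  also have "\<dots> = 1" using assms by (simp add: norm_quat)
  finally have e: "za y * cnj (za y) + zb y * cnj (zb y) = 1" .
  have "mon (Suc p) (Suc q) r s y + mon p q (Suc r) (Suc s) y = mon p q r s y * (za y * cnj (za y) + zb y * cnj (zb y))"
    by (simp add: mon_def algebra_simps)
  then show ?thesis by (simp add: e)
qed

lemma mon_euler:
  "mon p q r s (euler_quat \<alpha> \<beta> \<gamma>) = of_real (cos (\<beta>/2) ^ (p + q) * sin (\<beta>/2) ^ (r + s)) *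
     cis ((real q - real p) * ((\<alpha> + \<gamma>)/2) + (real s - real r) * ((\<alpha> - \<gamma>)/2))"
proof -
  have a: "za (euler_quat \<alpha> \<beta> \<gamma>) = of_real (cos (\<beta>/2)) * cis (- ((\<alpha> + \<gamma>)/2))"
    and b: "zb (euler_quat \<alpha> \<beta> \<gamma>) = of_real (sin (\<beta>/2)) * cis (- ((\<alpha> - \<gamma>)/2))"
    by (simp_all add: za_def zb_def euler_quat_def complex_eq_iff)
  have "mon p q r s (euler_quat \<alpha> \<beta> \<gamma>) = of_real (cos (\<beta>/2) ^ (p + q) * sin (\<beta>/2) ^ (r + s)) *
     (cis (- ((\<alpha> + \<gamma>)/2)) ^ p * cis ((\<alpha> + \<gamma>)/2) ^ q * cis (- ((\<alpha> - \<gamma>)/2)) ^ r * cis ((\<alpha> - \<gamma>)/2) ^ s)"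
    unfolding mon_def a b by (simp add: cis_cnj power_mult_distrib power_add mult_ac)
  also have "cis (- ((\<alpha> + \<gamma>)/2)) ^ p * cis ((\<alpha> + \<gamma>)/2) ^ q * cis (- ((\<alpha> - \<gamma>)/2)) ^ r * cis ((\<alpha> - \<gamma>)/2) ^ s
     = cis ((real q - real p) * ((\<alpha> + \<gamma>)/2) + (real s - real r) * ((\<alpha> - \<gamma>)/2))"
    unfolding Complex.DeMoivre cis_mult by (rule arg_cong[of _ _ cis]) (simp add: field_simps)
  finally show ?thesis .
qed

text \<open>The absolute values of the coefficients in Wigner's formula. Keeping the sign separate
  exposes their positivity, on which the absence of cancellation rests.\<close>

definition wigner_coeff :: "nat \<Rightarrow> int \<Rightarrow> int \<Rightarrow> int \<Rightarrow> real" where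
  "wigner_coeff l k m s =
     sqrt (fact (nat (int l + k)) * fact (nat (int l - k)) * fact (nat (int l + m)) * fact (nat (int l - m))) /
     (fact (nat (int l + m - s)) * fact (nat s) * fact (nat (k - m + s)) * fact (nat (int l - k - s)))"

lemma wigner_coeff_pos: "wigner_coeff l k m s > 0"
  by (simp add: wigner_coeff_def)

text \<open>Whichever Euler angles the choice operator selects, they give one of the two lifts, and
  the formula is matched termwise with monomials in half-angle form.\<close>

lemma wigner_D_lift:
  assumes X: "X \<in> SO3"
  shows "wigner_D l k m X = (\<Sum>s\<in>{max 0 (m - k)..min (int l + m) (int l - k)}.
    of_real ((-1) ^ nat (k - m + s) * wigner_coeff l k m s) *
    mon (nat (int l + m - s)) (nat (int l - k - s)) (nat (k - m + s)) (nat s) (lift X))"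
proof -
  have "\<exists>z \<alpha> \<beta> \<gamma>. X = RZ \<alpha> ** RX \<beta> ** RZ \<gamma> \<and> 0 \<le> \<beta> \<and> \<beta> \<le> pi \<and>
      z = exp (- \<i> * of_int k * of_real \<alpha>) * of_real (wigner_P l k m (cos \<beta>)) * exp (- \<i> * of_int m * of_real \<gamma>)"
    using SO3_euler[OF X] by blast
  from someI_ex[OF this, folded wigner_D_def]
  obtain \<alpha> \<beta> \<gamma> where e: "X = RZ \<alpha> ** RX \<beta> ** RZ \<gamma>" "0 \<le> \<beta>" "\<beta> \<le> pi"
    and D: "wigner_D l k m X = exp (- \<i> * of_int k * of_real \<alpha>) * of_real (wigner_P l k m (cos \<beta>)) * exp (- \<i> * of_int m * of_real \<gamma>)"
    by auto
  have P: "wigner_P l k m (cos \<beta>) = wigner_d l k m \<beta>" using e by (simp add: wigner_P_def arccos_cos)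
  have lf: "lift X = euler_quat \<alpha> \<beta> \<gamma> \<or> lift X = - euler_quat \<alpha> \<beta> \<gamma>"
    using lift_quat_rot[OF norm_euler_quat[of \<alpha> \<beta> \<gamma>]] by (simp add: quat_rot_euler e)
  have ex: "exp (- \<i> * of_int k * of_real \<alpha>) * exp (- \<i> * of_int m * of_real \<gamma>) = cis (- (of_int k * \<alpha> + of_int m * \<gamma>))"
    unfolding cis_conv_exp exp_add[symmetric] by (simp add: algebra_simps)
  have "exp (- \<i> * of_int k * of_real \<alpha>) * of_real (wigner_d l k m \<beta>) * exp (- \<i> * of_int m * of_real \<gamma>)
    = cis (- (of_int k * \<alpha> + of_int m * \<gamma>)) * of_real (wigner_d l k m \<beta>)"
    unfolding ex[symmetric] by (simp add: mult_ac)
  also have "\<dots> = (\<Sum>s\<in>{max 0 (m - k)..min (int l + m) (int l - k)}.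
    of_real ((-1) ^ nat (k - m + s) * wigner_coeff l k m s) *
    mon (nat (int l + m - s)) (nat (int l - k - s)) (nat (k - m + s)) (nat s) (lift X))"
    unfolding wigner_d_def of_real_sum sum_distrib_left
  proof (rule sum.cong[OF refl])
    fix s assume s: "s \<in> {max 0 (m - k)..min (int l + m) (int l - k)}"
    define p q r t where "p = nat (int l + m - s)" and "q = nat (int l - k - s)" and "r = nat (k - m + s)" and "t = nat s"
    have i: "int p = int l + m - s" "int q = int l - k - s" "int r = k - m + s" "int t = s"
      using s by (auto simp: p_def q_def r_def t_def)
    have "int (p + q + r + t) = int (2 * l)" using i by simp
    then have pqrt: "p + q + r + t = 2 * l" by linarith
    \<comment> \<open>The even degree 2l absorbs the sign of the lift.\<close>
    have mon: "mon p q r t (lift X) = mon p q r t (euler_quat \<alpha> \<beta> \<gamma>)"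
      using lf by (auto simp: mon_uminus pqrt)
    have n1: "nat (2 * int l + m - k - 2 * s) = p + q" "nat (k - m + 2 * s) = r + t" using i by auto
    have "real_of_int (int p) = real_of_int (int l + m - s)" "real_of_int (int q) = real_of_int (int l - k - s)"
      "real_of_int (int r) = real_of_int (k - m + s)" "real_of_int (int t) = real_of_int s"
      unfolding i by simp_all
    then have rr: "real p = real l + m - s" "real q = real l - k - s" "real r = real_of_int k - m + s" "real t = s"
      by simp_all
    \<comment> \<open>The phase does not depend on s, so it is common to all terms of the
      sum.\<close>
    have an: "(real q - real p) * ((\<alpha> + \<gamma>)/2) + (real t - real r) * ((\<alpha> - \<gamma>)/2) = - (of_int k * \<alpha> + of_int m * \<gamma>)"
      unfolding rr by (simp add: field_simps)
    show "cis (- (real_of_int k * \<alpha> + real_of_int m * \<gamma>)) *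
       complex_of_real ((- 1) ^ nat (k - m + s) *
         sqrt (fact (nat (int l + k)) * fact (nat (int l - k)) * fact (nat (int l + m)) * fact (nat (int l - m))) /
         (fact (nat (int l + m - s)) * fact (nat s) * fact (nat (k - m + s)) * fact (nat (int l - k - s))) *
         cos (\<beta> / 2) ^ nat (2 * int l + m - k - 2 * s) * sin (\<beta> / 2) ^ nat (k - m + 2 * s)) =
       complex_of_real ((- 1) ^ nat (k - m + s) * wigner_coeff l k m s) *
       mon (nat (int l + m - s)) (nat (int l - k - s)) (nat (k - m + s)) (nat s) (lift X)"
      unfolding p_def[symmetric] q_def[symmetric] r_def[symmetric] t_def[symmetric] mon mon_euler an n1
      by (simp add: wigner_coeff_def p_def[symmetric] q_def[symmetric] r_def[symmetric] t_def[symmetric] mult_ac)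
  qed
  finally show ?thesis unfolding D P .
qed

text \<open>
  By induction on the degree, \<open>rec\<close> makes neighbouring top-degree monomials differ only by a sign, and
  this sign matches the alternation in Wigner's formula. All terms of the sum therefore agree in sign,
  so its vanishing forces each of them to vanish.
\<close>
lemma monomial_moments_vanish:
  fixes F :: "nat \<Rightarrow> nat \<Rightarrow> nat \<Rightarrow> nat \<Rightarrow> complex"
  assumes rec: "\<And>p q r s. even (p + q + r + s) \<Longrightarrow> F p q r s = F (Suc p) (Suc q) r s + F p q (Suc r) (Suc s)"
    and D: "\<And>l k m. l \<le> N \<Longrightarrow> \<bar>k\<bar> \<le> int l \<Longrightarrow> \<bar>m\<bar> \<le> int l \<Longrightarrow>
      (\<Sum>s\<in>{max 0 (m - k)..min (int l + m) (int l - k)}.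
        of_real ((-1) ^ nat (k - m + s) * wigner_coeff l k m s) *
        F (nat (int l + m - s)) (nat (int l - k - s)) (nat (k - m + s)) (nat s)) = 0"
  shows "p + q + r + s = 2 * n \<Longrightarrow> n \<le> N \<Longrightarrow> F p q r s = 0"
proof (induction n arbitrary: p q r s rule: less_induct)
  case (less n)
  \<comment> \<open>The indices are recovered from the exponents: the given monomial is the term
    with summation index s in the Wigner sum for (n, k, m).\<close>
  define k m where "k = (int p - int q + int r - int s) div 2" and "m = (int p - int q - int r + int s) div 2"
  have sum: "int p + int q + int r + int s = 2 * int n" using less.prems(1) by linarith
  have "int p - int q + int r - int s = 2 * (int n - int q - int s)" "int p - int q - int r + int s = 2 * (int n - int q - int r)"
    using sum by auto
  then have km: "k = int n - int q - int s" "m = int n - int q - int r" by (auto simp: k_def m_def)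
  define lo hi where "lo = max 0 (m - k)" and "hi = min (int n + m) (int n - k)"
  define G where "G t = F (nat (int n + m - t)) (nat (int n - k - t)) (nat (k - m + t)) (nat t)" for t
  define f where "f t = of_real ((-1) ^ nat (k - m + t)) * G t" for t
  have step: "f (t + 1) = f t" if t: "lo \<le> t" "t < hi" for t
  proof -
    define a b c d where "a = nat (int n + m - t - 1)" and "b = nat (int n - k - t - 1)" and "c = nat (k - m + t)" and "d = nat t"
    have i: "int a = int n + m - t - 1" "int b = int n - k - t - 1" "int c = k - m + t" "int d = t"
      using t by (auto simp: a_def b_def c_def d_def lo_def hi_def)
    have e: "nat (int n + m - t) = Suc a" "nat (int n - k - t) = Suc b" "nat (int n + m - (t + 1)) = a" "nat (int n - k - (t + 1)) = b"
      "nat (k - m + (t + 1)) = Suc c" "nat (t + 1) = Suc d" "nat (k - m + t) = c" "nat t = d"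
      using i by auto
    have "int (a + b + c + d) = 2 * int (n - 1)" "n > 0" using i by auto
    then have abcd: "a + b + c + d = 2 * (n - 1)" "n - 1 < n" by linarith+
    have "F a b c d = 0" using less.IH[OF abcd(2,1)] less.prems(2) by simp
    moreover have "F a b c d = F (Suc a) (Suc b) c d + F a b (Suc c) (Suc d)"
      by (rule rec) (use abcd in simp)
    ultimately have "F a b (Suc c) (Suc d) = - F (Suc a) (Suc b) c d" by (simp add: add_eq_0_iff2)
    then show ?thesis unfolding f_def G_def e by simp
  qed
  have const: "f t = f lo" if "lo \<le> t" "t \<le> hi" for t
    using that
  proof (induction t rule: int_ge_induct)
    case (step t)
    then show ?case using \<open>\<And>t. lo \<le> t \<Longrightarrow> t < hi \<Longrightarrow> f (t + 1) = f t\<close>[of t] by simp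
  qed simp
  have s: "lo \<le> int s" "int s \<le> hi" using km sum by (auto simp: lo_def hi_def)
  have "0 = (\<Sum>t\<in>{lo..hi}. of_real ((-1) ^ nat (k - m + t) * wigner_coeff n k m t) * G t)"
    unfolding lo_def hi_def G_def by (rule D[symmetric]) (use less.prems(2) km sum in auto)
  also have "\<dots> = (\<Sum>t\<in>{lo..hi}. of_real (wigner_coeff n k m t) * f t)"
    by (simp add: f_def mult_ac)
  also have "\<dots> = (\<Sum>t\<in>{lo..hi}. of_real (wigner_coeff n k m t) * f lo)"
  proof (rule sum.cong[OF refl])
    fix t assume "t \<in> {lo..hi}"
    then have "f t = f lo" by (intro const) auto
    then show "of_real (wigner_coeff n k m t) * f t = of_real (wigner_coeff n k m t) * f lo" by (simp only:)
  qed
  also have "\<dots> = of_real (\<Sum>t\<in>{lo..hi}. wigner_coeff n k m t) * f lo"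
    by (simp add: sum_distrib_right)
  finally have "of_real (\<Sum>t\<in>{lo..hi}. wigner_coeff n k m t) * f lo = 0" by simp
  moreover have "(\<Sum>t\<in>{lo..hi}. wigner_coeff n k m t) > 0"
    by (rule sum_pos) (use wigner_coeff_pos s in auto)
  ultimately have "f lo = 0" by (simp del: of_real_sum)
  then have "f (int s) = 0" using const[OF s] by simp
  then have "G (int s) = 0" by (simp add: f_def)
  moreover have "G (int s) = F p q r s"
  proof -
    have "int n + m - int s = int p" "int n - k - int s = int q" "k - m + int s = int r" using km sum by auto
    then show ?thesis by (simp add: G_def)
  qed
  ultimately show ?case by simp
qed

text \<open>Polynomials of degree at most \<open>d\<close> whose monomials all have the parity of \<open>d\<close>.\<close>
inductive pol :: "nat \<Rightarrow> (real^4 \<Rightarrow> complex) \<Rightarrow> bool" for d where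
  pol_mon: "p + q + r + s + 2 * e = d \<Longrightarrow> pol d (mon p q r s)"
| pol_add: "pol d f \<Longrightarrow> pol d g \<Longrightarrow> pol d (\<lambda>y. f y + g y)"
| pol_scale: "pol d f \<Longrightarrow> pol d (\<lambda>y. c * f y)"

lemma pol_mono: "pol d f \<Longrightarrow> pol (d + 2 * e) f"
proof (induction rule: pol.induct)
  case (pol_mon p q r s e')
  then show ?case by (intro pol.pol_mon[of p q r s "e' + e"]) simp
qed (auto intro: pol.intros)

lemma pol_mult:
  assumes "pol d f" "pol e g"
  shows "pol (d + e) (\<lambda>y. f y * g y)"
  using assms(1)
proof (induction rule: pol.induct)
  case (pol_mon p q r s n)
  show ?case using assms(2)
  proof (induction rule: pol.induct)
    case (pol_mon p' q' r' s' n')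
    have "(\<lambda>y. mon p q r s y * mon p' q' r' s' y) = mon (p + p') (q + q') (r + r') (s + s')"
      by (simp add: mon_def power_add fun_eq_iff mult_ac)
    moreover have "pol (d + e) (mon (p + p') (q + q') (r + r') (s + s'))"
      by (rule pol.pol_mon[of _ _ _ _ "n + n'"]) (use pol_mon \<open>p + q + r + s + 2 * n = d\<close> in simp)
    ultimately show ?case by simp
  next
    case (pol_add f g)
    then show ?case by (simp add: distrib_left pol.pol_add)
  next
    case (pol_scale f c)
    then show ?case using pol.pol_scale[of "d + e" "\<lambda>y. mon p q r s y * f y" c] by (simp add: mult_ac)
  qed
next
  case (pol_add f g)
  then show ?case by (simp add: distrib_right pol.pol_add)
next
  case (pol_scale f c)
  then show ?case using pol.pol_scale[of "d + e" "\<lambda>y. f y * g y" c] by (simp add: mult_ac)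
qed

lemma pol_const: "pol (2 * e) (\<lambda>y. c)"
proof -
  have "pol (2 * e) (\<lambda>y. c * mon 0 0 0 0 y)" by (intro pol_scale pol_mon[where e = e]) simp
  then show ?thesis by (simp add: mon_def)
qed

lemma pol_sum: "finite I \<Longrightarrow> (\<And>i. i \<in> I \<Longrightarrow> pol (2 * d) (f i)) \<Longrightarrow> pol (2 * d) (\<lambda>y. \<Sum>i\<in>I. f i y)"
  by (induction I rule: finite_induct) (auto intro: pol_add pol_const)

lemma pol_power: "pol d f \<Longrightarrow> pol (n * d) (\<lambda>y. f y ^ n)"
  by (induction n) (auto intro: pol_mult pol_const[of 0, simplified])

lemma pol_inner: "pol 1 (\<lambda>y. of_real (v \<bullet> y))"
proof -
  have m: "pol 1 (mon 1 0 0 0)" "pol 1 (mon 0 1 0 0)" "pol 1 (mon 0 0 1 0)" "pol 1 (mon 0 0 0 1)"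
    by (rule pol.pol_mon[where e = 0], simp)+
  have "pol 1 (\<lambda>y. (of_real (v$1) / 2 + \<i> * of_real (v$4) / 2) * mon 1 0 0 0 y + (of_real (v$1) / 2 - \<i> * of_real (v$4) / 2) * mon 0 1 0 0 y
     + (of_real (v$2) / 2 + \<i> * of_real (v$3) / 2) * mon 0 0 1 0 y + (of_real (v$2) / 2 - \<i> * of_real (v$3) / 2) * mon 0 0 0 1 y)"
    by (intro pol.intros(2,3) m)
  moreover have "(\<lambda>y. (of_real (v$1) / 2 + \<i> * of_real (v$4) / 2) * mon 1 0 0 0 y + (of_real (v$1) / 2 - \<i> * of_real (v$4) / 2) * mon 0 1 0 0 y
     + (of_real (v$2) / 2 + \<i> * of_real (v$3) / 2) * mon 0 0 1 0 y + (of_real (v$2) / 2 - \<i> * of_real (v$3) / 2) * mon 0 0 0 1 y)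
     = (\<lambda>y. of_real (v \<bullet> y))"
    by (rule ext) (simp add: mon_def za_def zb_def inner_vec_def sum_4 complex_eq_iff)
  ultimately show ?thesis by (simp only:)
qed

text \<open>In the three-term recurrence both terms have the parity of n, so the lower one is padded
  by an even degree.\<close>

lemma pol_chebU: "pol n (\<lambda>y. of_real (chebU (Suc n) (v \<bullet> y)))"
proof (induction n rule: less_induct)
  case (less n)
  consider "n = 0" | "n = 1" | k where "n = Suc (Suc k)" by (metis One_nat_def not0_implies_Suc)
  then show ?case
  proof cases
    case 1
    then show ?thesis using pol_const[of 0 1] by simp
  next
    case 2
    then show ?thesis using pol_scale[OF pol_inner[of v], of 2] by simp
  next
    case 3
    have "pol (1 + Suc k) (\<lambda>y. of_real (v \<bullet> y) * of_real (chebU (Suc (Suc k)) (v \<bullet> y)))"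
      by (rule pol_mult[OF pol_inner less.IH]) (simp add: 3)
    then have 4: "pol n (\<lambda>y. 2 * (of_real (v \<bullet> y) * of_real (chebU (Suc (Suc k)) (v \<bullet> y))))"
      unfolding 3 by (intro pol_scale) simp
    have "pol n (\<lambda>y. (- 1) * of_real (chebU (Suc k) (v \<bullet> y)))"
      using pol_scale[OF pol_mono[OF less.IH[of k], of 1], of "- 1"] by (simp add: 3)
    from pol_add[OF 4 this] show ?thesis by (simp add: 3 mult.assoc)
  qed
qed

lemma pol_bump: "m > 0 \<Longrightarrow> pol (2 + 8 * (m - 1)) (\<lambda>y. of_real (bump m a b p y))"
proof -
  assume "m > 0"
  then obtain k where k: "m = Suc k" by (cases m) auto
  have "pol k (\<lambda>y. of_real (1 / m) * of_real (chebU (Suc k) (p \<bullet> y)))"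
    by (intro pol_scale pol_chebU)
  then have K: "pol (8 * k) (\<lambda>y. (of_real (1 / m) * of_real (chebU (Suc k) (p \<bullet> y))) ^ 8)"
    by (rule pol_power)
  have "pol (1 + 1) (\<lambda>y. of_real (b \<bullet> y) * of_real (p \<bullet> y))"
    by (intro pol_mult pol_inner)
  then have "pol 2 (\<lambda>y. of_real a + of_real (b \<bullet> y) * of_real (p \<bullet> y))"
    using pol_const[of 1] by (intro pol_add) (simp_all add: numeral_2_eq_2)
  from pol_mult[OF this K] show ?thesis by (simp add: bump_def ker_def k)
qed

lemma pol_continuous: "pol d f \<Longrightarrow> continuous_on A f"
  by (induction rule: pol.induct) (auto intro!: continuous_intros continuous_on_mon)

lemma pol_even: "pol (2 * d) f \<Longrightarrow> f (- y) = f y"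
proof (induction rule: pol.induct)
  case (pol_mon p q r s e)
  then have "even (p + q + r + s)" by (metis even_add even_mult_iff even_numeral)
  then show ?case by (simp add: mon_uminus)
qed auto

section \<open>Moments of measures on the rotation group\<close>

lemma space_fin_borel: "fin_borel_SO3 P \<Longrightarrow> space P = SO3"
  using sets_eq_imp_space_eq[of P SO3_borel] by (simp add: fin_borel_SO3_def SO3_borel_def space_restrict_space)

lemma integrable_lift:
  fixes f :: "real^4 \<Rightarrow> 'a::{banach, second_countable_topology}"
  assumes P: "fin_borel_SO3 P" and f: "continuous_on UNIV f" "\<And>y. f (- y) = f y"
  shows "integrable P (\<lambda>X. f (lift X))"
proof -
  interpret finite_measure P using P by (simp add: fin_borel_SO3_def)
  have "(\<lambda>X. f (lift X)) \<in> borel_measurable (restrict_space borel SO3)"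
    by (rule borel_measurable_continuous_on_restrict[OF continuous_on_lift[OF f]])
  then have ms: "(\<lambda>X. f (lift X)) \<in> borel_measurable P"
    using P by (subst measurable_cong_sets[of P SO3_borel _ borel]) (simp_all add: fin_borel_SO3_def SO3_borel_def)
  have "compact (f ` sphere 0 1)" by (intro compact_continuous_image continuous_on_subset[OF f(1)]) auto
  then obtain B where "\<forall>z\<in>f ` sphere 0 1. norm z \<le> B" using compact_imp_bounded bounded_iff by metis
  then have "norm (f (lift X)) \<le> B" if "X \<in> SO3" for X using lift(1)[OF that] by auto
  then have "AE X in P. norm (f (lift X)) \<le> B" by (intro AE_I2) (simp add: space_fin_borel[OF P])
  then show ?thesis by (rule integrable_const_bound[OF _ ms])
qed

text \<open>The difference of the two sides is a linear functional \<open>L\<close> that sees only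
  values on SO(3). The relation |a|^2 + |b|^2 = 1 thus passes to its values \<open>F\<close> on
  monomials, and the hypothesis becomes the vanishing of the Wigner sums in \<open>F\<close>; these
  are the two inputs of \<open>monomial_moments_vanish\<close>.\<close>

lemma moments_agree:
  fixes c :: "nat \<Rightarrow> real" and x :: "nat \<Rightarrow> real^3^3"
  assumes P: "fin_borel_SO3 P" and Q: "fin_borel_SO3 Q" and x: "\<And>i. i < M \<Longrightarrow> x i \<in> SO3"
    and D: "\<And>l k m. l \<le> N \<Longrightarrow> \<bar>k\<bar> \<le> int l \<Longrightarrow> \<bar>m\<bar> \<le> int l \<Longrightarrow>
       spair P Q (wigner_D l k m) = (\<Sum>i<M. of_real (c i) * wigner_D l k m (x i))"
    and f: "pol (2 * N) f"
  shows "spair P Q (\<lambda>X. f (lift X)) = (\<Sum>i<M. of_real (c i) * f (lift (x i)))"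
proof -
  define L where "L f = spair P Q f - (\<Sum>i<M. of_real (c i) * f (x i))" for f :: "real^3^3 \<Rightarrow> complex"
  note sp = space_fin_borel[OF P] space_fin_borel[OF Q]
  have L_cong: "L f = L g" if "\<And>X. X \<in> SO3 \<Longrightarrow> f X = g X" for f g
  proof -
    have "(\<integral>X. f X \<partial>P) = (\<integral>X. g X \<partial>P)" "(\<integral>X. f X \<partial>Q) = (\<integral>X. g X \<partial>Q)"
      by (rule Bochner_Integration.integral_cong; simp add: sp that)+
    moreover have "(\<Sum>i<M. of_real (c i) * f (x i)) = (\<Sum>i<M. of_real (c i) * g (x i))"
      by (rule sum.cong) (use that x in auto)
    ultimately show ?thesis by (simp only: L_def spair_def)
  qed
  have L_add: "L (\<lambda>X. f X + g X) = L f + L g"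
    if "integrable P f" "integrable Q f" "integrable P g" "integrable Q g" for f g
    using that by (simp add: L_def spair_def sum.distrib algebra_simps)
  have L_scale: "L (\<lambda>X. a * f X) = a * L f" for a f
    by (simp add: L_def spair_def sum_distrib_left algebra_simps)
  have L_sum: "L (\<lambda>X. \<Sum>i\<in>I. a i * f i X) = (\<Sum>i\<in>I. a i * L (f i))"
    if "finite I" "\<And>i. i \<in> I \<Longrightarrow> integrable P (f i)" "\<And>i. i \<in> I \<Longrightarrow> integrable Q (f i)"
    for I :: "int set" and a f
    using that
  proof (induction I rule: finite_induct)
    case empty
    show ?case by (simp add: L_def spair_def)
  next
    case (insert i I)
    then show ?case by (simp add: L_add L_scale)
  qed
  have int: "integrable P (\<lambda>X. mon p q r s (lift X))" "integrable Q (\<lambda>X. mon p q r s (lift X))"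
    if "even (p + q + r + s)" for p q r s
    using that by (auto intro!: integrable_lift P Q continuous_on_mon simp: mon_uminus)
  define F where "F p q r s = L (\<lambda>X. mon p q r s (lift X))" for p q r s
  have F0: "F p q r s = 0" if "p + q + r + s = 2 * n" "n \<le> N" for p q r s n
  proof (rule monomial_moments_vanish[OF _ _ that])
    fix p q r s :: nat assume e: "even (p + q + r + s)"
    have "F p q r s = L (\<lambda>X. mon (Suc p) (Suc q) r s (lift X) + mon p q (Suc r) (Suc s) (lift X))"
      unfolding F_def by (rule L_cong) (rule mon_split, rule lift)
    also have "\<dots> = F (Suc p) (Suc q) r s + F p q (Suc r) (Suc s)"
      unfolding F_def by (rule L_add; rule int) (use e in auto)
    finally show "F p q r s = F (Suc p) (Suc q) r s + F p q (Suc r) (Suc s)" .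
  next
    fix l k m assume lkm: "l \<le> N" "\<bar>k\<bar> \<le> int l" "\<bar>m\<bar> \<le> int l"
    have "0 = L (wigner_D l k m)" using D[OF lkm] by (simp add: L_def)
    also have "\<dots> = L (\<lambda>X. \<Sum>s\<in>{max 0 (m - k)..min (int l + m) (int l - k)}.
        of_real ((-1) ^ nat (k - m + s) * wigner_coeff l k m s) *
        mon (nat (int l + m - s)) (nat (int l - k - s)) (nat (k - m + s)) (nat s) (lift X))"
      by (rule L_cong) (rule wigner_D_lift)
    also have "\<dots> = (\<Sum>s\<in>{max 0 (m - k)..min (int l + m) (int l - k)}.
        of_real ((-1) ^ nat (k - m + s) * wigner_coeff l k m s) *
        F (nat (int l + m - s)) (nat (int l - k - s)) (nat (k - m + s)) (nat s))"
      unfolding F_def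
    proof (rule L_sum)
      fix s assume s: "s \<in> {max 0 (m - k)..min (int l + m) (int l - k)}"
      have "int (nat (int l + m - s) + nat (int l - k - s) + nat (k - m + s) + nat s) = int (2 * l)"
        using s by auto
      then have "nat (int l + m - s) + nat (int l - k - s) + nat (k - m + s) + nat s = 2 * l" by linarith
      then have "even (nat (int l + m - s) + nat (int l - k - s) + nat (k - m + s) + nat s)" by simp
      from int[OF this] show
        "integrable P (\<lambda>X. mon (nat (int l + m - s)) (nat (int l - k - s)) (nat (k - m + s)) (nat s) (lift X))"
        "integrable Q (\<lambda>X. mon (nat (int l + m - s)) (nat (int l - k - s)) (nat (k - m + s)) (nat s) (lift X))"
        by simp_all
    qed simp
    finally show "(\<Sum>s\<in>{max 0 (m - k)..min (int l + m) (int l - k)}.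
        of_real ((-1) ^ nat (k - m + s) * wigner_coeff l k m s) *
        F (nat (int l + m - s)) (nat (int l - k - s)) (nat (k - m + s)) (nat s)) = 0" ..
  qed
  have "L (\<lambda>X. f (lift X)) = 0" using f
  proof (induction rule: pol.induct)
    case (pol_mon p q r s e)
    then have "p + q + r + s = 2 * (N - e)" by linarith
    then show ?case using F0[of p q r s "N - e"] by (simp add: F_def)
  next
    case (pol_add f g)
    have "L (\<lambda>X. f (lift X) + g (lift X)) = L (\<lambda>X. f (lift X)) + L (\<lambda>X. g (lift X))"
      by (rule L_add; rule integrable_lift) (use P Q pol_add.hyps pol_continuous pol_even in auto)
    then show ?case using pol_add by simp
  next
    case (pol_scale f a)
    then show ?case by (simp add: L_scale)
  qed
  then show ?thesis by (simp add: L_def)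
qed

section \<open>Total variation and duality\<close>

text \<open>Domination on the subsets of Y becomes an order between the measures restricted to Y by
  a density, and monotonicity of the nonnegative integral applies. The bound B keeps it finite, so
  the comparison returns to real integrals.\<close>

lemma integral_indicator_mono_measure:
  fixes h :: "'a \<Rightarrow> real"
  assumes sets: "sets Q = sets P" and fin: "finite_measure P" "finite_measure Q" and Y: "Y \<in> sets P"
    and le: "\<And>X. X \<in> sets P \<Longrightarrow> X \<subseteq> Y \<Longrightarrow> emeasure Q X \<le> emeasure P X"
    and h: "h \<in> borel_measurable P" "\<And>x. x \<in> Y \<Longrightarrow> 0 \<le> h x" "\<And>x. x \<in> Y \<Longrightarrow> h x \<le> B"
  shows "(\<integral>x. indicator Y x * h x \<partial>Q) \<le> (\<integral>x. indicator Y x * h x \<partial>P)"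
proof -
  interpret P: finite_measure P by fact
  interpret Q: finite_measure Q by fact
  have sp: "space Q = space P" by (rule sets_eq_imp_space_eq[OF sets])
  have hQ: "h \<in> borel_measurable Q" using h(1) sets by (simp cong: measurable_cong_sets)
  have YQ: "Y \<in> sets Q" using Y sets by simp
  define g where "g x = indicator Y x * h x" for x
  have g0: "0 \<le> g x" "g x \<le> \<bar>B\<bar>" for x
    using h(2,3)[of x] by (auto simp: g_def indicator_def)
  have gP: "g \<in> borel_measurable P" "g \<in> borel_measurable Q"
    unfolding g_def using h(1) hQ Y YQ by (auto intro!: borel_measurable_times borel_measurable_indicator)
  have eq: "(\<integral>\<^sup>+x. ennreal (g x) \<partial>M) = (\<integral>\<^sup>+x. ennreal (h x) \<partial>density M (indicator Y))"
    if "h \<in> borel_measurable M" "Y \<in> sets M" for M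
    using that by (subst nn_integral_density) (auto intro!: nn_integral_cong simp: g_def split: split_indicator)
  have "density Q (indicator Y) \<le> density P (indicator Y)"
  proof (subst le_measure)
    show "sets (density Q (indicator Y)) = sets (density P (indicator Y))" by (simp add: sets)
    show "\<forall>A\<in>sets (density Q (indicator Y)). emeasure (density Q (indicator Y)) A \<le> emeasure (density P (indicator Y)) A"
    proof
      fix A assume "A \<in> sets (density Q (indicator Y))"
      then have A: "A \<in> sets Q" "A \<in> sets P" by (auto simp: sets)
      have e: "emeasure (density M (indicator Y)) A = emeasure M (A \<inter> Y)" if "A \<in> sets M" "Y \<in> sets M" for M
      proof -
        have "emeasure (density M (indicator Y)) A = (\<integral>\<^sup>+x. indicator Y x * indicator A x \<partial>M)"
          by (rule emeasure_density) (use that in auto)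
        also have "\<dots> = (\<integral>\<^sup>+x. indicator (A \<inter> Y) x \<partial>M)"
          by (rule nn_integral_cong) (auto split: split_indicator)
        finally show ?thesis using that by simp
      qed
      show "emeasure (density Q (indicator Y)) A \<le> emeasure (density P (indicator Y)) A"
        using A Y YQ by (simp add: e le)
    qed
  qed
  then have "(\<integral>\<^sup>+x. ennreal (g x) \<partial>Q) \<le> (\<integral>\<^sup>+x. ennreal (g x) \<partial>P)"
    unfolding eq[OF h(1) Y] eq[OF hQ YQ] by (intro nn_integral_mono_measure) (auto simp: sets)
  moreover have "(\<integral>\<^sup>+x. ennreal (g x) \<partial>P) < \<infinity>"
  proof -
    have "(\<integral>\<^sup>+x. ennreal (g x) \<partial>P) \<le> (\<integral>\<^sup>+x. ennreal \<bar>B\<bar> \<partial>P)"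
      using g0 by (intro nn_integral_mono ennreal_leI) auto
    also have "\<dots> < \<infinity>" by (simp add: ennreal_mult_less_top P.emeasure_eq_measure)
    finally show ?thesis .
  qed
  ultimately have "enn2real (\<integral>\<^sup>+x. ennreal (g x) \<partial>Q) \<le> enn2real (\<integral>\<^sup>+x. ennreal (g x) \<partial>P)"
    by (intro enn2real_mono) auto
  then have "(\<integral>x. g x \<partial>Q) \<le> (\<integral>x. g x \<partial>P)"
    using gP g0 by (simp add: integral_eq_nn_integral)
  then show ?thesis by (simp add: g_def)
qed

lemma SO3_sets: "SO3 \<in> sets SO3_borel"
  using sets.top[of SO3_borel] by (simp add: SO3_borel_def space_restrict_space)

lemma partition_sum_le_tv_norm:
  assumes P: "fin_borel_SO3 P" and Q: "fin_borel_SO3 Q" and B: "borel_partition \<B>"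
  shows "(\<Sum>B\<in>\<B>. \<bar>smeas P Q B\<bar>) \<le> tv_norm (smeas P Q)"
  unfolding tv_norm_def
proof (rule cSup_upper)
  show "(\<Sum>B\<in>\<B>. \<bar>smeas P Q B\<bar>) \<in> {\<Sum>B\<in>\<B>. \<bar>smeas P Q B\<bar> |\<B>. borel_partition \<B>}" using B by blast
  show "bdd_above {\<Sum>B\<in>\<B>. \<bar>smeas P Q B\<bar> |\<B>. borel_partition \<B>}"
  proof (rule bdd_aboveI)
    fix v assume "v \<in> {\<Sum>B\<in>\<B>. \<bar>smeas P Q B\<bar> |\<B>. borel_partition \<B>}"
    then obtain \<C> where v: "v = (\<Sum>B\<in>\<C>. \<bar>smeas P Q B\<bar>)" and C: "borel_partition \<C>" by blast
    have m: "(\<Sum>B\<in>\<C>. measure R B) = measure R SO3" if "fin_borel_SO3 R" for R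
    proof -
      interpret finite_measure R using that by (simp add: fin_borel_SO3_def)
      have "measure R (\<Union>B\<in>\<C>. B) = (\<Sum>B\<in>\<C>. measure R B)"
        by (rule finite_measure_finite_Union)
          (use C that in \<open>auto simp: borel_partition_def fin_borel_SO3_def disjoint_family_on_def\<close>)
      then show ?thesis using C by (simp add: borel_partition_def)
    qed
    have "v \<le> (\<Sum>B\<in>\<C>. measure P B + measure Q B)"
      unfolding v smeas_def
    proof (rule sum_mono)
      fix B
      show "\<bar>measure P B - measure Q B\<bar> \<le> measure P B + measure Q B"
        using measure_nonneg[of P B] measure_nonneg[of Q B] by linarith
    qed
    then show "v \<le> measure P SO3 + measure Q SO3" by (simp add: sum.distrib m P Q)
  qed
qed

text \<open>Each node lies in at most one cell of a partition, so each weight is counted at most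
  once.\<close>

lemma tv_norm_discrete_le: "tv_norm (discrete_smeas M c x) \<le> (\<Sum>i<M. \<bar>c i\<bar>)"
  unfolding tv_norm_def
proof (rule cSup_least)
  have "borel_partition {SO3}" by (simp add: borel_partition_def SO3_sets)
  then show "{\<Sum>B\<in>\<B>. \<bar>discrete_smeas M c x B\<bar> |\<B>. borel_partition \<B>} \<noteq> {}" by blast
  fix v assume "v \<in> {\<Sum>B\<in>\<B>. \<bar>discrete_smeas M c x B\<bar> |\<B>. borel_partition \<B>}"
  then obtain \<B> where v: "v = (\<Sum>B\<in>\<B>. \<bar>discrete_smeas M c x B\<bar>)" and B: "borel_partition \<B>" by blast
  have "v \<le> (\<Sum>B\<in>\<B>. \<Sum>i<M. \<bar>c i\<bar> * indicator B (x i))"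
    unfolding v discrete_smeas_def by (intro sum_mono order_trans[OF sum_abs]) (simp add: abs_mult)
  also have "\<dots> = (\<Sum>i<M. \<bar>c i\<bar> * (\<Sum>B\<in>\<B>. indicator B (x i)))"
    by (subst sum.swap) (simp add: sum_distrib_left)
  also have "\<dots> \<le> (\<Sum>i<M. \<bar>c i\<bar> * 1)"
  proof (intro sum_mono mult_left_mono)
    fix i
    have fin: "finite \<B>" using B by (simp add: borel_partition_def)
    have "B = B'" if "B \<in> \<B>" "x i \<in> B" "B' \<in> \<B>" "x i \<in> B'" for B B'
      using that B unfolding borel_partition_def by blast
    then have "card {B\<in>\<B>. x i \<in> B} \<le> 1"
      using fin by (simp add: card_le_Suc0_iff_eq)
    moreover have "(\<Sum>B\<in>\<B>. indicator B (x i) :: real) = real (card {B\<in>\<B>. x i \<in> B})"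
      using fin by (simp add: indicator_def sum.If_cases Int_def)
    ultimately show "(\<Sum>B\<in>\<B>. indicator B (x i) :: real) \<le> 1" by simp
  qed simp
  finally show "v \<le> (\<Sum>i<M. \<bar>c i\<bar>)" by simp
qed

lemma tv_norm_swap: "tv_norm (smeas Q P) = tv_norm (smeas P Q)"
proof -
  have "\<bar>smeas Q P B\<bar> = \<bar>smeas P Q B\<bar>" for B by (simp add: smeas_def)
  then show ?thesis by (simp add: tv_norm_def)
qed

text \<open>Here Y is a positive set of a Hahn decomposition. Integrate 1 - f - e 1_A \<ge> 0 over
  Y, where P dominates, and 1 + f \<ge> 0 over the complement, where Q dominates. Adding the two
  inequalities leaves the partition into Y and its complement, which bounds the total variation from
  below. The term with e measures what is lost where f stays below 1.\<close>

lemma pairing_gap_positive_part: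
  assumes P: "fin_borel_SO3 P" and Q: "fin_borel_SO3 Q"
    and f: "f \<in> borel_measurable SO3_borel" "\<And>X. X \<in> SO3 \<Longrightarrow> \<bar>f X\<bar> \<le> 1"
    and Y: "Y \<in> sets SO3_borel"
      "\<And>X. X \<in> sets SO3_borel \<Longrightarrow> X \<subseteq> Y \<Longrightarrow> emeasure Q X \<le> emeasure P X"
      "\<And>X. X \<in> sets SO3_borel \<Longrightarrow> X \<inter> Y = {} \<Longrightarrow> emeasure P X \<le> emeasure Q X"
    and A: "A \<in> sets SO3_borel" "A \<subseteq> Y" and e: "0 \<le> e" "\<And>X. X \<in> A \<Longrightarrow> f X \<le> 1 - e"
  shows "(\<integral>X. f X \<partial>P) - (\<integral>X. f X \<partial>Q) + e * smeas P Q A \<le> tv_norm (smeas P Q)"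
proof -
  have sets: "sets P = sets SO3_borel" "sets Q = sets SO3_borel" and fin: "finite_measure P" "finite_measure Q"
    using P Q by (auto simp: fin_borel_SO3_def)
  interpret P: finite_measure P by fact
  interpret Q: finite_measure Q by fact
  note sp = space_fin_borel[OF P] space_fin_borel[OF Q]
  have YS: "Y \<subseteq> SO3" "A \<subseteq> SO3" using sets.sets_into_space[OF Y(1)] A(2) by (auto simp: SO3_borel_def space_restrict_space)
  have fm: "f \<in> borel_measurable P" "f \<in> borel_measurable Q" using f(1) sets by (simp_all cong: measurable_cong_sets)
  have Z: "SO3 - Y \<in> sets SO3_borel" using SO3_sets Y(1) by auto
  have if': "integrable R f" if "R = P \<or> R = Q" for R
  proof -
    interpret finite_measure R using that fin by auto
    show ?thesis by (rule integrable_const_bound[of _ 1]) (use that fm f(2) sp in \<open>auto intro!: AE_I2\<close>)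
  qed
  have ifY: "integrable R (\<lambda>X. indicator S X * f X)" if "R = P \<or> R = Q" "S \<in> sets SO3_borel" for R S
    using integrable_mult_indicator[OF _ if'[OF that(1)], of S] that sets by auto
  have iS: "integrable R (indicator S :: _ \<Rightarrow> real)" "(\<integral>X. indicator S X \<partial>R) = measure R S"
    if "R = P \<or> R = Q" "S \<in> sets SO3_borel" for R S
  proof -
    interpret finite_measure R using that fin by auto
    have "S \<in> sets R" using that sets by auto
    then show "integrable R (indicator S :: _ \<Rightarrow> real)" "(\<integral>X. indicator S X \<partial>R) = measure R S"
      using sets.sets_into_space by (auto simp: emeasure_eq_measure Int_absorb2)
  qed
  have 1: "measure Q Y - (\<integral>X. indicator Y X * f X \<partial>Q) - e * measure Q A \<le> measure P Y - (\<integral>X. indicator Y X * f X \<partial>P) - e * measure P A"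
  proof -
    have eq: "(\<integral>X. indicator Y X * (1 - f X - e * indicator A X) \<partial>R) = measure R Y - (\<integral>X. indicator Y X * f X \<partial>R) - e * measure R A"
      if R: "R = P \<or> R = Q" for R
    proof -
      have "(\<integral>X. indicator Y X * (1 - f X - e * indicator A X) \<partial>R) = (\<integral>X. indicator Y X - indicator Y X * f X - e * indicator A X \<partial>R)"
        by (rule Bochner_Integration.integral_cong) (use A(2) in \<open>auto simp: indicator_def\<close>)
      then show ?thesis using iS[OF R Y(1)] iS[OF R A(1)] ifY[OF R Y(1)] by simp
    qed
    have "(\<integral>X. indicator Y X * (1 - f X - e * indicator A X) \<partial>Q) \<le> (\<integral>X. indicator Y X * (1 - f X - e * indicator A X) \<partial>P)"
    proof (rule integral_indicator_mono_measure[where B = 2])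
      show "(\<lambda>X. 1 - f X - e * indicator A X) \<in> borel_measurable P"
        using fm A(1) sets by (intro borel_measurable_diff borel_measurable_times borel_measurable_indicator) auto
      fix X assume "X \<in> Y"
      then have "\<bar>f X\<bar> \<le> 1" using f(2) YS by auto
      then show "0 \<le> 1 - f X - e * indicator A X" "1 - f X - e * indicator A X \<le> 2"
        using e(1) e(2)[of X] by (auto simp: indicator_def)
    qed (use sets fin Y in auto)
    then show ?thesis using eq by simp
  qed
  have 2: "measure P (SO3 - Y) + (\<integral>X. indicator (SO3 - Y) X * f X \<partial>P) \<le> measure Q (SO3 - Y) + (\<integral>X. indicator (SO3 - Y) X * f X \<partial>Q)"
  proof -
    have eq: "(\<integral>X. indicator (SO3 - Y) X * (1 + f X) \<partial>R) = measure R (SO3 - Y) + (\<integral>X. indicator (SO3 - Y) X * f X \<partial>R)"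
      if R: "R = P \<or> R = Q" for R
      using iS[OF R Z] ifY[OF R Z] by (simp add: distrib_left)
    have "(\<integral>X. indicator (SO3 - Y) X * (1 + f X) \<partial>P) \<le> (\<integral>X. indicator (SO3 - Y) X * (1 + f X) \<partial>Q)"
    proof (rule integral_indicator_mono_measure[where B = 2])
      show "(\<lambda>X. 1 + f X) \<in> borel_measurable Q" using fm by (intro borel_measurable_add) auto
      fix X assume "X \<in> SO3 - Y"
      then have "\<bar>f X\<bar> \<le> 1" using f(2) by auto
      then show "0 \<le> 1 + f X" "1 + f X \<le> 2" by auto
    next
      show "emeasure P X \<le> emeasure Q X" if "X \<in> sets Q" "X \<subseteq> SO3 - Y" for X
        by (rule Y(3)) (use that sets in auto)
    qed (use sets fin Z in auto)
    then show ?thesis using eq by simp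
  qed
  have split: "(\<integral>X. f X \<partial>R) = (\<integral>X. indicator Y X * f X \<partial>R) + (\<integral>X. indicator (SO3 - Y) X * f X \<partial>R)"
    if R: "R = P \<or> R = Q" for R
  proof -
    have "(\<integral>X. f X \<partial>R) = (\<integral>X. indicator Y X * f X + indicator (SO3 - Y) X * f X \<partial>R)"
      by (rule Bochner_Integration.integral_cong) (use R sp in \<open>auto simp: indicator_def\<close>)
    then show ?thesis using ifY[OF R Y(1)] ifY[OF R Z] by simp
  qed
  have "(\<integral>X. f X \<partial>P) - (\<integral>X. f X \<partial>Q) + e * smeas P Q A \<le> smeas P Q Y - smeas P Q (SO3 - Y)"
    using 1 2 split by (simp add: smeas_def algebra_simps)
  also have "\<dots> \<le> \<bar>smeas P Q Y\<bar> + \<bar>smeas P Q (SO3 - Y)\<bar>" by linarith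
  also have "\<dots> = (\<Sum>B\<in>{Y, SO3 - Y}. \<bar>smeas P Q B\<bar>)"
  proof -
    \<comment> \<open>A point of SO(3) shows that Y differs from its complement, so the two cells
      are two summands.\<close>
    have "quat_rot (euler_quat 0 0 0) \<in> SO3" by (rule quat_rot_SO3[OF norm_euler_quat])
    then have "Y \<noteq> SO3 - Y" by blast
    then show ?thesis by simp
  qed
  also have "\<dots> \<le> tv_norm (smeas P Q)"
    by (rule partition_sum_le_tv_norm[OF P Q]) (use Y(1) Z YS in \<open>auto simp: borel_partition_def\<close>)
  finally show ?thesis .
qed

text \<open>The case of A outside Y is the positive case with P and Q exchanged and f negated. On
  either side \<open>smeas P Q A\<close> has a fixed sign, which gives the absolute value.\<close>

lemma pairing_gap:
  assumes P: "fin_borel_SO3 P" and Q: "fin_borel_SO3 Q"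
    and f: "f \<in> borel_measurable SO3_borel" "\<And>X. X \<in> SO3 \<Longrightarrow> \<bar>f X\<bar> \<le> 1"
  obtains Y where "Y \<in> sets SO3_borel"
    "\<And>A e. A \<in> sets SO3_borel \<Longrightarrow> 0 \<le> e \<Longrightarrow> (\<And>X. X \<in> A \<Longrightarrow> \<bar>f X\<bar> \<le> 1 - e) \<Longrightarrow> A \<subseteq> Y \<or> A \<inter> Y = {} \<Longrightarrow>
       (\<integral>X. f X \<partial>P) - (\<integral>X. f X \<partial>Q) + e * \<bar>smeas P Q A\<bar> \<le> tv_norm (smeas P Q)"
proof -
  have sets: "sets P = sets SO3_borel" "sets Q = sets SO3_borel" and fin: "finite_measure P" "finite_measure Q"
    using P Q by (auto simp: fin_borel_SO3_def)
  interpret P: finite_measure P by fact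
  interpret Q: finite_measure Q by fact
  obtain Y where Y: "Y \<in> sets SO3_borel"
      "\<And>X. X \<in> sets SO3_borel \<Longrightarrow> X \<subseteq> Y \<Longrightarrow> emeasure Q X \<le> emeasure P X"
      "\<And>X. X \<in> sets SO3_borel \<Longrightarrow> X \<inter> Y = {} \<Longrightarrow> emeasure P X \<le> emeasure Q X"
    using finite_unsigned_Hahn_decomposition[OF fin] sets by auto
  show ?thesis
  proof (rule that[OF Y(1)])
    fix A e assume A: "A \<in> sets SO3_borel" and e: "0 \<le> e" "\<And>X. X \<in> A \<Longrightarrow> \<bar>f X\<bar> \<le> 1 - e"
      and AY: "A \<subseteq> Y \<or> A \<inter> Y = {}"
    from AY show "(\<integral>X. f X \<partial>P) - (\<integral>X. f X \<partial>Q) + e * \<bar>smeas P Q A\<bar> \<le> tv_norm (smeas P Q)"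
    proof
      assume AY: "A \<subseteq> Y"
      have "f X \<le> 1 - e" if "X \<in> A" for X using e(2)[OF that] by linarith
      then have "(\<integral>X. f X \<partial>P) - (\<integral>X. f X \<partial>Q) + e * smeas P Q A \<le> tv_norm (smeas P Q)"
        by (intro pairing_gap_positive_part[OF P Q f Y A AY e(1)]) auto
      moreover have "smeas P Q A \<ge> 0"
        using Y(2)[OF A AY] by (simp add: smeas_def P.emeasure_eq_measure Q.emeasure_eq_measure)
      ultimately show ?thesis by simp
    next
      assume AY: "A \<inter> Y = {}"
      have AS: "A \<subseteq> SO3 - Y" using AY sets.sets_into_space[OF A] by (auto simp: SO3_borel_def space_restrict_space)
      have "(\<integral>X. - f X \<partial>Q) - (\<integral>X. - f X \<partial>P) + e * smeas Q P A \<le> tv_norm (smeas Q P)"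
      proof (rule pairing_gap_positive_part[OF Q P, where Y = "SO3 - Y"])
        show "(\<lambda>X. - f X) \<in> borel_measurable SO3_borel" using f(1) by simp
        show "\<bar>- f X\<bar> \<le> 1" if "X \<in> SO3" for X using f(2)[OF that] by simp
        show "SO3 - Y \<in> sets SO3_borel" using SO3_sets Y(1) by auto
        show "emeasure P X \<le> emeasure Q X" if "X \<in> sets SO3_borel" "X \<subseteq> SO3 - Y" for X
          by (rule Y(3)) (use that in auto)
        show "emeasure Q X \<le> emeasure P X" if "X \<in> sets SO3_borel" "X \<inter> (SO3 - Y) = {}" for X
          by (rule Y(2)) (use that sets.sets_into_space[OF that(1)] in \<open>auto simp: SO3_borel_def space_restrict_space\<close>)
        show "- f X \<le> 1 - e" if "X \<in> A" for X using e(2)[OF that] by linarith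
      qed (use A AS e in auto)
      moreover have "smeas Q P A = \<bar>smeas P Q A\<bar>"
        using Y(3)[OF A AY] by (simp add: smeas_def P.emeasure_eq_measure Q.emeasure_eq_measure)
      ultimately show ?thesis by (simp add: tv_norm_swap)
    qed
  qed
qed

section \<open>Minimality and uniqueness\<close>

lemma SO3_dual_certificate:
  fixes x :: "nat \<Rightarrow> real^3^3" and u :: "nat \<Rightarrow> real"
  assumes N: "N \<ge> 20" and x: "\<And>i. i < M \<Longrightarrow> x i \<in> SO3" and inj: "inj_on x {..<M}"
    and sep: "\<And>i j. i < M \<Longrightarrow> j < M \<Longrightarrow> x i \<noteq> x j \<Longrightarrow> so3_dist (x i) (x j) \<ge> 36 / (real N + 1)"
    and u: "\<And>i. i < M \<Longrightarrow> \<bar>u i\<bar> = 1"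
  obtains f where "f \<in> borel_measurable SO3_borel" "\<And>X. X \<in> SO3 \<Longrightarrow> \<bar>f X\<bar> \<le> 1"
    "\<And>i. i < M \<Longrightarrow> f (x i) = u i" "\<And>X. X \<in> SO3 \<Longrightarrow> X \<notin> x ` {..<M} \<Longrightarrow> \<bar>f X\<bar> < 1"
    "\<And>P Q c. fin_borel_SO3 P \<Longrightarrow> fin_borel_SO3 Q \<Longrightarrow>
       (\<forall>l\<le>N. \<forall>k m. \<bar>k\<bar> \<le> int l \<and> \<bar>m\<bar> \<le> int l \<longrightarrow>
          spair P Q (wigner_D l k m) = (\<Sum>i<M. of_real (c i) * wigner_D l k m (x i))) \<Longrightarrow>
       (\<integral>X. f X \<partial>P) - (\<integral>X. f X \<partial>Q) = (\<Sum>i<M. c i * f (x i))"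
proof -
  \<comment> \<open>The choice satisfies two opposite demands: 4(m - 1) + 1 \<le> N keeps the degree
    8(m - 1) + 2 within 2N, and N \<le> 4m makes the separation at least that of the locale.\<close>
  define m where "m = (N + 3) div 4"
  have m: "m \<ge> 5" "4 * (m - 1) + 1 \<le> N" "N \<le> 4 * m" using N by (auto simp: m_def)
  define p where "p i = lift (x i)" for i
  interpret separated_rotations m M p
  proof
    show "5 \<le> m" by (rule m)
    show "norm (p i) = 1" if "i < M" for i using lift(1)[OF x[OF that]] by (simp add: p_def)
    show "\<bar>p i \<bullet> p j\<bar> \<le> cos (18 / (4 * real m + 1))" if ij: "i < M" "j < M" "i \<noteq> j" for i j
    proof -
      have ne: "x i \<noteq> x j" using inj ij by (auto simp: inj_on_def)
      define t where "t = \<bar>p j \<bullet> p i\<bar>"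
      define \<phi> where "\<phi> = arccos t"
      have "norm (p i) = 1" "norm (p j) = 1" using lift(1) x ij by (auto simp: p_def)
      then have t: "0 \<le> t" "t \<le> 1" using Cauchy_Schwarz_ineq2[of "p j" "p i"] by (auto simp: t_def)
      have ph: "0 \<le> \<phi>" "\<phi> \<le> pi / 2" "cos \<phi> = t"
        using t arccos_le_pi2[of t] by (auto simp: \<phi>_def arccos_lbound cos_arccos)
      have "so3_dist (x i) (x j) = arccos (2 * t\<^sup>2 - 1)"
        using so3_dist_lift[of "x i" "x j"] x ij by (simp add: p_def t_def)
      also have "\<dots> = arccos (cos (2 * \<phi>))" by (simp add: cos_double_cos ph)
      \<comment> \<open>The absolute value in \<open>t\<close> keeps \<phi> below \<pi>/2, so that 2
        \<phi> stays in the range of \<open>arccos\<close>.\<close>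
      also have "\<dots> = 2 * \<phi>" using ph by (intro arccos_cos) auto
      finally have "36 / (real N + 1) \<le> 2 * \<phi>" using sep[OF ij(1,2) ne] by simp
      moreover have "36 / (4 * real m + 1) \<le> 36 / (real N + 1)"
        using m(3) by (intro divide_left_mono) auto
      ultimately have "18 / (4 * real m + 1) \<le> \<phi>" by simp
      moreover have "0 \<le> 18 / (4 * real m + 1)" by simp
      ultimately have "cos \<phi> \<le> cos (18 / (4 * real m + 1))"
        using ph pi_gt3 by (intro cos_monotone_0_pi_le) auto
      then show ?thesis by (simp add: ph t_def inner_commute)
    qed
  qed
  obtain z where z: "\<And>i. i < M \<Longrightarrow> q z (p i) = u i"
    "\<And>y. norm y = 1 \<Longrightarrow> (\<And>i. i < M \<Longrightarrow> y \<noteq> p i \<and> y \<noteq> - p i) \<Longrightarrow> \<bar>q z y\<bar> < 1"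
    using dual_certificate[of u] u by metis
  have pq: "pol (2 * N) (\<lambda>y. complex_of_real (q z y))"
    unfolding q_def of_real_sum
  proof (rule pol_sum)
    fix i
    have "2 + 8 * (m - 1) + 2 * (N - 1 - 4 * (m - 1)) = 2 * N" using m by auto
    then show "pol (2 * N) (\<lambda>y. complex_of_real (h z i y))"
      using pol_mono[OF pol_bump[of m "fst (z i)" "real m *\<^sub>R proj (p i) (snd (z i))" "p i"], of "N - 1 - 4 * (m - 1)"] m
      unfolding h_def by simp
  qed simp
  have cq: "continuous_on UNIV (q z)"
    using continuous_on_Re[OF pol_continuous[OF pq]] by simp
  define f where "f X = q z (lift X)" for X
  have off: "\<bar>f X\<bar> < 1" if X: "X \<in> SO3" "X \<notin> x ` {..<M}" for X
    unfolding f_def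
  proof (rule z(2)[OF lift(1)[OF X(1)]])
    fix i assume i: "i < M"
    have "x i \<noteq> X" using X(2) i by auto
    then have "quat_rot (p i) \<noteq> quat_rot (lift X)" using lift(2)[OF X(1)] lift(2)[OF x[OF i]] by (simp add: p_def)
    then show "lift X \<noteq> p i \<and> lift X \<noteq> - p i"
      using quat_rot_eq_iff[OF lift(1)[OF X(1)] lift(1)[OF x[OF i]]] by (simp add: p_def)
  qed
  have on: "f (x i) = u i" if "i < M" for i using z(1)[OF that] by (simp add: f_def p_def)
  show ?thesis
  proof (rule that[of f])
    show "f \<in> borel_measurable SO3_borel"
      unfolding SO3_borel_def f_def
      by (rule borel_measurable_continuous_on_restrict[OF continuous_on_lift[OF cq q_uminus]])
    show "\<bar>f X\<bar> \<le> 1" if "X \<in> SO3" for X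
      using off[OF that] on u by (cases "X \<in> x ` {..<M}") auto
  next
    fix P Q c
    assume PQ: "fin_borel_SO3 P" "fin_borel_SO3 Q"
      and D: "\<forall>l\<le>N. \<forall>k m. \<bar>k\<bar> \<le> int l \<and> \<bar>m\<bar> \<le> int l \<longrightarrow>
          spair P Q (wigner_D l k m) = (\<Sum>i<M. of_real (c i) * wigner_D l k m (x i))"
    have "spair P Q (\<lambda>X. complex_of_real (q z (lift X))) = (\<Sum>i<M. of_real (c i) * complex_of_real (q z (lift (x i))))"
      by (rule moments_agree[OF PQ _ _ pq]) (use x D in auto)
    then have "complex_of_real ((\<integral>X. f X \<partial>P) - (\<integral>X. f X \<partial>Q)) = complex_of_real (\<Sum>i<M. c i * f (x i))"
      by (simp add: spair_def f_def)
    then show "(\<integral>X. f X \<partial>P) - (\<integral>X. f X \<partial>Q) = (\<Sum>i<M. c i * f (x i))"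
      by (simp only: of_real_eq_iff)
  qed (use on off in auto)
qed

lemma finite_sets_SO3:
  assumes "finite C" "C \<subseteq> SO3"
  shows "C \<in> sets SO3_borel"
proof -
  have "C \<in> sets borel" using assms(1) by (intro borel_closed finite_imp_closed)
  then show ?thesis
    using assms(2) by (auto simp: SO3_borel_def sets_restrict_space intro!: image_eqI[of _ _ C])
qed

text \<open>P and Q agree on all measurable sets off C, so integrals over \<open>SO3 - C\<close>
  agree, by the comparison lemma used in both directions. That lemma asks for a nonnegative
  integrand, hence 1 + f in place of f; the constant cancels again when total masses are
  split.\<close>

lemma supported_pairing:
  assumes P: "fin_borel_SO3 P" and Q: "fin_borel_SO3 Q" and C: "finite C" "C \<subseteq> SO3"
    and null: "\<And>A. A \<in> sets SO3_borel \<Longrightarrow> A \<inter> C = {} \<Longrightarrow> smeas P Q A = 0"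
    and f: "f \<in> borel_measurable SO3_borel" "\<And>X. X \<in> SO3 \<Longrightarrow> \<bar>f X\<bar> \<le> 1"
  shows "(\<integral>X. f X \<partial>P) - (\<integral>X. f X \<partial>Q) = (\<Sum>X\<in>C. smeas P Q {X} * f X)"
proof -
  have sets: "sets P = sets SO3_borel" "sets Q = sets SO3_borel" and fin: "finite_measure P" "finite_measure Q"
    using P Q by (auto simp: fin_borel_SO3_def)
  note sp = space_fin_borel[OF P] space_fin_borel[OF Q]
  note CS = finite_sets_SO3[OF C]
  have Y: "SO3 - C \<in> sets SO3_borel" using CS SO3_sets by auto
  have eqm: "emeasure P X = emeasure Q X" if "X \<in> sets SO3_borel" "X \<subseteq> SO3 - C" for X
  proof -
    interpret P: finite_measure P by fact
    interpret Q: finite_measure Q by fact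
    have "smeas P Q X = 0" using that by (intro null) auto
    then show ?thesis by (simp add: smeas_def P.emeasure_eq_measure Q.emeasure_eq_measure)
  qed
  have fm: "f \<in> borel_measurable P" "f \<in> borel_measurable Q" using f(1) sets by (simp_all cong: measurable_cong_sets)
  have dec: "(\<integral>X. 1 + f X \<partial>R) = (\<integral>X. indicator (SO3 - C) X * (1 + f X) \<partial>R) + (\<Sum>X\<in>C. measure R {X} * (1 + f X))"
      "(\<integral>X. 1 + f X \<partial>R) = measure R SO3 + (\<integral>X. f X \<partial>R)"
      "measure R SO3 = measure R (SO3 - C) + (\<Sum>X\<in>C. measure R {X})" if R: "R = P \<or> R = Q" for R
  proof -
    interpret finite_measure R using R fin by auto
    have spR: "space R = SO3" and fR: "f \<in> borel_measurable R" and sR: "sets R = sets SO3_borel"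
      using R sp fm sets by auto
    have if': "integrable R f"
      by (rule integrable_const_bound[of _ 1]) (use fR f(2) spR in \<open>auto intro!: AE_I2\<close>)
    have i1: "integrable R (\<lambda>X. 1 + f X)" using if' by simp
    have i2: "integrable R (\<lambda>X. indicator (SO3 - C) X * (1 + f X))"
      using integrable_mult_indicator[OF _ i1, of "SO3 - C"] Y sR by simp
    have sg: "{X} \<in> sets R" if "X \<in> C" for X using finite_sets_SO3[of "{X}"] that C sR by auto
    have "(\<integral>X. 1 + f X \<partial>R) = (\<integral>X. indicator (SO3 - C) X * (1 + f X) + (\<Sum>W\<in>C. indicator {W} X * (1 + f W)) \<partial>R)"
    proof (rule Bochner_Integration.integral_cong[OF refl])
      fix X assume "X \<in> space R"
      have "(\<Sum>W\<in>C. indicator {W} X * (1 + f W)) = (if X \<in> C then 1 + f X else 0)"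
      proof -
        have "(\<Sum>W\<in>C. indicator {W} X * (1 + f W)) = (\<Sum>W\<in>C. if W = X then 1 + f W else 0)"
          by (rule sum.cong) (auto simp: indicator_def)
        then show ?thesis using C(1) by (simp add: sum.delta)
      qed
      then show "1 + f X = indicator (SO3 - C) X * (1 + f X) + (\<Sum>W\<in>C. indicator {W} X * (1 + f W))"
        using \<open>X \<in> space R\<close> spR by (auto simp: indicator_def)
    qed
    also have "\<dots> = (\<integral>X. indicator (SO3 - C) X * (1 + f X) \<partial>R) + (\<integral>X. (\<Sum>W\<in>C. indicator {W} X * (1 + f W)) \<partial>R)"
      by (rule Bochner_Integration.integral_add[OF i2])
        (use sg in \<open>auto intro!: Bochner_Integration.integrable_sum integrable_mult_left simp: emeasure_eq_measure\<close>)
    also have "(\<integral>X. (\<Sum>W\<in>C. indicator {W} X * (1 + f W)) \<partial>R) = (\<Sum>W\<in>C. (\<integral>X. indicator {W} X * (1 + f W) \<partial>R))"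
      by (rule Bochner_Integration.integral_sum) (use sg in \<open>auto simp: emeasure_eq_measure\<close>)
    also have "\<dots> = (\<Sum>X\<in>C. measure R {X} * (1 + f X))"
      by (rule sum.cong) (use sg spR C in \<open>auto simp: Int_absorb2\<close>)
    finally show "(\<integral>X. 1 + f X \<partial>R) = (\<integral>X. indicator (SO3 - C) X * (1 + f X) \<partial>R) + (\<Sum>X\<in>C. measure R {X} * (1 + f X))" .
    show "(\<integral>X. 1 + f X \<partial>R) = measure R SO3 + (\<integral>X. f X \<partial>R)"
      using if' by (simp add: spR)
    have "measure R C = (\<Sum>X\<in>C. measure R {X})"
      using C sg by (intro finite_measure_eq_sum_singleton) auto
    moreover have "measure R (SO3 - C) = measure R SO3 - measure R C"
      using C CS SO3_sets sR by (intro finite_measure_Diff) auto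
    ultimately show "measure R SO3 = measure R (SO3 - C) + (\<Sum>X\<in>C. measure R {X})" by simp
  qed
  have le: "(\<integral>X. indicator (SO3 - C) X * (1 + f X) \<partial>R) \<le> (\<integral>X. indicator (SO3 - C) X * (1 + f X) \<partial>R')"
    if R: "R = P \<and> R' = Q \<or> R = Q \<and> R' = P" for R R'
  proof (rule integral_indicator_mono_measure[where B = 2])
    show "(\<lambda>X. 1 + f X) \<in> borel_measurable R'" using R fm by (intro borel_measurable_add) auto
    show "emeasure R X \<le> emeasure R' X" if "X \<in> sets R'" "X \<subseteq> SO3 - C" for X
      using eqm[of X] that R sets by auto
    fix X assume "X \<in> SO3 - C"
    then have "\<bar>f X\<bar> \<le> 1" using f(2) by auto
    then show "0 \<le> 1 + f X" "1 + f X \<le> 2" by auto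
  qed (use R sets fin Y in auto)
  have "(\<integral>X. indicator (SO3 - C) X * (1 + f X) \<partial>P) = (\<integral>X. indicator (SO3 - C) X * (1 + f X) \<partial>Q)"
    using le[of P Q] le[of Q P] by auto
  moreover have "measure P (SO3 - C) = measure Q (SO3 - C)"
    using null[OF Y] by (simp add: smeas_def Int_commute)
  ultimately show ?thesis
    using dec[of P] dec[of Q]
    by (simp add: smeas_def algebra_simps sum.distrib sum_subtractf)
qed

theorem theorem2p1:
  fixes N M :: nat and c :: "nat \<Rightarrow> real" and x :: "nat \<Rightarrow> real^3^3"
  assumes N: "N \<ge> 20"
    and xSO3: "\<forall>i<M. x i \<in> SO3"
    and distinct: "inj_on x {..<M}"
    and sep: "\<forall>i<M. \<forall>j<M. x i \<noteq> x j \<longrightarrow> so3_dist (x i) (x j) \<ge> 36 / (real N + 1)"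
  shows "\<forall>P Q. fin_borel_SO3 P \<and> fin_borel_SO3 Q \<and>
            (\<forall>l\<le>N. \<forall>k m. \<bar>k\<bar> \<le> int l \<and> \<bar>m\<bar> \<le> int l \<longrightarrow>
               spair P Q (wigner_D l k m) = (\<Sum>i<M. of_real (c i) * wigner_D l k m (x i)))
          \<longrightarrow> tv_norm (discrete_smeas M c x) \<le> tv_norm (smeas P Q) \<and>
              (tv_norm (smeas P Q) = tv_norm (discrete_smeas M c x) \<longrightarrow>
                 (\<forall>A \<in> sets SO3_borel. smeas P Q A = discrete_smeas M c x A))"
proof (intro allI impI, elim conjE)
  fix P Q
  assume P: "fin_borel_SO3 P" and Q: "fin_borel_SO3 Q"
    and D: "\<forall>l\<le>N. \<forall>k m. \<bar>k\<bar> \<le> int l \<and> \<bar>m\<bar> \<le> int l \<longrightarrow>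
               spair P Q (wigner_D l k m) = (\<Sum>i<M. of_real (c i) * wigner_D l k m (x i))"
  have sets: "sets P = sets SO3_borel" "sets Q = sets SO3_borel" and fin: "finite_measure P" "finite_measure Q"
    using P Q by (auto simp: fin_borel_SO3_def)
  interpret P: finite_measure P by fact
  interpret Q: finite_measure Q by fact
  have x: "x i \<in> SO3" if "i < M" for i using xSO3 that by blast
  have sep': "so3_dist (x i) (x j) \<ge> 36 / (real N + 1)" if "i < M" "j < M" "x i \<noteq> x j" for i j
    using sep that by blast
  \<comment> \<open>The value at 0 is 1, so that every node receives a sign of modulus 1, as the
    certificate requires.\<close>
  define sg where "sg t = (if t \<ge> 0 then 1 else - 1 :: real)" for t :: real
  have sg: "\<bar>sg t\<bar> = 1" "t * sg t = \<bar>t\<bar>" for t by (auto simp: sg_def)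
  \<comment> \<open>Kept general in the signs: it is used for the signs of \<open>c\<close> here and
    for a different pattern in the uniqueness argument.\<close>
  have cert: "\<exists>f. f \<in> borel_measurable SO3_borel \<and> (\<forall>X\<in>SO3. \<bar>f X\<bar> \<le> 1) \<and> (\<forall>i<M. f (x i) = u i) \<and>
      (\<forall>X\<in>SO3. X \<notin> x ` {..<M} \<longrightarrow> \<bar>f X\<bar> < 1) \<and> (\<integral>X. f X \<partial>P) - (\<integral>X. f X \<partial>Q) = (\<Sum>i<M. c i * f (x i))"
    if u: "\<And>i. \<bar>u i\<bar> = 1" for u
  proof (rule SO3_dual_certificate[of N M x u])
    fix f
    assume f: "f \<in> borel_measurable SO3_borel" "\<And>X. X \<in> SO3 \<Longrightarrow> \<bar>f X\<bar> \<le> 1"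
      "\<And>i. i < M \<Longrightarrow> f (x i) = u i" "\<And>X. X \<in> SO3 \<Longrightarrow> X \<notin> x ` {..<M} \<Longrightarrow> \<bar>f X\<bar> < 1"
      and fD: "\<And>P Q c. fin_borel_SO3 P \<Longrightarrow> fin_borel_SO3 Q \<Longrightarrow>
       (\<forall>l\<le>N. \<forall>k m. \<bar>k\<bar> \<le> int l \<and> \<bar>m\<bar> \<le> int l \<longrightarrow>
          spair P Q (wigner_D l k m) = (\<Sum>i<M. of_real (c i) * wigner_D l k m (x i))) \<Longrightarrow>
       (\<integral>X. f X \<partial>P) - (\<integral>X. f X \<partial>Q) = (\<Sum>i<M. c i * f (x i))"
    show ?thesis using f fD[OF P Q D] by blast
  qed (use N x distinct sep' u in auto)
  obtain f where f: "f \<in> borel_measurable SO3_borel" "\<And>X. X \<in> SO3 \<Longrightarrow> \<bar>f X\<bar> \<le> 1"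
    "\<And>i. i < M \<Longrightarrow> f (x i) = sg (c i)" "\<And>X. X \<in> SO3 \<Longrightarrow> X \<notin> x ` {..<M} \<Longrightarrow> \<bar>f X\<bar> < 1"
    and fD: "(\<integral>X. f X \<partial>P) - (\<integral>X. f X \<partial>Q) = (\<Sum>i<M. c i * f (x i))"
    using cert[of "\<lambda>i. sg (c i)"] sg(1) by blast
  have I: "(\<integral>X. f X \<partial>P) - (\<integral>X. f X \<partial>Q) = (\<Sum>i<M. \<bar>c i\<bar>)"
    unfolding fD by (rule sum.cong) (auto simp: f(3) sg)
  obtain Y where Y: "Y \<in> sets SO3_borel" and
    gap: "\<And>A e. A \<in> sets SO3_borel \<Longrightarrow> 0 \<le> e \<Longrightarrow> (\<And>X. X \<in> A \<Longrightarrow> \<bar>f X\<bar> \<le> 1 - e) \<Longrightarrow> A \<subseteq> Y \<or> A \<inter> Y = {} \<Longrightarrow>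
       (\<integral>X. f X \<partial>P) - (\<integral>X. f X \<partial>Q) + e * \<bar>smeas P Q A\<bar> \<le> tv_norm (smeas P Q)"
    using pairing_gap[OF P Q f(1,2)] by blast
  have le: "(\<Sum>i<M. \<bar>c i\<bar>) \<le> tv_norm (smeas P Q)"
    using gap[of "{}" 0] by (simp add: I)
  have "(\<forall>A \<in> sets SO3_borel. smeas P Q A = discrete_smeas M c x A)"
    if eq: "tv_norm (smeas P Q) = tv_norm (discrete_smeas M c x)"
  proof -
    have tv: "tv_norm (smeas P Q) = (\<Sum>i<M. \<bar>c i\<bar>)" using le eq tv_norm_discrete_le[of M c x] by simp
    have null1: "smeas P Q A = 0"
      if A: "A \<in> sets SO3_borel" "A \<inter> x ` {..<M} = {}" "A \<subseteq> Y \<or> A \<inter> Y = {}" for A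
    proof -
      \<comment> \<open>Equality of the norms makes the gap inequality tight, so each set on which f
        stays away from modulus 1 by a fixed amount is null. These sets exhaust A because |f| < 1
        off the nodes.\<close>
      define An where "An n = A \<inter> {X\<in>space SO3_borel. \<bar>f X\<bar> \<le> 1 - 1 / real (Suc n)}" for n
      have AS: "A \<subseteq> SO3" using sets.sets_into_space[OF A(1)] by (simp add: SO3_borel_def space_restrict_space)
      have An: "An n \<in> sets SO3_borel" for n
        unfolding An_def using A(1) f(1) by measurable
      have inc: "incseq An"
      proof (rule incseq_SucI)
        fix n
        have "1 / real (Suc (Suc n)) \<le> 1 / real (Suc n)" by (intro divide_left_mono) auto
        then show "An n \<subseteq> An (Suc n)" unfolding An_def by auto
      qed
      have un: "(\<Union>n. An n) = A"
      proof (intro equalityI subsetI)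
        fix X assume X: "X \<in> A"
        then have "\<bar>f X\<bar> < 1" using f(4)[of X] A(2) AS by auto
        then obtain n where "1 / real (Suc n) < 1 - \<bar>f X\<bar>" using nat_approx_posE[of "1 - \<bar>f X\<bar>"] by (metis diff_gt_0_iff_gt)
        then have "X \<in> An n" using X AS by (auto simp: An_def SO3_borel_def space_restrict_space)
        then show "X \<in> (\<Union>n. An n)" by blast
      qed (auto simp: An_def)
      have "smeas P Q (An n) = 0" for n
      proof -
        have "(\<integral>X. f X \<partial>P) - (\<integral>X. f X \<partial>Q) + 1 / real (Suc n) * \<bar>smeas P Q (An n)\<bar> \<le> tv_norm (smeas P Q)"
          by (rule gap[OF An]) (use A(3) in \<open>auto simp: An_def\<close>)
        then have "1 / real (Suc n) * \<bar>smeas P Q (An n)\<bar> \<le> 0" by (simp add: I tv)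
        then show ?thesis by (simp add: divide_le_0_iff)
      qed
      then have e: "measure P (An n) = measure Q (An n)" for n by (simp add: smeas_def)
      have "(\<lambda>n. measure P (An n)) \<longlonglongrightarrow> measure P (\<Union>n. An n)"
        by (rule P.finite_Lim_measure_incseq) (use An inc sets in auto)
      moreover have "(\<lambda>n. measure Q (An n)) \<longlonglongrightarrow> measure Q (\<Union>n. An n)"
        by (rule Q.finite_Lim_measure_incseq) (use An inc sets in auto)
      ultimately have "measure P A = measure Q A" unfolding un e by (rule LIMSEQ_unique)
      then show ?thesis by (simp add: smeas_def)
    qed
    have add: "smeas P Q A = smeas P Q (A \<inter> B) + smeas P Q (A - B)"
      if "A \<in> sets SO3_borel" "B \<in> sets SO3_borel" for A B
      using that sets by (simp add: smeas_def P.finite_measure_Diff' Q.finite_measure_Diff')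
    have null: "smeas P Q A = 0" if A: "A \<in> sets SO3_borel" "A \<inter> x ` {..<M} = {}" for A
    proof -
      have "smeas P Q (A \<inter> Y) = 0" "smeas P Q (A - Y) = 0" by (rule null1; use A Y in auto)+
      then show ?thesis using add[OF A(1) Y] by simp
    qed
    define C where "C = x ` {..<M}"
    have C: "finite C" "C \<subseteq> SO3" using x by (auto simp: C_def)
    define d where "d i = smeas P Q {x i}" for i
    have sumC: "(\<Sum>X\<in>C. g X) = (\<Sum>i<M. g (x i))" for g :: "real^3^3 \<Rightarrow> real"
      unfolding C_def by (rule sum.reindex_cong[OF distinct]) auto
    \<comment> \<open>Now P - Q lives on the nodes with weights \<open>d\<close>. A certificate with
      the signs of d - c turns the equality of pairings into a vanishing sum of |d - c|.\<close>
    obtain g where g: "g \<in> borel_measurable SO3_borel" "\<And>X. X \<in> SO3 \<Longrightarrow> \<bar>g X\<bar> \<le> 1"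
      "\<And>i. i < M \<Longrightarrow> g (x i) = sg (d i - c i)"
      and gD: "(\<integral>X. g X \<partial>P) - (\<integral>X. g X \<partial>Q) = (\<Sum>i<M. c i * g (x i))"
      using cert[of "\<lambda>i. sg (d i - c i)"] sg(1) by blast
    have "(\<integral>X. g X \<partial>P) - (\<integral>X. g X \<partial>Q) = (\<Sum>X\<in>C. smeas P Q {X} * g X)"
      by (rule supported_pairing[OF P Q C]) (use null g in \<open>auto simp: C_def\<close>)
    then have "(\<Sum>i<M. d i * g (x i)) = (\<Sum>i<M. c i * g (x i))" using gD by (simp add: sumC d_def)
    then have "(\<Sum>i<M. (d i - c i) * g (x i)) = 0" by (simp add: left_diff_distrib sum_subtractf)
    moreover have "(\<Sum>i<M. (d i - c i) * g (x i)) = (\<Sum>i<M. \<bar>d i - c i\<bar>)"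
      by (rule sum.cong) (auto simp: g(3) sg)
    ultimately have dc: "d i = c i" if "i < M" for i
      using sum_nonneg_eq_0_iff[of "{..<M}" "\<lambda>i. \<bar>d i - c i\<bar>"] that by auto
    show ?thesis
    proof
      fix A assume A: "A \<in> sets SO3_borel"
      note CS = finite_sets_SO3[OF C]
      have "smeas P Q A = smeas P Q (A \<inter> C)"
        using add[OF A CS] null[of "A - C"] A CS by (auto simp: C_def)
      also have "\<dots> = (\<Sum>X\<in>A \<inter> C. smeas P Q {X})"
      proof -
        have "measure R (A \<inter> C) = (\<Sum>X\<in>A \<inter> C. measure R {X})" if "R = P \<or> R = Q" for R
        proof -
          interpret finite_measure R using that fin by auto
          have "{X} \<in> sets R" if "X \<in> A \<inter> C" for X
            using finite_sets_SO3[of "{X}"] that C \<open>R = P \<or> R = Q\<close> sets by auto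
          then show ?thesis using C by (intro finite_measure_eq_sum_singleton) auto
        qed
        then show ?thesis by (simp add: smeas_def sum_subtractf)
      qed
      also have "\<dots> = (\<Sum>X\<in>C. smeas P Q {X} * indicator A X)"
        using C(1) by (simp add: indicator_def sum.If_cases Int_commute if_distrib[of "\<lambda>t. _ * t"] cong: if_cong)
      also have "\<dots> = (\<Sum>i<M. d i * indicator A (x i))" by (simp add: sumC d_def)
      also have "\<dots> = discrete_smeas M c x A" by (simp add: discrete_smeas_def dc)
      finally show "smeas P Q A = discrete_smeas M c x A" .
    qed
  qed
  then show "tv_norm (discrete_smeas M c x) \<le> tv_norm (smeas P Q) \<and>
              (tv_norm (smeas P Q) = tv_norm (discrete_smeas M c x) \<longrightarrow>
                 (\<forall>A \<in> sets SO3_borel. smeas P Q A = discrete_smeas M c x A))"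
    using le tv_norm_discrete_le[of M c x] by linarith
qed

end
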